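(* Let $n\ge 3$ and let $M$ be a closed hyperbolic $n$-manifold with injectivity radius $\mathbf{i}_M$. There exist constants $C,\delta_0>0$, depending only on $M$, such that $$\Lambda\left(\mathcal{K}^{\delta}_{r,\epsilon}\right)\le C\,\delta^{n-2}r^2$$ for every $r\ge 10\,\mathbf{i}_M$, every $0<\delta\le\delta_0$, and every $\epsilon>0$, where $\mathcal{K}^{\delta}_{r,\epsilon}$ is the set of $(r,\epsilon,\delta)$-tight unit tangent vectors of $M$.
   Context: Let $\mathcal{T}=T^1M$ be the unit tangent bundle, $\pi:\mathcal{T}\to M$ the projection, $d_{\mathcal{T}}$ the distance on $\mathcal{T}$ induced by the Sasaki Riemannian metric, $\Lambda$ the Liouville probability measure on $\mathcal{T}$, $\mathbf{g}_t:\mathcal{T}\to\mathcal{T}$ the geodesic flow, and $d_M$ the hyperbolic distance on $M$. For $r,\epsilon,\delta>0$, a vector $v\in\mathcal{T}$ is $(r,\epsilon,\delta)$-tight if $d_{\mathcal{T}}(v,\mathbf{g}_r(v))<\epsilon$ and $d_M(\pi(\mathbf{g}_s(v)),\pi(\mathbf{g}_t(v)))<\delta$ for some $s,t\in[\frac{r}{10},\frac{9r}{10}]$ with $|s-t|\ge\mathbf{i}_M$. *)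

theory Defs
  imports "HOL-Analysis.Analysis"
begin

text \<open>
  Hyperbolic space is the hyperboloid model in Minkowski space $R \times R^n$, whose first
  coordinate is the time-like one. A closed hyperbolic manifold is $M = \Gamma \backslash H^n$,
  where $\Gamma$ is a group of isometries acting freely, properly discontinuously and cocompactly.
  Points of $M$ and of $T^1 M$ are $\Gamma$-orbits of points and of unit tangent vectors of $H^n$.
\<close>

type_synonym 'n mink = "real \<times> (real ^ 'n)"

definition mink_inner :: "'n::finite mink \<Rightarrow> 'n mink \<Rightarrow> real" where
  "mink_inner x y = snd x \<bullet> snd y - fst x * fst y"

definition mink_norm :: "'n::finite mink \<Rightarrow> real" where
  "mink_norm v = sqrt (mink_inner v v)"

definition hyp_space :: "'n::finite mink set" where
  "hyp_space = {x. mink_inner x x = -1 \<and> 0 < fst x}"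

definition hyp_dist :: "'n::finite mink \<Rightarrow> 'n mink \<Rightarrow> real" where
  "hyp_dist x y = arcosh (- mink_inner x y)"

definition tangent_space :: "'n::finite mink \<Rightarrow> 'n mink set" where
  "tangent_space x = {v. mink_inner x v = 0}"

definition hyp_exp :: "'n::finite mink \<Rightarrow> 'n mink \<Rightarrow> 'n mink" where
  "hyp_exp x v = cosh (mink_norm v) *\<^sub>R x + (sinh (mink_norm v) / mink_norm v) *\<^sub>R v"

definition unit_tangent :: "('n::finite mink \<times> 'n mink) set" where
  "unit_tangent = {(x, v). x \<in> hyp_space \<and> v \<in> tangent_space x \<and> mink_norm v = 1}"

definition hyp_flow :: "real \<Rightarrow> 'n::finite mink \<times> 'n mink \<Rightarrow> 'n mink \<times> 'n mink" where
  "hyp_flow t = (\<lambda>(x, v). (cosh t *\<^sub>R x + sinh t *\<^sub>R v, sinh t *\<^sub>R x + cosh t *\<^sub>R v))"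

text \<open>
  The Sasaki norm of the velocity $(x', v')$ of a curve $(x, v)$ in the tangent bundle is
  $(|x'|^2 + |D v|^2)^{1/2}$, with $D v$ the covariant derivative of $v$ along $x$. As $x$ is a
  normal vector of the hyperboloid at $x$ and has square $-1$, the tangential part $D v$ of
  $v'$ is $v' + \langle v', x \rangle x$.
\<close>

definition covariant_deriv :: "'n::finite mink \<Rightarrow> 'n mink \<Rightarrow> 'n mink" where
  "covariant_deriv x v' = v' + mink_inner v' x *\<^sub>R x"

definition sasaki_norm :: "'n::finite mink \<times> 'n mink \<Rightarrow> 'n mink \<times> 'n mink \<Rightarrow> real" where
  "sasaki_norm = (\<lambda>(x, v) (x', v').
     sqrt ((mink_norm x')\<^sup>2 + (mink_norm (covariant_deriv x v'))\<^sup>2))"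

definition sasaki_length :: "(real \<Rightarrow> 'n::finite mink \<times> 'n mink) \<Rightarrow> real" where
  "sasaki_length c = integral {0..1} (\<lambda>t. sasaki_norm (c t) (vector_derivative c (at t)))"

text \<open>
  Only curves with a continuous derivative on the whole of $[0,1]$ are used. The library's
  \<open>valid_path\<close> allows the derivative to blow up at finitely many points, and the
  integral of a non-integrable speed would be \<open>0\<close>.
\<close>

definition sasaki_dist :: "'n::finite mink \<times> 'n mink \<Rightarrow> 'n mink \<times> 'n mink \<Rightarrow> real" where
  "sasaki_dist p q = Inf {sasaki_length c | c.
     c C1_differentiable_on {0..1} \<and> c ` {0..1} \<subseteq> unit_tangent \<and> c 0 = p \<and> c 1 = q}"

text \<open>
  Isometries of $H^n$ are represented by the linear maps that preserve the Minkowski form and the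
  hyperboloid, so that an isometry is its own differential.
\<close>

definition hyp_isometry :: "('n::finite mink \<Rightarrow> 'n mink) \<Rightarrow> bool" where
  "hyp_isometry f \<longleftrightarrow> linear f \<and> (\<forall>x y. mink_inner (f x) (f y) = mink_inner x y)
     \<and> f ` hyp_space = hyp_space"

definition closed_hyperbolic_manifold :: "('n::finite mink \<Rightarrow> 'n mink) set \<Rightarrow> bool" where
  "closed_hyperbolic_manifold \<Gamma> \<longleftrightarrow>
     (\<forall>f\<in>\<Gamma>. hyp_isometry f) \<and>
     id \<in> \<Gamma> \<and> (\<forall>f\<in>\<Gamma>. \<forall>g\<in>\<Gamma>. f \<circ> g \<in> \<Gamma>) \<and> (\<forall>f\<in>\<Gamma>. inv f \<in> \<Gamma>) \<and>
     (\<forall>f\<in>\<Gamma>. f \<noteq> id \<longrightarrow> (\<forall>x\<in>hyp_space. f x \<noteq> x)) \<and>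
     (\<forall>K. compact K \<and> K \<subseteq> hyp_space \<longrightarrow> finite {f \<in> \<Gamma>. f ` K \<inter> K \<noteq> {}}) \<and>
     (\<exists>K. compact K \<and> K \<subseteq> hyp_space \<and> (\<Union>f\<in>\<Gamma>. f ` K) = hyp_space)"

definition point_class :: "('n::finite mink \<Rightarrow> 'n mink) set \<Rightarrow> 'n mink \<Rightarrow> 'n mink set" where
  "point_class \<Gamma> x = (\<lambda>f. f x) ` \<Gamma>"

definition vector_class ::
    "('n::finite mink \<Rightarrow> 'n mink) set \<Rightarrow> 'n mink \<times> 'n mink \<Rightarrow> ('n mink \<times> 'n mink) set" where
  "vector_class \<Gamma> p = (\<lambda>f. map_prod f f p) ` \<Gamma>"

definition unit_tangent_bundle ::
    "('n::finite mink \<Rightarrow> 'n mink) set \<Rightarrow> ('n mink \<times> 'n mink) set set" where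
  "unit_tangent_bundle \<Gamma> = vector_class \<Gamma> ` unit_tangent"

text \<open>
  The flow and the projection are equivariant, so the induced maps on orbits are images of sets.
  The distances on $M$ and $T^1 M$ are those of the quotient Riemannian metrics: by lifting of
  curves, the infimum of the distances between representatives.
\<close>

definition geodesic_flow :: "real \<Rightarrow> ('n::finite mink \<times> 'n mink) set \<Rightarrow> ('n mink \<times> 'n mink) set" where
  "geodesic_flow t v = hyp_flow t ` v"

definition base_proj :: "('n::finite mink \<times> 'n mink) set \<Rightarrow> 'n mink set" where
  "base_proj v = fst ` v"

definition dist_M :: "'n::finite mink set \<Rightarrow> 'n mink set \<Rightarrow> real" where
  "dist_M X Y = Inf {hyp_dist x y | x y. x \<in> X \<and> y \<in> Y}"

definition dist_T :: "('n::finite mink \<times> 'n mink) set \<Rightarrow> ('n mink \<times> 'n mink) set \<Rightarrow> real" where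
  "dist_T v w = Inf {sasaki_dist p q | p q. p \<in> v \<and> q \<in> w}"

text \<open>
  The exponential map of $M$ is a local diffeomorphism in curvature $-1$, so it is a diffeomorphism
  from an open ball onto its image if and only if it is injective on that ball.
\<close>

definition inj_radius_at :: "('n::finite mink \<Rightarrow> 'n mink) set \<Rightarrow> 'n mink \<Rightarrow> real" where
  "inj_radius_at \<Gamma> x = Sup {\<rho>. 0 < \<rho> \<and>
     inj_on (\<lambda>v. point_class \<Gamma> (hyp_exp x v)) {v \<in> tangent_space x. mink_norm v < \<rho>}}"

definition inj_radius :: "('n::finite mink \<Rightarrow> 'n mink) set \<Rightarrow> real" where
  "inj_radius \<Gamma> = Inf (inj_radius_at \<Gamma> ` hyp_space)"

text \<open>
  Over the chart \<open>hyp_chart\<close> of $H^n$ the Riemannian metric is $I - y y^T / (1 + |y|^2)$, with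
  volume density $(1 + |y|^2)^{-1/2}$. The map \<open>boost y\<close> is a linear isometry from $R^n$ onto the
  tangent space at \<open>hyp_chart y\<close>, so it carries the measure of the unit sphere to that of
  the fibre of the unit tangent bundle. The measure of the unit sphere is, up to the factor $n$,
  the radial image of Lebesgue measure on the punctured unit ball.
\<close>

definition hyp_chart :: "real ^ 'n::finite \<Rightarrow> 'n mink" where
  "hyp_chart y = (sqrt (1 + (norm y)\<^sup>2), y)"

definition boost :: "real ^ 'n::finite \<Rightarrow> real ^ 'n \<Rightarrow> 'n mink" where
  "boost y u = (y \<bullet> u, u + ((y \<bullet> u) / (1 + sqrt (1 + (norm y)\<^sup>2))) *\<^sub>R y)"

definition hyp_volume :: "(real ^ 'n::finite) measure" where
  "hyp_volume = density lborel (\<lambda>y. ennreal (1 / sqrt (1 + (norm y)\<^sup>2)))"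

definition sphere_measure :: "(real ^ 'n::finite) measure" where
  "sphere_measure = distr (restrict_space lborel (ball 0 1 - {0}))
     (restrict_space borel (sphere 0 1)) (\<lambda>u. u /\<^sub>R norm u)"

definition liouville_cover :: "('n::finite mink \<times> 'n mink) measure" where
  "liouville_cover = distr (hyp_volume \<Otimes>\<^sub>M sphere_measure)
     (restrict_space borel unit_tangent) (\<lambda>(y, u). (hyp_chart y, boost y u))"

text \<open>
  The Liouville probability measure on $T^1 M$ is the image of the normalised restriction of the
  $\Gamma$-invariant measure \<open>liouville_cover\<close> to the vectors based in a fundamental domain for
  $\Gamma$, here the Dirichlet domain centred at $(1, 0)$, whose boundary is a null set.
\<close>

definition dirichlet_domain ::
    "('n::finite mink \<Rightarrow> 'n mink) set \<Rightarrow> ('n mink \<times> 'n mink) set" where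
  "dirichlet_domain \<Gamma> =
     {(x, v) \<in> unit_tangent. \<forall>f\<in>\<Gamma>. hyp_dist (1, 0) x \<le> hyp_dist (1, 0) (f x)}"

definition quotient_borel ::
    "('n::finite mink \<Rightarrow> 'n mink) set \<Rightarrow> ('n mink \<times> 'n mink) set measure" where
  "quotient_borel \<Gamma> = sigma (unit_tangent_bundle \<Gamma>)
     {A. A \<subseteq> unit_tangent_bundle \<Gamma> \<and> {p \<in> unit_tangent. vector_class \<Gamma> p \<in> A} \<in> sets borel}"

definition liouville ::
    "('n::finite mink \<Rightarrow> 'n mink) set \<Rightarrow> ('n mink \<times> 'n mink) set measure" where
  "liouville \<Gamma> = distr (uniform_measure liouville_cover (dirichlet_domain \<Gamma>))
     (quotient_borel \<Gamma>) (vector_class \<Gamma>)"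

definition tight ::
    "('n::finite mink \<Rightarrow> 'n mink) set \<Rightarrow> real \<Rightarrow> real \<Rightarrow> real \<Rightarrow> ('n mink \<times> 'n mink) set \<Rightarrow> bool" where
  "tight \<Gamma> r \<epsilon> \<delta> v \<longleftrightarrow> dist_T v (geodesic_flow r v) < \<epsilon> \<and>
     (\<exists>s\<in>{r / 10..9 * r / 10}. \<exists>t\<in>{r / 10..9 * r / 10}. \<bar>s - t\<bar> \<ge> inj_radius \<Gamma> \<and>
        dist_M (base_proj (geodesic_flow s v)) (base_proj (geodesic_flow t v)) < \<delta>)"

definition tight_set ::
    "('n::finite mink \<Rightarrow> 'n mink) set \<Rightarrow> real \<Rightarrow> real \<Rightarrow> real \<Rightarrow> ('n mink \<times> 'n mink) set set" where
  "tight_set \<Gamma> r \<epsilon> \<delta> = {v \<in> unit_tangent_bundle \<Gamma>. tight \<Gamma> r \<epsilon> \<delta> v}"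

end

theory Submission
  imports Defs
begin

text \<open>
  Let \<open>E\<close> be the set of unit vectors whose geodesic is again within distance \<open>2 \<delta>\<close> of its
  starting point at some time between the injectivity radius and \<open>r\<close>. Tightness of \<open>v\<close> at times
  \<open>s < t\<close> puts \<open>g\<^sub>a v\<close> into \<open>E\<close> for all \<open>a\<close> in \<open>(s - \<delta>, s)\<close>, because moving the first time by
  less than \<open>\<delta>\<close> costs less than \<open>\<delta>\<close> in distance. So a tight vector spends time at least \<open>\<delta>\<close> in
  \<open>E\<close> during \<open>[0, r]\<close>, and Markov's inequality together with the invariance of the Liouville measure
  under the flow bounds the measure of the tight vectors by \<open>(1 / \<delta>) r \<Lambda>(E)\<close>. It remains to see that
  \<open>\<Lambda>(E)\<close> is of order \<open>\<delta>\<^sup>n\<^sup>-\<^sup>1 r\<close>, and this holds fibre by fibre (\<open>return_directions\<close>).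

  Fix a base point \<open>z\<close> in hyperbolic space. A direction in \<open>E\<close> sends its geodesic through the ball
  of radius \<open>2 \<delta>\<close> about some translate \<open>f z\<close>, hence through the ball of radius \<open>3 \<delta>\<close> for time at
  least \<open>\<delta>\<close>. In polar coordinates about \<open>z\<close>, integration over directions and times is integration
  against the volume weighted by \<open>sinh(d)\<^sup>1\<^sup>-\<^sup>n\<close>, where \<open>d\<close> is the distance from \<open>z\<close>. On the ball of
  radius \<open>3 \<delta>\<close> about \<open>f z\<close> this weighted volume is at most a constant times \<open>\<delta>\<^sup>n\<close> times that of a
  concentric ball of a fixed radius (\<open>orbit_ball_weight\<close>). The fixed balls are disjoint, so their
  weighted volumes add up to at most the one of a large ball about \<open>z\<close>, which is of order \<open>r\<close>.

  Flow invariance enters in integrated form. A vector at \<open>x\<close> and a time \<open>s\<close> are encoded by the pair of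
  end points \<open>x\<close> and \<open>z = exp\<^sub>x(s v)\<close>; the density of the pair, a power of \<open>sinh d(x, z)\<close>, is
  symmetric in \<open>x\<close> and \<open>z\<close>. So integrating over \<open>x\<close> in a compact set that meets every orbit, and over
  all \<open>z\<close>, may be replaced by integrating over \<open>z\<close> in the compact set and over all \<open>x\<close>, up to the
  finite multiplicity with which translates of the compact set overlap
  (\<open>double_integral_swap_le\<close>).

  Two facts about the hyperbolic volume are used: its polar coordinates about an arbitrary point
  (\<open>nn_integral_hyp_polar\<close>) and its invariance under isometries
  (\<open>nn_integral_hyp_measure_isometry\<close>). The volume of a set is a multiple of the Lebesgue measure of
  the cone over it, so the latter reduces to the fact that isometries, which are linear in the
  hyperboloid model, preserve Lebesgue measure (\<open>lborel_hyp_isometry\<close>). A Lorentz boost does, as a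
  product of three shears, and every isometry is a boost times a rotation or reflection of space.
\<close>

section \<open>Elementary estimates\<close>

lemma ennreal_le_divideI:
  assumes "0 < a" "0 \<le> b" "ennreal a * X \<le> ennreal b" shows "X \<le> ennreal (b / a)"
proof (cases X rule: ennreal_cases)
  case (real x)
  then have "a * x \<le> b" using assms by (simp add: ennreal_mult[symmetric])
  then show ?thesis using real assms by (simp add: ennreal_leI field_simps)
next
  case top
  then show ?thesis using assms by (simp add: ennreal_mult_top top_unique)
qed

lemma sum_indicator_disjoint_le:
  assumes "finite G" "\<And>f g. f \<in> G \<Longrightarrow> g \<in> G \<Longrightarrow> y \<in> P f \<Longrightarrow> y \<in> P g \<Longrightarrow> f = g"
  shows "(\<Sum>f\<in>G. indicator (P f) y :: ennreal) \<le> 1"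
proof -
  have "(\<Sum>f\<in>G. indicator (P f) y :: ennreal) = (\<Sum>f\<in>{f \<in> G. y \<in> P f}. 1)"
    using assms(1) by (intro sum.mono_neutral_cong_right) (auto simp: indicator_def)
  also have "\<dots> = of_nat (card {f \<in> G. y \<in> P f})" by simp
  also have "card {f \<in> G. y \<in> P f} \<le> Suc 0"
    using assms by (subst card_le_Suc0_iff_eq) auto
  then have "of_nat (card {f \<in> G. y \<in> P f}) \<le> (1::ennreal)"
    by (metis One_nat_def of_nat_1 of_nat_mono)
  finally show ?thesis .
qed

text \<open>
  This bounds the growth of spheres between two radii by a constant, once the radii stay away
  from \<open>0\<close>: for \<open>h \<le> A\<close> the term \<open>cosh A * sinh h\<close> is dominated by \<open>sinh A * cosh h\<close>.
\<close>

lemma sinh_add_le: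
  assumes "0 \<le> h" "h \<le> (A::real)" shows "sinh (A + h) \<le> 2 * cosh h * sinh A"
proof -
  have "0 \<le> sinh (A - h)" using assms by simp
  then show ?thesis by (simp add: sinh_add sinh_diff mult.commute)
qed

lemma sinh_le_mult_cosh: 
  assumes "0 \<le> (x::real)" shows "sinh x \<le> x * cosh x"
proof (cases "x = 0")
  case False
  with assms have "0 < x" by simp
  have "(sinh has_real_derivative cosh y) (at y)" for y :: real
    by (auto intro!: derivative_eq_intros)
  with MVT2[of 0 x sinh cosh] \<open>0 < x\<close>
  obtain z where "0 < z" "z < x" "sinh x - sinh 0 = (x - 0) * cosh z" by blast
  then show ?thesis using assms by (simp add: cosh_real_nonneg_le_iff mult_left_mono)
qed simp

lemma finite_uniform_lower_bound:
  fixes h :: "'a \<Rightarrow> 'b \<Rightarrow> real"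
  assumes "finite F" "\<And>f. f \<in> F \<Longrightarrow> \<exists>c>0. \<forall>x\<in>S. c \<le> h f x"
  shows "\<exists>c>0. c \<le> 1 \<and> (\<forall>f\<in>F. \<forall>x\<in>S. c \<le> h f x)"
  using assms
proof (induction F)
  case empty
  then show ?case by (intro exI[of _ 1]) simp
next
  case (insert g F)
  then obtain c where c: "c > 0" "c \<le> 1" "\<forall>f\<in>F. \<forall>x\<in>S. c \<le> h f x" by auto
  obtain d where d: "d > 0" "\<forall>x\<in>S. d \<le> h g x" using insert.prems by blast
  show ?case
    by (rule exI[of _ "min c d"]) (use c d in \<open>auto simp: min_le_iff_disj\<close>)
qed

section \<open>Linear maps and Lebesgue measure\<close>

lemma nn_integral_scaleR:
  fixes f :: "'a::euclidean_space \<Rightarrow> ennreal"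
  assumes [measurable]: "f \<in> borel_measurable borel" and "c > 0"
  shows "(\<integral>\<^sup>+x. f x \<partial>lborel) = ennreal (c ^ DIM('a)) * (\<integral>\<^sup>+x. f (c *\<^sub>R x) \<partial>lborel)"
  using \<open>c > 0\<close> by (subst lborel_affine[of c 0])
    (simp_all add: nn_integral_density nn_integral_distr nn_integral_cmult)

lemma nn_integral_translate:
  fixes f :: "'a::euclidean_space \<Rightarrow> ennreal"
  assumes [measurable]: "f \<in> borel_measurable borel"
  shows "(\<integral>\<^sup>+x. f (a + x) \<partial>lborel) = (\<integral>\<^sup>+x. f x \<partial>lborel)"
  by (subst (2) lborel_distr_plus[of a, symmetric]) (simp add: nn_integral_distr)

text \<open>
  The argument is the one for the uniqueness of Haar measure. In the double integral of
  \<open>1\<^sub>A(f x) 1\<^sub>B(y)\<close> over \<open>x\<close> and \<open>y\<close>, with \<open>B\<close> the unit ball, translating first \<open>y\<close> and then \<open>x\<close>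
  moves the variable from \<open>f x\<close> to \<open>y\<close> and leaves \<open>B\<close> as it is, since \<open>f\<close> preserves norms.
  Comparing the two values gives the claim after division by the measure of \<open>B\<close>.
\<close>

lemma lborel_distr_norm_preserving:
  fixes f :: "'a::euclidean_space \<Rightarrow> 'a"
  assumes lin: "linear f" and norm: "\<And>x. norm (f x) = norm x"
  shows "distr lborel borel f = lborel"
proof (rule measure_eqI)
  show "sets (distr lborel borel f) = sets lborel" by simp
next
  have [measurable]: "f \<in> borel_measurable borel"
    using lin by (intro borel_measurable_continuous_onI linear_continuous_on linear_conv_bounded_linear[THEN iffD1])
  fix A assume "A \<in> sets (distr lborel borel f)"
  then have [measurable]: "A \<in> sets borel" by simp
  define B where "B = ball (0::'a) 1"
  have [measurable]: "B \<in> sets borel" by (simp add: B_def)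
  let ?m = "emeasure lborel B"
  have m: "?m \<noteq> 0" "?m \<noteq> \<infinity>"
    using unit_ball_vol_pos[of "real DIM('a)"] by (auto simp: B_def emeasure_ball simp del: unit_ball_vol_pos)
  have surj: "\<exists>z. f z = y" for y
  proof -
    have "inj f" using lin norm by (metis linear_injective_0 norm_eq_zero)
    then show ?thesis using lin linear_injective_imp_surjective by (metis surj_def)
  qed
  have "emeasure (distr lborel borel f) A * ?m
      = (\<integral>\<^sup>+x. indicator A (f x) * ?m \<partial>lborel)"
  proof -
    have "emeasure (distr lborel borel f) A = (\<integral>\<^sup>+x. indicator A x \<partial>distr lborel borel f)"
      by (rule nn_integral_indicator[symmetric]) simp
    then show ?thesis by (simp add: nn_integral_distr nn_integral_multc del: nn_integral_indicator)
  qed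
  also have "\<dots> = (\<integral>\<^sup>+x. \<integral>\<^sup>+y. indicator A (f x) * indicator B y \<partial>lborel \<partial>lborel)"
    by (intro nn_integral_cong) (subst nn_integral_cmult_indicator; simp)
  also have "\<dots> = (\<integral>\<^sup>+x. \<integral>\<^sup>+y. indicator A (f x) * indicator B (- f x + y) \<partial>lborel \<partial>lborel)"
    by (rule nn_integral_cong, rule nn_integral_translate[symmetric, of "\<lambda>y. indicator A (f _) * indicator B y"]) measurable
  also have "\<dots> = (\<integral>\<^sup>+y. \<integral>\<^sup>+x. indicator A (f x) * indicator B (- f x + y) \<partial>lborel \<partial>lborel)"
    by (rule lborel_pair.Fubini'[symmetric]) (measurable)
  also have "\<dots> = (\<integral>\<^sup>+y. \<integral>\<^sup>+x. indicator A (y + f x) * indicator B x \<partial>lborel \<partial>lborel)"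
  proof (rule nn_integral_cong)
    fix y
    obtain z where z: "f z = y" using surj by blast
    have "(\<integral>\<^sup>+x. indicator A (f x) * indicator B (- f x + y) \<partial>lborel)
        = (\<integral>\<^sup>+x. indicator A (f (z + x)) * indicator B (- f (z + x) + y) \<partial>lborel)"
      by (rule nn_integral_translate[symmetric]) measurable
    also have "\<dots> = (\<integral>\<^sup>+x. indicator A (y + f x) * indicator B x \<partial>lborel)"
      by (intro nn_integral_cong) (simp add: B_def linear_add[OF lin] z norm indicator_def)
    finally show "(\<integral>\<^sup>+x. indicator A (f x) * indicator B (- f x + y) \<partial>lborel) = \<dots>" .
  qed
  also have "\<dots> = (\<integral>\<^sup>+x. \<integral>\<^sup>+y. indicator A (y + f x) * indicator B x \<partial>lborel \<partial>lborel)"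
    by (rule lborel_pair.Fubini') (measurable)
  also have "\<dots> = (\<integral>\<^sup>+x. (\<integral>\<^sup>+y. indicator A (f x + y) \<partial>lborel) * indicator B x \<partial>lborel)"
    by (intro nn_integral_cong) (simp add: nn_integral_multc add.commute)
  also have "\<dots> = (\<integral>\<^sup>+x. emeasure lborel A * indicator B x \<partial>lborel)"
    by (subst nn_integral_translate) auto
  also have "\<dots> = emeasure lborel A * ?m"
    by (simp add: nn_integral_cmult)
  finally show "emeasure (distr lborel borel f) A = emeasure lborel A"
    using m by (simp add: ennreal_mult_cancel_left mult.commute[of _ ?m])
qed


text \<open>
  By Tonelli's theorem a shear only translates each fibre.
\<close>

lemma lborel_shear_fst:
  fixes f :: "'a::euclidean_space \<times> 'b::euclidean_space \<Rightarrow> ennreal"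
  assumes [measurable]: "f \<in> borel_measurable borel" "g \<in> borel_measurable borel"
  shows "(\<integral>\<^sup>+z. f (g (snd z) + fst z, snd z) \<partial>lborel) = (\<integral>\<^sup>+z. f z \<partial>lborel)"
proof -
  have "(\<integral>\<^sup>+z. f (g (snd z) + fst z, snd z) \<partial>lborel)
      = (\<integral>\<^sup>+b. \<integral>\<^sup>+a. f (g b + a, b) \<partial>lborel \<partial>lborel)"
    unfolding lborel_prod[symmetric] by (subst lborel_pair.nn_integral_snd[symmetric]) auto
  also have "\<dots> = (\<integral>\<^sup>+b. \<integral>\<^sup>+a. f (a, b) \<partial>lborel \<partial>lborel)"
    by (intro nn_integral_cong nn_integral_translate[of "\<lambda>a. f (a, _)"]) measurable
  also have "\<dots> = (\<integral>\<^sup>+z. f z \<partial>lborel)"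
    unfolding lborel_prod[symmetric] by (rule lborel_pair.nn_integral_snd) (simp add: lborel_prod)
  finally show ?thesis .
qed

lemma lborel_shear_snd:
  fixes f :: "'a::euclidean_space \<times> 'b::euclidean_space \<Rightarrow> ennreal"
  assumes [measurable]: "f \<in> borel_measurable borel" "g \<in> borel_measurable borel"
  shows "(\<integral>\<^sup>+z. f (fst z, g (fst z) + snd z) \<partial>lborel) = (\<integral>\<^sup>+z. f z \<partial>lborel)"
proof -
  have "(\<integral>\<^sup>+z. f (fst z, g (fst z) + snd z) \<partial>lborel)
      = (\<integral>\<^sup>+a. \<integral>\<^sup>+b. f (a, g a + b) \<partial>lborel \<partial>lborel)"
    unfolding lborel_prod[symmetric] by (subst lborel.nn_integral_fst[symmetric]) auto
  also have "\<dots> = (\<integral>\<^sup>+a. \<integral>\<^sup>+b. f (a, b) \<partial>lborel \<partial>lborel)"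
    by (intro nn_integral_cong nn_integral_translate[of "\<lambda>a. f (_, a)"]) measurable
  also have "\<dots> = (\<integral>\<^sup>+z. f z \<partial>lborel)"
    unfolding lborel_prod[symmetric] by (rule lborel.nn_integral_fst) (simp add: lborel_prod)
  finally show ?thesis .
qed

lemma borel_measurable_fst [measurable (raw)]:
  fixes f :: "'a \<Rightarrow> 'b::topological_space \<times> 'c::topological_space"
  shows "f \<in> borel_measurable M \<Longrightarrow> (\<lambda>x. fst (f x)) \<in> borel_measurable M"
  by (rule borel_measurable_continuous_on[of fst]) (auto intro: continuous_intros)

lemma borel_measurable_snd [measurable (raw)]:
  fixes f :: "'a \<Rightarrow> 'b::topological_space \<times> 'c::topological_space"
  shows "f \<in> borel_measurable M \<Longrightarrow> (\<lambda>x. snd (f x)) \<in> borel_measurable M"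
  by (rule borel_measurable_continuous_on[of snd]) (auto intro: continuous_intros)

section \<open>Polar coordinates in Euclidean space\<close>

lemma sets_sphere_measure [measurable_cong]:
  "sets (sphere_measure :: (real ^ 'n::finite) measure) = sets (restrict_space borel (sphere 0 1))"
  by (simp add: sphere_measure_def)

lemma space_sphere_measure: "space (sphere_measure :: (real ^ 'n::finite) measure) = sphere 0 1"
  by (simp add: sphere_measure_def space_restrict_space)

lemma measurable_sphere_measureI:
  "g \<in> borel_measurable borel \<Longrightarrow> g \<in> borel_measurable (sphere_measure :: (real^'n::finite) measure)"
  by (simp add: measurable_cong_sets[OF sets_sphere_measure refl] measurable_restrict_space1)

lemma sphere_proj_measurable [measurable]:
  "(\<lambda>u::real^'n::finite. u /\<^sub>R norm u) \<in> restrict_space lborel (ball 0 1 - {0}) \<rightarrow>\<^sub>M restrict_space borel (sphere 0 1)"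
  by (rule measurable_restrict_space2) (auto simp: space_restrict_space intro!: measurable_restrict_space1)

lemma nn_integral_sphere:
  fixes g :: "real ^ 'n::finite \<Rightarrow> ennreal"
  assumes [measurable]: "g \<in> borel_measurable borel"
  shows "(\<integral>\<^sup>+u. g u \<partial>sphere_measure) = (\<integral>\<^sup>+x. g (x /\<^sub>R norm x) * indicator (ball 0 1 - {0}) x \<partial>lborel)"
proof -
  have "(\<integral>\<^sup>+u. g u \<partial>sphere_measure) = (\<integral>\<^sup>+x. g (x /\<^sub>R norm x) \<partial>restrict_space lborel (ball 0 1 - {0}))"
    unfolding sphere_measure_def
    by (rule nn_integral_distr) (auto intro!: measurable_restrict_space1)
  also have "\<dots> = (\<integral>\<^sup>+x. g (x /\<^sub>R norm x) * indicator (ball 0 1 - {0}) x \<partial>lborel)"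
    by (rule nn_integral_restrict_space) simp
  finally show ?thesis .
qed

lemma finite_sphere_measure: "emeasure (sphere_measure :: (real ^ 'n::finite) measure) (sphere 0 1) < \<infinity>"
proof -
  have "emeasure (sphere_measure :: (real ^ 'n::finite) measure) (sphere 0 1) = (\<integral>\<^sup>+u. 1 \<partial>(sphere_measure :: (real ^ 'n::finite) measure))"
    by (simp add: space_sphere_measure)
  also have "\<dots> = emeasure lborel (ball (0::real^'n) 1 - {0})"
    by (subst nn_integral_sphere) auto
  also have "\<dots> \<le> emeasure lborel (ball (0::real^'n) 1)" by (rule emeasure_mono) auto
  also have "\<dots> < \<infinity>" using emeasure_lborel_ball_finite by simp
  finally show ?thesis .
qed

interpretation sphere_measure: finite_measure sphere_measure
  by standard (use finite_sphere_measure in \<open>simp add: space_sphere_measure less_top\<close>)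

text \<open>
  The radial integral that remains at the end of the computation of \<open>nn_integral_polar\<close>.
\<close>

lemma nn_integral_inverse_power_tail:
  assumes "c > 0" "n > 0"
  shows "(\<integral>\<^sup>+t. ennreal (1 / t ^ Suc n) * indicator {c<..} t \<partial>lborel) = ennreal (1 / (real n * c ^ n))"
proof -
  have "(\<integral>\<^sup>+t. ennreal (1 / t ^ Suc n) * indicator {c<..} t \<partial>lborel)
      = (\<integral>\<^sup>+t. ennreal (1 / t ^ Suc n) * indicator {c..} t \<partial>lborel)"
    by (intro nn_integral_cong_AE) (use AE_lborel_singleton[of c] in \<open>auto split: split_indicator\<close>)
  also have "\<dots> = ennreal (0 - (- (1 / (real n * c ^ n))))"
  proof (rule nn_integral_FTC_atLeast)
    show "((\<lambda>t. - (1 / (real n * t ^ n))) has_real_derivative 1 / t ^ Suc n) (at t)" if "c \<le> t" for t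
      using that assms by (auto intro!: derivative_eq_intros simp: divide_simps) (cases n; simp add: algebra_simps)
    show "((\<lambda>t. - (1 / (real n * t ^ n))) \<longlongrightarrow> 0) at_top"
      using assms by real_asymp
  qed (use assms in auto)
  finally show ?thesis by simp
qed

text \<open>
  The measure \<open>sphere_measure\<close> is given by integration over the ball, so the right-hand side is an
  integral over \<open>x\<close> in the ball and over \<open>\<rho> > 0\<close> of a function of \<open>\<rho> x / |x|\<close>. Substituting
  \<open>\<rho> = t |x|\<close> turns the argument into \<open>t x\<close>. After exchanging the integrals and substituting
  \<open>z = t x\<close>, the value at \<open>z\<close> is multiplied by the integral of \<open>|z|\<^sup>n t\<^sup>-\<^sup>n\<^sup>-\<^sup>1\<close> over \<open>t > |z|\<close>, which is
  \<open>1 / n\<close>.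
\<close>

theorem nn_integral_polar:
  fixes f :: "real ^ 'n::finite \<Rightarrow> ennreal"
  assumes [measurable]: "f \<in> borel_measurable borel"
  shows "(\<integral>\<^sup>+x. f x \<partial>lborel) = real CARD('n) *
    (\<integral>\<^sup>+u. \<integral>\<^sup>+\<rho>. f (\<rho> *\<^sub>R u) * ennreal (\<rho> ^ (CARD('n) - 1)) * indicator {0<..} \<rho> \<partial>lborel \<partial>sphere_measure)"
proof -
  define n where "n = CARD('n)"
  have n: "n > 0" "DIM(real^'n) = n" by (auto simp: n_def)
  define B where "B = ball (0::real^'n) 1 - {0}"
  have [measurable]: "B \<in> sets borel" by (simp add: B_def)
  have nz: "AE x in lborel. x \<noteq> (0::real^'n)" by (rule AE_lborel_singleton)
  have "(\<integral>\<^sup>+u. \<integral>\<^sup>+\<rho>. f (\<rho> *\<^sub>R u) * ennreal (\<rho> ^ (n - 1)) * indicator {0<..} \<rho> \<partial>lborel \<partial>sphere_measure)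
      = (\<integral>\<^sup>+x. (\<integral>\<^sup>+\<rho>. f (\<rho> *\<^sub>R (x /\<^sub>R norm x)) * ennreal (\<rho> ^ (n - 1)) * indicator {0<..} \<rho> \<partial>lborel) * indicator B x \<partial>lborel)"
    unfolding B_def by (rule nn_integral_sphere) measurable
  also have "\<dots> = (\<integral>\<^sup>+x. (\<integral>\<^sup>+t. f (t *\<^sub>R x) * ennreal (t ^ (n - 1)) * ennreal (norm x ^ n) * indicator {0<..} t * indicator B x \<partial>lborel) \<partial>lborel)"
  proof (rule nn_integral_cong)
    fix x :: "real^'n"
    show "(\<integral>\<^sup>+\<rho>. f (\<rho> *\<^sub>R (x /\<^sub>R norm x)) * ennreal (\<rho> ^ (n - 1)) * indicator {0<..} \<rho> \<partial>lborel) * indicator B x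
      = (\<integral>\<^sup>+t. f (t *\<^sub>R x) * ennreal (t ^ (n - 1)) * ennreal (norm x ^ n) * indicator {0<..} t * indicator B x \<partial>lborel)"
    proof (cases "x \<in> B")
      case True
      then have x: "norm x > 0" by (auto simp: B_def)
      have "(\<integral>\<^sup>+\<rho>. f (\<rho> *\<^sub>R (x /\<^sub>R norm x)) * ennreal (\<rho> ^ (n - 1)) * indicator {0<..} \<rho> \<partial>lborel)
         = ennreal \<bar>norm x\<bar> * (\<integral>\<^sup>+t. f ((0 + norm x * t) *\<^sub>R (x /\<^sub>R norm x)) * ennreal ((0 + norm x * t) ^ (n - 1)) * indicator {0<..} (0 + norm x * t) \<partial>lborel)"
        by (rule nn_integral_real_affine) (use x in auto)
      also have "\<dots> = (\<integral>\<^sup>+t. ennreal (norm x) * (f ((0 + norm x * t) *\<^sub>R (x /\<^sub>R norm x)) * ennreal ((0 + norm x * t) ^ (n - 1)) * indicator {0<..} (0 + norm x * t)) \<partial>lborel)"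
        using x by (subst nn_integral_cmult) auto
      also have "\<dots> = (\<integral>\<^sup>+t. f (t *\<^sub>R x) * ennreal (t ^ (n - 1)) * ennreal (norm x ^ n) * indicator {0<..} t \<partial>lborel)"
      proof (rule nn_integral_cong)
        fix t :: real
        have "ennreal (norm x) * ennreal ((norm x * t) ^ (n - 1)) = ennreal (t ^ (n - 1)) * ennreal (norm x ^ n)" if "t > 0"
          using that n by (cases n) (simp_all add: ennreal_mult[symmetric] power_mult_distrib mult_ac)
        then have "f (t *\<^sub>R x) * (ennreal (norm x) * ennreal ((norm x * t) ^ (n - 1))) = f (t *\<^sub>R x) * (ennreal (t ^ (n - 1)) * ennreal (norm x ^ n))" if "t > 0"
          using that by simp
        then show "ennreal (norm x) * (f ((0 + norm x * t) *\<^sub>R (x /\<^sub>R norm x)) * ennreal ((0 + norm x * t) ^ (n - 1)) * indicator {0<..} (0 + norm x * t))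
            = f (t *\<^sub>R x) * ennreal (t ^ (n - 1)) * ennreal (norm x ^ n) * indicator {0<..} t"
          using x by (auto simp: indicator_def zero_less_mult_iff mult_ac)
      qed
      finally show ?thesis using True by simp
    qed simp
  qed
  also have "\<dots> = (\<integral>\<^sup>+t. (\<integral>\<^sup>+x. f (t *\<^sub>R x) * ennreal (t ^ (n - 1)) * ennreal (norm x ^ n) * indicator {0<..} t * indicator B x \<partial>lborel) \<partial>lborel)"
    by (rule lborel_pair.Fubini') measurable
  also have "\<dots> = (\<integral>\<^sup>+t. (\<integral>\<^sup>+z. f z * ennreal (norm z ^ n) * ennreal (1 / t ^ Suc n) * (if 0 < norm z \<and> norm z < t then 1 else 0) \<partial>lborel) \<partial>lborel)"
  proof (rule nn_integral_cong)
    fix t :: real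
    show "(\<integral>\<^sup>+x. f (t *\<^sub>R x) * ennreal (t ^ (n - 1)) * ennreal (norm x ^ n) * indicator {0<..} t * indicator B x \<partial>lborel)
      = (\<integral>\<^sup>+z. f z * ennreal (norm z ^ n) * ennreal (1 / t ^ Suc n) * (if 0 < norm z \<and> norm z < t then 1 else 0) \<partial>lborel)"
    proof (cases "t > 0")
      case True
      have "(\<integral>\<^sup>+z. f z * ennreal (norm z ^ n) * ennreal (1 / t ^ Suc n) * (if 0 < norm z \<and> norm z < t then 1 else 0) \<partial>lborel)
         = ennreal (t ^ n) * (\<integral>\<^sup>+x. f (t *\<^sub>R x) * ennreal (norm (t *\<^sub>R x) ^ n) * ennreal (1 / t ^ Suc n) * (if 0 < norm (t *\<^sub>R x) \<and> norm (t *\<^sub>R x) < t then 1 else 0) \<partial>lborel)"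
        by (subst nn_integral_scaleR[OF _ True]) (auto simp: n_def)
      also have "\<dots> = (\<integral>\<^sup>+x. ennreal (t ^ n) * (f (t *\<^sub>R x) * ennreal (norm (t *\<^sub>R x) ^ n) * ennreal (1 / t ^ Suc n) * (if 0 < norm (t *\<^sub>R x) \<and> norm (t *\<^sub>R x) < t then 1 else 0)) \<partial>lborel)"
        by (subst nn_integral_cmult) auto
      also have "\<dots> = (\<integral>\<^sup>+x. f (t *\<^sub>R x) * ennreal (t ^ (n - 1)) * ennreal (norm x ^ n) * indicator {0<..} t * indicator B x \<partial>lborel)"
      proof (rule nn_integral_cong)
        fix x :: "real^'n"
        have "t ^ n * ((t * norm x) ^ n * (1 / t ^ Suc n)) = t ^ (n - 1) * norm x ^ n"
          using n True by (cases n) (simp_all add: power_mult_distrib field_simps)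
        then have "ennreal (t ^ n) * (ennreal ((t * norm x) ^ n) * ennreal (1 / t ^ Suc n)) = ennreal (t ^ (n - 1)) * ennreal (norm x ^ n)"
          using True by (simp add: ennreal_mult[symmetric])
        then have "f (t *\<^sub>R x) * (ennreal (t ^ n) * (ennreal ((t * norm x) ^ n) * ennreal (1 / t ^ Suc n))) = f (t *\<^sub>R x) * (ennreal (t ^ (n - 1)) * ennreal (norm x ^ n))" by simp
        then show "ennreal (t ^ n) * (f (t *\<^sub>R x) * ennreal (norm (t *\<^sub>R x) ^ n) * ennreal (1 / t ^ Suc n) * (if 0 < norm (t *\<^sub>R x) \<and> norm (t *\<^sub>R x) < t then 1 else 0))
           = f (t *\<^sub>R x) * ennreal (t ^ (n - 1)) * ennreal (norm x ^ n) * indicator {0<..} t * indicator B x"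
          using True by (auto simp: B_def indicator_def mult_ac abs_of_pos mult_less_cancel_left1)
      qed
      finally show ?thesis by simp
    next
      case False
      then have "(if 0 < norm z \<and> norm z < t then 1 else 0) = (0::ennreal)" for z :: "real^'n"
        using False norm_ge_zero[of z] by (smt (verit))
      with False show ?thesis by (simp only: mult_zero_right) simp
    qed
  qed
  also have "\<dots> = (\<integral>\<^sup>+z. (\<integral>\<^sup>+t. f z * ennreal (norm z ^ n) * ennreal (1 / t ^ Suc n) * (if 0 < norm z \<and> norm z < t then 1 else 0) \<partial>lborel) \<partial>lborel)"
    by (rule lborel_pair.Fubini'[symmetric]) measurable
  also have "\<dots> = (\<integral>\<^sup>+z. f z * ennreal (1 / n) \<partial>lborel)"
  proof (rule nn_integral_cong_AE, use nz in eventually_elim)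
    fix z :: "real^'n" assume "z \<noteq> 0"
    then have z: "norm z > 0" by simp
    have "(\<integral>\<^sup>+t. f z * ennreal (norm z ^ n) * ennreal (1 / t ^ Suc n) * (if 0 < norm z \<and> norm z < t then 1 else 0) \<partial>lborel)
       = (\<integral>\<^sup>+t. (f z * ennreal (norm z ^ n)) * (ennreal (1 / t ^ Suc n) * indicator {norm z<..} t) \<partial>lborel)"
      using z by (intro nn_integral_cong) (auto simp: indicator_def mult_ac)
    also have "\<dots> = (f z * ennreal (norm z ^ n)) * ennreal (1 / (real n * norm z ^ n))"
      using z n by (subst nn_integral_cmult) (auto simp: nn_integral_inverse_power_tail simp del: power_Suc)
    also have "\<dots> = f z * ennreal (1 / n)"
      using z n by (simp add: mult.assoc ennreal_mult[symmetric])
    finally show "(\<integral>\<^sup>+t. f z * ennreal (norm z ^ n) * ennreal (1 / t ^ Suc n) * (if 0 < norm z \<and> norm z < t then 1 else 0) \<partial>lborel) = f z * ennreal (1 / n)" .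
  qed
  also have "\<dots> = (\<integral>\<^sup>+z. f z \<partial>lborel) * ennreal (1 / n)"
    by (simp add: nn_integral_multc)
  finally have "real n * (\<integral>\<^sup>+u. \<integral>\<^sup>+\<rho>. f (\<rho> *\<^sub>R u) * ennreal (\<rho> ^ (n - 1)) * indicator {0<..} \<rho> \<partial>lborel \<partial>sphere_measure)
    = (\<integral>\<^sup>+z. f z \<partial>lborel) * (ennreal (1 / n) * ennreal (real n))"
    by (simp add: mult_ac ennreal_of_nat_eq_real_of_nat)
  also have "ennreal (1 / n) * ennreal (real n) = 1"
    using n by (simp add: ennreal_mult[symmetric])
  finally show ?thesis by (simp add: n_def)
qed

section \<open>Minkowski space and the isometries of the hyperboloid\<close>

lemma mink_inner_add_left: "mink_inner (x + y) z = mink_inner x z + mink_inner y z"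
  and mink_inner_add_right: "mink_inner z (x + y) = mink_inner z x + mink_inner z y"
  and mink_inner_diff_left: "mink_inner (x - y) z = mink_inner x z - mink_inner y z"
  and mink_inner_diff_right: "mink_inner z (x - y) = mink_inner z x - mink_inner z y"
  and mink_inner_scaleR_left: "mink_inner (c *\<^sub>R x) z = c * mink_inner x z"
  and mink_inner_scaleR_right: "mink_inner z (c *\<^sub>R x) = c * mink_inner z x"
  and mink_inner_minus_left: "mink_inner (- x) z = - mink_inner x z"
  and mink_inner_minus_right: "mink_inner z (- x) = - mink_inner z x"
  by (simp_all add: mink_inner_def inner_simps algebra_simps)

lemmas mink_inner_simps = mink_inner_add_left mink_inner_add_right mink_inner_diff_left
  mink_inner_diff_right mink_inner_scaleR_left mink_inner_scaleR_right
  mink_inner_minus_left mink_inner_minus_right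

lemma mink_inner_commute: "mink_inner x y = mink_inner y x"
  by (simp add: mink_inner_def inner_commute mult.commute)

lemma continuous_on_mink_inner [continuous_intros]:
  "continuous_on A f \<Longrightarrow> continuous_on A g \<Longrightarrow> continuous_on A (\<lambda>x. mink_inner (f x) (g x))"
  unfolding mink_inner_def by (intro continuous_intros)

lemma borel_measurable_mink_inner [measurable]:
  fixes f g :: "'a \<Rightarrow> 'n::finite mink"
  assumes "f \<in> borel_measurable M" "g \<in> borel_measurable M"
  shows "(\<lambda>x. mink_inner (f x) (g x)) \<in> borel_measurable M"
proof -
  have "continuous_on UNIV (\<lambda>p::'n mink \<times> 'n mink. mink_inner (fst p) (snd p))"
    by (intro continuous_intros)
  then show ?thesis using assms by (rule borel_measurable_continuous_Pair[rotated 2])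
qed

abbreviation hyp_origin :: "'n::finite mink" where "hyp_origin \<equiv> (1, 0)"

lemma hyp_origin_in [simp]: "(hyp_origin :: 'n::finite mink) \<in> hyp_space"
  by (simp add: hyp_space_def mink_inner_def)

lemma hyp_space_iff_chart: "x \<in> hyp_space \<longleftrightarrow> x = hyp_chart (snd x)"
proof -
  have "fst x * fst x = 1 + snd x \<bullet> snd x \<and> 0 < fst x \<longleftrightarrow> fst x = sqrt (1 + snd x \<bullet> snd x)"
    by (auto simp: real_sqrt_mult_self add_pos_nonneg intro!: real_sqrt_unique[symmetric] simp: power2_eq_square)
  then show ?thesis
    by (cases x) (auto simp: hyp_space_def mink_inner_def hyp_chart_def power2_norm_eq_inner)
qed

lemma hyp_chart_in [simp]: "hyp_chart y \<in> hyp_space"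
  by (simp add: hyp_space_iff_chart hyp_chart_def)

definition time_shear :: "real ^ 'n::finite \<Rightarrow> 'n mink \<Rightarrow> 'n mink" where
  "time_shear w z = (fst z, fst z *\<^sub>R w + snd z)"

definition space_shear :: "real ^ 'n::finite \<Rightarrow> 'n mink \<Rightarrow> 'n mink" where
  "space_shear y z = (y \<bullet> snd z + fst z, snd z)"

text \<open>
  The isometry that takes the base point \<open>(1, 0)\<close> to \<open>hyp_chart y\<close> and whose differential there is
  \<open>boost y\<close>. It supplies the frames in which \<open>liouville_cover\<close> is defined.
\<close>

definition lorentz_boost :: "real ^ 'n::finite \<Rightarrow> 'n mink \<Rightarrow> 'n mink" where
  "lorentz_boost y z = fst z *\<^sub>R hyp_chart y + boost y (snd z)"

text \<open>
  A hyperbolic rotation is a product of three shears, like a rotation of the plane. With \<open>c\<close> the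
  hyperbolic cosine of the distance moved, \<open>w = y / (1 + c)\<close> is the choice for which
  \<open>y \<bullet> w = c - 1\<close>. Both the inverse of a boost and its effect on Lebesgue measure are read off
  from this factorisation.
\<close>

lemma lorentz_boost_shears:
  fixes y :: "real ^ 'n::finite"
  defines "w \<equiv> y /\<^sub>R (1 + sqrt (1 + (norm y)\<^sup>2))"
  shows "lorentz_boost y z = time_shear w (space_shear y (time_shear w z))"
proof -
  define c where "c = sqrt (1 + (norm y)\<^sup>2)"
  have c: "c > 0" "c * c = 1 + y \<bullet> y"
    by (auto simp: c_def power2_norm_eq_inner add_pos_nonneg real_sqrt_mult_self)
  have yw: "y \<bullet> w = c - 1"
    using c by (simp add: w_def c_def[symmetric] field_simps)
  have y: "y = (1 + c) *\<^sub>R w" using c by (simp add: w_def c_def[symmetric])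
  obtain a b where z: "z = (a, b)" by (cases z)
  have "(y \<bullet> b / (1 + c)) *\<^sub>R y = (y \<bullet> b) *\<^sub>R w"
    by (simp add: w_def c_def[symmetric] divide_inverse)
  moreover have "a *\<^sub>R y = a *\<^sub>R w + (a * c) *\<^sub>R w"
    by (subst y) (simp add: algebra_simps)
  ultimately show ?thesis
    by (simp add: yw z lorentz_boost_def time_shear_def space_shear_def hyp_chart_def boost_def
      c_def[symmetric] inner_simps algebra_simps)
qed

lemma time_shear_minus: "time_shear (- w) (time_shear w z) = z"
  by (simp add: time_shear_def)

lemma space_shear_minus: "space_shear (- w) (space_shear w z) = z"
  by (simp add: space_shear_def)

lemma lorentz_boost_minus: "lorentz_boost (- y) (lorentz_boost y z) = z"
  by (simp add: lorentz_boost_shears time_shear_minus space_shear_minus)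

lemma lorentz_boost_minus': "lorentz_boost y (lorentz_boost (- y) z) = z"
  using lorentz_boost_minus[of "- y"] by simp

lemma linear_lorentz_boost: "linear (lorentz_boost y)"
  by (rule linearI)
    (simp_all add: lorentz_boost_def boost_def hyp_chart_def inner_simps algebra_simps add_divide_distrib scaleR_add_left)

lemma mink_inner_lorentz_boost:
  "mink_inner (lorentz_boost y z) (lorentz_boost y z') = mink_inner z z'"
proof -
  define c where "c = sqrt (1 + (norm y)\<^sup>2)"
  define k where "k = 1 / (1 + c)"
  have c: "c > 0" "c * c = 1 + y \<bullet> y"
    by (auto simp: c_def power2_norm_eq_inner add_pos_nonneg real_sqrt_mult_self)
  have k: "k * (1 + c) = 1" using c by (simp add: k_def)
  obtain a b where z: "z = (a, b)" by (cases z)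
  obtain a' b' where z': "z' = (a', b')" by (cases z')
  have alg: "a * a' * Y + a * q + a * k * q * Y + a' * p + k * q * p + a' * k * p * Y
     + k * p * q + k * k * p * q * Y = (a * c + p) * (a' * c + q) - a * a'"
    if "c * c = 1 + Y" for Y p q :: real
    using that k by algebra
  have "mink_inner (lorentz_boost y z) (lorentz_boost y z')
     = (a *\<^sub>R y + (b + (k * (y \<bullet> b)) *\<^sub>R y)) \<bullet> (a' *\<^sub>R y + (b' + (k * (y \<bullet> b')) *\<^sub>R y))
       - (a * c + y \<bullet> b) * (a' * c + y \<bullet> b')"
    by (simp add: z z' mink_inner_def lorentz_boost_def boost_def hyp_chart_def c_def[symmetric] k_def)
  also have "\<dots> = b \<bullet> b' - a * a'"
    using alg[OF c(2), of "y \<bullet> b'" "y \<bullet> b"]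
    by (simp add: inner_simps algebra_simps inner_commute)
  finally show ?thesis by (simp add: z z' mink_inner_def)
qed

lemma lorentz_boost_hyp_space: "z \<in> hyp_space \<Longrightarrow> lorentz_boost y z \<in> hyp_space"
proof -
  assume z: "z \<in> hyp_space"
  obtain a b where ab: "z = (a, b)" by (cases z)
  have a: "a = sqrt (1 + (norm b)\<^sup>2)" using z by (simp add: ab hyp_space_iff_chart hyp_chart_def)
  define c where "c = sqrt (1 + (norm y)\<^sup>2)"
  have "norm b < a" "norm y < c" unfolding a c_def by (simp_all add: real_less_rsqrt)
  then have "norm y * norm b < c * a" by (intro mult_strict_mono') auto
  moreover have "\<bar>y \<bullet> b\<bar> \<le> norm y * norm b" by (rule Cauchy_Schwarz_ineq2)
  ultimately have "0 < fst (lorentz_boost y z)"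
    by (simp add: lorentz_boost_def ab hyp_chart_def boost_def c_def[symmetric] mult.commute)
  then show ?thesis using z by (simp add: hyp_space_def mink_inner_lorentz_boost)
qed

lemma hyp_isometry_lorentz_boost: "hyp_isometry (lorentz_boost y)"
  unfolding hyp_isometry_def
proof (intro conjI allI)
  show "lorentz_boost y ` hyp_space = hyp_space"
  proof
    show "hyp_space \<subseteq> lorentz_boost y ` hyp_space"
      by (metis image_eqI lorentz_boost_hyp_space lorentz_boost_minus' subsetI)
  qed (auto intro: lorentz_boost_hyp_space)
qed (auto simp: linear_lorentz_boost mink_inner_lorentz_boost)

lemma lorentz_boost_origin: "lorentz_boost y hyp_origin = hyp_chart y"
  by (simp add: lorentz_boost_def boost_def zero_prod_def[symmetric])

lemma lorentz_boost_tangent: "lorentz_boost y (0, u) = boost y u"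
  by (simp add: lorentz_boost_def)

lemma hyp_isometry_reflection: "hyp_isometry (\<lambda>z::'n::finite mink. (fst z, - snd z))"
  unfolding hyp_isometry_def
proof (intro conjI allI)
  have *: "z \<in> hyp_space \<Longrightarrow> (fst z, - snd z) \<in> hyp_space" for z :: "'n mink"
    by (simp add: hyp_space_def mink_inner_def)
  show "(\<lambda>z::'n mink. (fst z, - snd z)) ` hyp_space = hyp_space"
  proof
    show "hyp_space \<subseteq> (\<lambda>z::'n mink. (fst z, - snd z)) ` hyp_space"
      using * by (auto intro!: image_eqI[where x = "(fst z, - snd z)" for z])
  qed (use * in auto)
qed (auto simp: mink_inner_def intro!: linearI)

lemma hyp_isometry_comp: "hyp_isometry f \<Longrightarrow> hyp_isometry g \<Longrightarrow> hyp_isometry (f \<circ> g)"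
  unfolding hyp_isometry_def by (metis (no_types, lifting) comp_apply image_comp linear_compose)

lemma hyp_isometry_inner: "hyp_isometry f \<Longrightarrow> mink_inner (f x) (f y) = mink_inner x y"
  unfolding hyp_isometry_def by blast

lemma hyp_isometry_linear: "hyp_isometry f \<Longrightarrow> linear f"
  by (simp add: hyp_isometry_def)

lemma hyp_isometry_hyp_space: "hyp_isometry f \<Longrightarrow> x \<in> hyp_space \<Longrightarrow> f x \<in> hyp_space"
  unfolding hyp_isometry_def by blast

lemma hyp_isometry_preimage: "hyp_isometry f \<Longrightarrow> y \<in> hyp_space \<Longrightarrow> \<exists>x\<in>hyp_space. y = f x"
  unfolding hyp_isometry_def by blast

lemma mink_inner_nondegenerate:
  assumes "\<And>w. mink_inner z w = 0" shows "z = (0 :: 'n::finite mink)"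
proof -
  have "mink_inner z (- fst z, snd z) = 0" by (rule assms)
  then have "snd z \<bullet> snd z + fst z * fst z = 0" by (simp add: mink_inner_def)
  then have "snd z \<bullet> snd z = 0" "fst z * fst z = 0"
    using inner_ge_zero[of "snd z"] zero_le_square[of "fst z"] by linarith+
  then show ?thesis by (auto simp: prod_eq_iff)
qed

lemma hyp_isometry_inj: "hyp_isometry f \<Longrightarrow> inj f"
proof -
  assume f: "hyp_isometry f"
  have "z = 0" if "f z = 0" for z
  proof (rule mink_inner_nondegenerate)
    fix w
    have "mink_inner (f z) (f w) = mink_inner z w" by (rule hyp_isometry_inner[OF f])
    then show "mink_inner z w = 0" using that by (simp add: mink_inner_def)
  qed
  then show "inj f" using linear_injective_0[OF hyp_isometry_linear[OF f]] by blast
qed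

lemma hyp_isometry_surj: "hyp_isometry f \<Longrightarrow> surj f"
  by (intro linear_inj_imp_surj hyp_isometry_inj hyp_isometry_linear)

lemma hyp_isometry_continuous: "hyp_isometry f \<Longrightarrow> continuous_on A f"
  by (intro linear_continuous_on linear_conv_bounded_linear[THEN iffD1] hyp_isometry_linear)

lemma hyp_isometry_measurable: "hyp_isometry f \<Longrightarrow> f \<in> borel_measurable borel"
  by (intro borel_measurable_continuous_onI hyp_isometry_continuous)

text \<open>
  Transitivity. It is used throughout to move the point of interest to \<open>(1, 0)\<close>, where inner
  products with it are time coordinates.
\<close>

lemma hyp_frame_exists: "x \<in> hyp_space \<Longrightarrow> \<exists>L. hyp_isometry L \<and> L hyp_origin = x"
  using hyp_isometry_lorentz_boost lorentz_boost_origin hyp_space_iff_chart by metis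

lemma hyp_isometry_split: "hyp_isometry L \<Longrightarrow> L (a, b) = a *\<^sub>R L hyp_origin + L (0, b)"
proof -
  assume "hyp_isometry L"
  then have L: "linear L" by (rule hyp_isometry_linear)
  have "(a, b) = a *\<^sub>R hyp_origin + (0, b)" by simp
  then show ?thesis using linear_add[OF L] linear_scale[OF L] by metis
qed

section \<open>Hyperbolic distance and geodesics\<close>

lemma mink_inner_hyp_ge_1:
  assumes "x \<in> hyp_space" "y \<in> hyp_space" shows "- mink_inner x y \<ge> 1"
proof -
  obtain L where L: "hyp_isometry L" "L hyp_origin = x" using hyp_frame_exists assms by blast
  obtain y' where y': "y' \<in> hyp_space" "y = L y'" using hyp_isometry_preimage L assms by blast
  have "- mink_inner x y = fst y'" using L y' by (auto simp: hyp_isometry_inner mink_inner_def[of hyp_origin] simp flip: L(2))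
  moreover have "fst y' \<ge> 1" using y' by (subst (asm) hyp_space_iff_chart, cases y') (auto simp: hyp_chart_def)
  ultimately show ?thesis by simp
qed

lemma cosh_hyp_dist: "x \<in> hyp_space \<Longrightarrow> y \<in> hyp_space \<Longrightarrow> cosh (hyp_dist x y) = - mink_inner x y"
  unfolding hyp_dist_def by (rule cosh_arcosh_real[OF mink_inner_hyp_ge_1])

lemma hyp_dist_nonneg: "x \<in> hyp_space \<Longrightarrow> y \<in> hyp_space \<Longrightarrow> 0 \<le> hyp_dist x y"
  unfolding hyp_dist_def by (rule arcosh_nonneg_real[OF mink_inner_hyp_ge_1])

lemma hyp_dist_commute: "hyp_dist x y = hyp_dist y x"
  by (simp add: hyp_dist_def mink_inner_commute)

lemma hyp_dist_isometry: "hyp_isometry f \<Longrightarrow> hyp_dist (f x) (f y) = hyp_dist x y"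
  by (simp add: hyp_dist_def hyp_isometry_inner)

lemma hyp_dist_le_iff:
  assumes "x \<in> hyp_space" "y \<in> hyp_space" "0 \<le> d"
  shows "hyp_dist x y \<le> d \<longleftrightarrow> - mink_inner x y \<le> cosh d"
  using cosh_real_nonneg_le_iff[of "hyp_dist x y" d] assms by (simp add: cosh_hyp_dist hyp_dist_nonneg)

lemma hyp_dist_less_iff:
  assumes "x \<in> hyp_space" "y \<in> hyp_space" "0 \<le> d"
  shows "hyp_dist x y < d \<longleftrightarrow> - mink_inner x y < cosh d"
  using cosh_real_nonneg_less_iff[of "hyp_dist x y" d] assms by (simp add: cosh_hyp_dist hyp_dist_nonneg)

text \<open>
  Move the middle point to \<open>(1, 0)\<close>. A point at distance \<open>d\<close> from there has time coordinate
  \<open>cosh d\<close> and spatial norm \<open>sinh d\<close>, so the inequality is Cauchy--Schwarz combined with the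
  addition theorem for \<open>cosh\<close>.
\<close>

lemma hyp_dist_triangle:
  assumes "x \<in> hyp_space" "y \<in> hyp_space" "z \<in> hyp_space"
  shows "hyp_dist x z \<le> hyp_dist x y + hyp_dist y z"
proof -
  have origin: "hyp_dist x z \<le> hyp_dist x hyp_origin + hyp_dist hyp_origin z"
    if xz: "x \<in> hyp_space" "z \<in> hyp_space" for x z :: "'a mink"
  proof -
    have s: "sinh (hyp_dist hyp_origin w) = norm (snd w)" "cosh (hyp_dist hyp_origin w) = fst w" if w: "w \<in> hyp_space" for w :: "'a mink"
    proof -
      show 1: "cosh (hyp_dist hyp_origin w) = fst w"
        using w by (simp add: cosh_hyp_dist mink_inner_def)
      have "(sinh (hyp_dist hyp_origin w))\<^sup>2 = (norm (snd w))\<^sup>2"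
        using w unfolding sinh_square_eq 1 power2_norm_eq_inner by (simp add: hyp_space_def mink_inner_def power2_eq_square)
      then show "sinh (hyp_dist hyp_origin w) = norm (snd w)"
        using hyp_dist_nonneg[OF hyp_origin_in w] by (simp add: power2_eq_iff_nonneg)
    qed
    have "- mink_inner x z \<le> fst x * fst z + norm (snd x) * norm (snd z)"
      using Cauchy_Schwarz_ineq2[of "snd x" "snd z"] by (simp add: mink_inner_def)
    also have "\<dots> = cosh (hyp_dist hyp_origin x + hyp_dist hyp_origin z)"
      using xz by (simp add: cosh_add s)
    finally show ?thesis
      using hyp_dist_le_iff[OF xz, of "hyp_dist hyp_origin x + hyp_dist hyp_origin z"]
        hyp_dist_nonneg[OF hyp_origin_in xz(1)] hyp_dist_nonneg[OF hyp_origin_in xz(2)]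
      by (simp add: hyp_dist_commute[of x hyp_origin])
  qed
  obtain L where L: "hyp_isometry L" "L hyp_origin = y" using hyp_frame_exists assms by blast
  obtain x' z' where "x' \<in> hyp_space" "x = L x'" "z' \<in> hyp_space" "z = L z'"
    using hyp_isometry_preimage L assms by blast
  with origin[of x' z'] show ?thesis by (simp add: hyp_dist_isometry[OF L(1)] flip: L(2))
qed

lemma hyp_dist_eq_0: 
  assumes "x \<in> hyp_space" "y \<in> hyp_space" "hyp_dist x y = 0" shows "x = y"
proof -
  obtain L where L: "hyp_isometry L" "L hyp_origin = x" using hyp_frame_exists assms by blast
  obtain y' where y': "y' \<in> hyp_space" "y = L y'" using hyp_isometry_preimage L assms by blast
  have "- mink_inner x y = fst y'" using L y' by (auto simp: hyp_isometry_inner mink_inner_def[of hyp_origin] simp flip: L(2))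
  moreover have "- mink_inner x y = 1" using cosh_hyp_dist[of x y] assms by simp
  ultimately have "fst y' = 1" by simp
  then have "y' = hyp_origin" using y' by (subst (asm) hyp_space_iff_chart, cases y') (auto simp: hyp_chart_def)
  then show ?thesis using L y' by simp
qed

definition geodesic :: "'n::finite mink \<Rightarrow> 'n mink \<Rightarrow> real \<Rightarrow> 'n mink" where
  "geodesic x v s = cosh s *\<^sub>R x + sinh s *\<^sub>R v"

lemma geodesic_isometry: "hyp_isometry f \<Longrightarrow> geodesic (f x) (f v) s = f (geodesic x v s)"
  by (simp add: geodesic_def linear_add[OF hyp_isometry_linear] linear_scale[OF hyp_isometry_linear])

lemma unit_tangent_frame:
  assumes "(x, v) \<in> unit_tangent" "hyp_isometry L" "L hyp_origin = x"
  obtains u where "norm u = 1" "v = L (0, u)"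
proof -
  obtain v' where v': "v = L v'" using hyp_isometry_surj[OF assms(2)] by (metis surj_def)
  have "mink_inner hyp_origin v' = 0" "mink_inner v' v' = 1"
    using assms hyp_isometry_inner[OF assms(2), of hyp_origin v'] hyp_isometry_inner[OF assms(2), of v' v']
    by (auto simp: unit_tangent_def tangent_space_def mink_norm_def v')
  then have "fst v' = 0" "snd v' \<bullet> snd v' = 1" by (auto simp: mink_inner_def)
  then show ?thesis using that[of "snd v'"] v' by (simp add: norm_eq_1) (metis prod.collapse)
qed

lemma unit_tangent_of_frame:
  assumes "hyp_isometry L" "norm u = 1"
  shows "(L hyp_origin, L (0, u)) \<in> unit_tangent"
  using assms hyp_isometry_hyp_space[OF assms(1) hyp_origin_in] by (auto simp: unit_tangent_def tangent_space_def mink_norm_def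
    hyp_isometry_inner norm_eq_1) (auto simp: mink_inner_def)

lemma geodesic_frame: "hyp_isometry L \<Longrightarrow> geodesic (L hyp_origin) (L (0, u)) s = L (cosh s, sinh s *\<^sub>R u)"
  using hyp_isometry_split[of L "cosh s" "sinh s *\<^sub>R u"] linear_scale[of L "sinh s" "(0, u)"]
  by (simp add: geodesic_def hyp_isometry_linear)

lemma polar_point_in_hyp_space: "norm u = 1 \<Longrightarrow> (cosh s, sinh s *\<^sub>R u) \<in> hyp_space"
  using cosh_square_eq[of s] by (simp add: hyp_space_def mink_inner_def norm_eq_1 power2_eq_square)

lemma geodesic_in_hyp_space: "(x, v) \<in> unit_tangent \<Longrightarrow> geodesic x v s \<in> hyp_space"
  by (metis (no_types, lifting) geodesic_frame hyp_frame_exists hyp_isometry_hyp_space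
      mem_Collect_eq polar_point_in_hyp_space case_prodD unit_tangent_def unit_tangent_frame)

lemma hyp_dist_geodesic: 
  assumes "(x, v) \<in> unit_tangent"
  shows "hyp_dist (geodesic x v s) (geodesic x v t) = \<bar>s - t\<bar>"
proof -
  have "mink_inner x x = -1" "mink_inner x v = 0" "mink_inner v v = 1"
    using assms by (auto simp: unit_tangent_def hyp_space_def tangent_space_def mink_norm_def)
  then have "- mink_inner (geodesic x v s) (geodesic x v t) = cosh \<bar>s - t\<bar>"
    by (simp add: geodesic_def mink_inner_simps mink_inner_commute[of v x] cosh_diff)
  then show ?thesis unfolding hyp_dist_def by (simp only: arcosh_cosh_real abs_ge_zero)
qed

lemma hyp_flow_eq: "hyp_flow s (x, v) = (geodesic x v s, sinh s *\<^sub>R x + cosh s *\<^sub>R v)"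
  by (simp add: hyp_flow_def geodesic_def)

lemma hyp_flow_frame:
  assumes J: "hyp_isometry J"
  shows "hyp_flow s (J hyp_origin, J (0, u)) = (J (cosh s, sinh s *\<^sub>R u), J (sinh s, cosh s *\<^sub>R u))"
  using linear_scale[OF hyp_isometry_linear[OF J], of "cosh s" "(0, u)"]
  by (simp add: hyp_flow_eq geodesic_frame[OF J] hyp_isometry_split[OF J, of "sinh s"])

lemma geodesic_flow_add:
  "geodesic (geodesic x v s) (sinh s *\<^sub>R x + cosh s *\<^sub>R v) t = geodesic x v (s + t)"
  by (simp add: geodesic_def cosh_add sinh_add algebra_simps)

lemma hyp_flow_measurable [measurable]: "hyp_flow s \<in> borel_measurable borel"
proof -
  have eq: "hyp_flow s = (\<lambda>p. (cosh s *\<^sub>R fst p + sinh s *\<^sub>R snd p, sinh s *\<^sub>R fst p + cosh s *\<^sub>R snd p))"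
    by (auto simp: hyp_flow_def)
  show ?thesis unfolding eq by (rule borel_measurable_continuous_onI) (intro continuous_intros)
qed

section \<open>Isometry invariance of the hyperbolic volume\<close>

text \<open>
  The Riemannian volume, carried from the chart to the hyperboloid so that isometries act on it.
\<close>

definition hyp_measure :: "'n::finite mink measure" where
  "hyp_measure = distr hyp_volume borel hyp_chart"

lemma hyp_chart_measurable [measurable]: "hyp_chart \<in> borel_measurable borel"
  unfolding hyp_chart_def by measurable

lemma sets_hyp_volume [measurable_cong, simp]: "sets (hyp_volume :: (real^'n::finite) measure) = sets borel"
  by (simp add: hyp_volume_def)

lemma space_hyp_volume [simp]: "space (hyp_volume :: (real^'n::finite) measure) = UNIV"
  by (simp add: hyp_volume_def)

lemma sets_hyp_measure [measurable_cong, simp]: "sets (hyp_measure :: 'n::finite mink measure) = sets borel"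
  by (simp add: hyp_measure_def)

lemma space_hyp_measure [simp]: "space (hyp_measure :: 'n::finite mink measure) = UNIV"
  by (simp add: hyp_measure_def)

lemma nn_integral_hyp_measure_chart:
  assumes [measurable]: "F \<in> borel_measurable borel"
  shows "(\<integral>\<^sup>+z. F z \<partial>hyp_measure) = (\<integral>\<^sup>+y. F (hyp_chart y) \<partial>hyp_volume)"
  unfolding hyp_measure_def by (rule nn_integral_distr) auto

lemma nn_integral_hyp_measure:
  fixes F :: "'n::finite mink \<Rightarrow> ennreal"
  assumes [measurable]: "F \<in> borel_measurable borel"
  shows "(\<integral>\<^sup>+z. F z \<partial>hyp_measure)
    = (\<integral>\<^sup>+y. F (hyp_chart y) * ennreal (1 / sqrt (1 + (norm y)\<^sup>2)) \<partial>lborel)"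
  by (simp add: nn_integral_hyp_measure_chart hyp_volume_def nn_integral_density mult.commute)

lemma nn_integral_hyp_measure_cong:
  fixes F :: "'n::finite mink \<Rightarrow> ennreal"
  assumes "F \<in> borel_measurable borel" "G \<in> borel_measurable borel"
    and "\<And>z. z \<in> hyp_space \<Longrightarrow> F z = G z"
  shows "(\<integral>\<^sup>+z. F z \<partial>hyp_measure) = (\<integral>\<^sup>+z. G z \<partial>hyp_measure)"
  using assms by (simp add: nn_integral_hyp_measure)

lemma nn_integral_hyp_measure_mono:
  fixes F :: "'n::finite mink \<Rightarrow> ennreal"
  assumes "F \<in> borel_measurable borel" "G \<in> borel_measurable borel"
    and "\<And>z. z \<in> hyp_space \<Longrightarrow> F z \<le> G z"
  shows "(\<integral>\<^sup>+z. F z \<partial>hyp_measure) \<le> (\<integral>\<^sup>+z. G z \<partial>hyp_measure)"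
  using assms by (simp add: nn_integral_hyp_measure_chart nn_integral_mono)

text \<open>
  A boost takes \<open>(1, 0)\<close> to its image under \<open>L\<close>. Undoing it leaves an isometry \<open>M\<close> that fixes
  \<open>(1, 0)\<close>, hence preserves time coordinates, hence the Euclidean norm.
\<close>

lemma lborel_hyp_isometry:
  fixes f :: "'n::finite mink \<Rightarrow> ennreal"
  assumes [measurable]: "f \<in> borel_measurable borel" and L: "hyp_isometry L"
  shows "(\<integral>\<^sup>+z. f (L z) \<partial>lborel) = (\<integral>\<^sup>+z. f z \<partial>lborel)"
proof -
  have shear1: "(\<integral>\<^sup>+z. h (time_shear w z) \<partial>lborel) = (\<integral>\<^sup>+z. h z \<partial>lborel)"
    if "h \<in> borel_measurable borel" for h :: "'n mink \<Rightarrow> ennreal" and w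
    using lborel_shear_snd[OF that, of "\<lambda>a. a *\<^sub>R w"] by (simp add: time_shear_def)
  have shear2: "(\<integral>\<^sup>+z. h (space_shear w z) \<partial>lborel) = (\<integral>\<^sup>+z. h z \<partial>lborel)"
    if "h \<in> borel_measurable borel" for h :: "'n mink \<Rightarrow> ennreal" and w
    using lborel_shear_fst[OF that, of "\<lambda>b. w \<bullet> b"] by (simp add: space_shear_def)
  have [measurable]: "time_shear w \<in> borel_measurable borel" "space_shear w \<in> borel_measurable borel" for w :: "real^'n"
    unfolding time_shear_def space_shear_def by (auto intro!: borel_measurable_continuous_onI continuous_intros)
  have boost: "(\<integral>\<^sup>+z. f (lorentz_boost y z) \<partial>lborel) = (\<integral>\<^sup>+z. f z \<partial>lborel)" for y
    unfolding lorentz_boost_shears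
    by (simp add: shear1[of "\<lambda>z. f (time_shear _ (space_shear _ z))"] shear2[of "\<lambda>z. f (time_shear _ z)"] shear1)
  define y where "y = snd (L hyp_origin)"
  have y: "L hyp_origin = hyp_chart y"
    unfolding y_def by (metis L hyp_isometry_hyp_space hyp_origin_in hyp_space_iff_chart)
  define M where "M = lorentz_boost (- y) \<circ> L"
  have M: "hyp_isometry M"
    unfolding M_def by (intro hyp_isometry_comp hyp_isometry_lorentz_boost L)
  have LM: "L z = lorentz_boost y (M z)" for z
    by (simp add: M_def lorentz_boost_minus')
  have Mo: "M hyp_origin = hyp_origin"
    by (simp add: M_def y lorentz_boost_minus flip: lorentz_boost_origin)
  have "norm (M z) = norm z" for z
  proof -
    have nsq: "(norm x)\<^sup>2 = mink_inner x x + 2 * (mink_inner hyp_origin x)\<^sup>2" for x :: "'n mink"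
      unfolding power2_norm_eq_inner by (simp add: inner_prod_def mink_inner_def power2_eq_square)
    have "mink_inner hyp_origin (M z) = mink_inner hyp_origin z"
      using hyp_isometry_inner[OF M, of hyp_origin z] Mo by simp
    then have "(norm (M z))\<^sup>2 = (norm z)\<^sup>2"
      by (simp only: nsq hyp_isometry_inner[OF M])
    then show ?thesis by (simp add: power2_eq_iff_nonneg)
  qed
  then have distr: "distr lborel borel M = lborel"
    by (intro lborel_distr_norm_preserving hyp_isometry_linear M)
  have [measurable]: "M \<in> borel_measurable borel" "lorentz_boost y \<in> borel_measurable borel"
    by (auto intro!: hyp_isometry_measurable M hyp_isometry_lorentz_boost)
  have "(\<integral>\<^sup>+z. f (L z) \<partial>lborel) = (\<integral>\<^sup>+z. f (lorentz_boost y z) \<partial>distr lborel borel M)"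
    by (simp add: LM nn_integral_distr)
  then show ?thesis by (simp add: distr boost)
qed

text \<open>
  The truncated cone over the hyperboloid. The isometries map it onto itself, and
  \<open>lborel_hyp_isometry\<close> says how they act on its Lebesgue measure.
\<close>

definition unit_cone :: "'n::finite mink set" where
  "unit_cone = {z. 0 < fst z \<and> -1 \<le> mink_inner z z \<and> mink_inner z z < 0}"

definition mink_dir :: "'n::finite mink \<Rightarrow> 'n mink" where
  "mink_dir z = z /\<^sub>R sqrt (- mink_inner z z)"

lemma unit_cone_measurable [measurable]: "unit_cone \<in> sets borel"
  unfolding unit_cone_def by measurable

lemma mink_dir_measurable [measurable]: "mink_dir \<in> borel_measurable borel"
  unfolding mink_dir_def by measurable

text \<open>
  Write a point of the cone as \<open>t (sqrt(1 + |y|\<^sup>2), y)\<close> with \<open>0 < t \<le> 1\<close>. For a fixed spatial part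
  \<open>b\<close> the substitution \<open>a = sqrt(t\<^sup>2 + |b|\<^sup>2)\<close> replaces the time coordinate by \<open>t\<close>, and then for a
  fixed \<open>t\<close> the scaling \<open>b = t y\<close> produces the factor \<open>t\<^sup>n\<close> and the volume density of the chart.
\<close>

lemma nn_integral_unit_cone:
  fixes F :: "'n::finite mink \<Rightarrow> ennreal"
  assumes [measurable]: "F \<in> borel_measurable borel"
  shows "(\<integral>\<^sup>+z. F (mink_dir z) * indicator unit_cone z \<partial>lborel)
    = ennreal (1 / (CARD('n) + 1)) * (\<integral>\<^sup>+z. F z \<partial>hyp_measure)"
proof -
  define n where "n = CARD('n)"
  have nz: "AE b in lborel. b \<noteq> (0::real^'n)" by (rule AE_lborel_singleton)
  let ?g = "\<lambda>(b::real^'n) t. sqrt (t\<^sup>2 + (norm b)\<^sup>2)"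
  have [measurable]: "(\<lambda>z::'n mink. F (mink_dir z) * indicator unit_cone z) \<in> borel_measurable (lborel \<Otimes>\<^sub>M lborel)"
    by (simp add: lborel_prod)
  have "(\<integral>\<^sup>+z. F (mink_dir z) * indicator unit_cone z \<partial>lborel)
    = (\<integral>\<^sup>+b. \<integral>\<^sup>+a. F (mink_dir (a, b)) * indicator unit_cone (a, b) \<partial>lborel \<partial>lborel)"
    unfolding lborel_prod[symmetric] by (rule lborel_pair.nn_integral_snd[symmetric]) simp
  also have "\<dots> = (\<integral>\<^sup>+b. \<integral>\<^sup>+t. F (?g b t / t, b /\<^sub>R t) * ennreal (t / ?g b t) * indicator {0<..1} t \<partial>lborel \<partial>lborel)"
  proof (rule nn_integral_cong_AE, use nz in eventually_elim)
    fix b :: "real^'n" assume "b \<noteq> 0"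
    then have b: "norm b > 0" by simp
    define f where "f a = F (mink_dir (a, b)) * indicator {norm b<..} a" for a
    have [measurable]: "f \<in> borel_measurable borel" unfolding f_def by measurable
    \<comment> \<open>The derivative of \<open>?g b\<close> exists at \<open>0\<close> because \<open>b\<close> is nonzero.\<close>
    have g: "?g b t > 0" "(?g b t)\<^sup>2 = t\<^sup>2 + (norm b)\<^sup>2" for t
      using b by (auto simp: add_nonneg_pos)
    have "(\<integral>\<^sup>+a. F (mink_dir (a, b)) * indicator unit_cone (a, b) \<partial>lborel)
      = (\<integral>\<^sup>+a. f a * indicator {?g b 0..?g b 1} a \<partial>lborel)"
    proof (rule nn_integral_cong)
      fix a :: real
      have "(a, b) \<in> unit_cone \<longleftrightarrow> norm b < a \<and> a \<le> ?g b 1"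
      proof -
        have "0 < a \<and> b \<bullet> b - a * a < 0 \<longleftrightarrow> norm b < a"
        proof
          assume "0 < a \<and> b \<bullet> b - a * a < 0"
          then show "norm b < a"
            by (intro power2_less_imp_less[of "norm b" a]) (auto simp: power2_norm_eq_inner power2_eq_square[of a])
        next
          assume ba: "norm b < a"
          then have "(norm b)\<^sup>2 < a\<^sup>2" by (intro power_strict_mono) auto
          then show "0 < a \<and> b \<bullet> b - a * a < 0"
            using order.strict_trans[OF b ba] unfolding power2_norm_eq_inner by (simp add: power2_eq_square)
        qed
        moreover have "- 1 \<le> b \<bullet> b - a * a \<longleftrightarrow> a \<le> ?g b 1" if "norm b < a"
        proof -
          have "a \<le> ?g b 1 \<longleftrightarrow> a\<^sup>2 \<le> (?g b 1)\<^sup>2"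
            using order.strict_trans[OF b that] g(1)[of 1] by (subst power_mono_iff) (auto intro: less_imp_le)
          then show ?thesis unfolding g(2) power2_norm_eq_inner by (auto simp: power2_eq_square)
        qed
        ultimately show ?thesis by (auto simp: unit_cone_def mink_inner_def)
      qed
      then show "F (mink_dir (a, b)) * indicator unit_cone (a, b) = f a * indicator {?g b 0..?g b 1} a"
        by (auto simp: f_def indicator_def)
    qed
    also have "\<dots> = (\<integral>\<^sup>+t. f (?g b t) * ennreal (t / ?g b t) * indicator {0..1} t \<partial>lborel)"
    proof (rule nn_integral_substitution_aux)
      show "(?g b has_real_derivative t / ?g b t) (at t)" for t
        using g(1)[of t] by (auto intro!: derivative_eq_intros simp: field_simps)
      show "continuous_on {0..1} (\<lambda>t. t / ?g b t)"
        using g(1) by (intro continuous_intros) (metis less_irrefl)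
    qed auto
    also have "\<dots> = (\<integral>\<^sup>+t. F (?g b t / t, b /\<^sub>R t) * ennreal (t / ?g b t) * indicator {0<..1} t \<partial>lborel)"
    proof (rule nn_integral_cong)
      fix t :: real
      show "f (?g b t) * ennreal (t / ?g b t) * indicator {0..1} t = F (?g b t / t, b /\<^sub>R t) * ennreal (t / ?g b t) * indicator {0<..1} t"
      proof (cases "0 < t")
        case True
        have "norm b < ?g b t" using True by (intro real_less_rsqrt) simp
        moreover have "mink_dir (?g b t, b) = (?g b t / t, b /\<^sub>R t)"
        proof -
          have "- mink_inner (?g b t, b) (?g b t, b) = t\<^sup>2"
            using g(2)[of t] unfolding power2_norm_eq_inner by (simp add: mink_inner_def power2_eq_square)
          then show ?thesis using True by (simp add: mink_dir_def divide_inverse mult.commute)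
        qed
        ultimately show ?thesis using True by (simp add: f_def indicator_def)
      qed (auto simp: indicator_def)
    qed
    finally show "(\<integral>\<^sup>+a. F (mink_dir (a, b)) * indicator unit_cone (a, b) \<partial>lborel)
      = (\<integral>\<^sup>+t. F (?g b t / t, b /\<^sub>R t) * ennreal (t / ?g b t) * indicator {0<..1} t \<partial>lborel)" .
  qed
  also have "\<dots> = (\<integral>\<^sup>+t. \<integral>\<^sup>+b. F (?g b t / t, b /\<^sub>R t) * ennreal (t / ?g b t) * indicator {0<..1} t \<partial>lborel \<partial>lborel)"
    by (rule lborel_pair.Fubini') measurable
  also have "\<dots> = (\<integral>\<^sup>+t. ennreal (t ^ n) * indicator {0..1} t * (\<integral>\<^sup>+z. F z \<partial>hyp_measure) \<partial>lborel)"
  proof (rule nn_integral_cong_AE, use AE_lborel_singleton[of "0::real"] in eventually_elim)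
    fix t :: real assume "t \<noteq> 0"
    show "(\<integral>\<^sup>+b. F (?g b t / t, b /\<^sub>R t) * ennreal (t / ?g b t) * indicator {0<..1} t \<partial>lborel)
      = ennreal (t ^ n) * indicator {0..1} t * (\<integral>\<^sup>+z. F z \<partial>hyp_measure)"
    proof (cases "0 < t \<and> t \<le> 1")
      case True
      then have t: "t > 0" by simp
      have "(\<integral>\<^sup>+b. F (?g b t / t, b /\<^sub>R t) * ennreal (t / ?g b t) * indicator {0<..1} t \<partial>lborel)
        = ennreal (t ^ n) * (\<integral>\<^sup>+y. F (?g (t *\<^sub>R y) t / t, (t *\<^sub>R y) /\<^sub>R t) * ennreal (t / ?g (t *\<^sub>R y) t) * indicator {0<..1} t \<partial>lborel)"
        by (subst nn_integral_scaleR[OF _ t]) (auto simp: n_def)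
      also have "(\<integral>\<^sup>+y. F (?g (t *\<^sub>R y) t / t, (t *\<^sub>R y) /\<^sub>R t) * ennreal (t / ?g (t *\<^sub>R y) t) * indicator {0<..1} t \<partial>lborel)
        = (\<integral>\<^sup>+z. F z \<partial>hyp_measure)"
      proof -
        have "?g (t *\<^sub>R y) t = t * sqrt (1 + (norm y)\<^sup>2)" for y
        proof -
          have "t\<^sup>2 + (norm (t *\<^sub>R y))\<^sup>2 = t\<^sup>2 * (1 + (norm y)\<^sup>2)" by (simp add: power_mult_distrib algebra_simps)
          then show ?thesis using t by (simp add: real_sqrt_mult)
        qed
        then show ?thesis using t True by (simp add: nn_integral_hyp_measure hyp_chart_def)
      qed
      finally show ?thesis using True by (simp add: indicator_def)
    qed (use \<open>t \<noteq> 0\<close> in \<open>auto simp: indicator_def\<close>)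
  qed
  also have "\<dots> = (\<integral>\<^sup>+t. ennreal (t ^ n) * indicator {0..1} t \<partial>lborel) * (\<integral>\<^sup>+z. F z \<partial>hyp_measure)"
    by (rule nn_integral_multc) measurable
  also have "(\<integral>\<^sup>+t. ennreal (t ^ n) * indicator {0..1} t \<partial>lborel) = ennreal (1 ^ Suc n / Suc n - 0 ^ Suc n / Suc n)"
    by (rule nn_integral_FTC_Icc[where F = "\<lambda>t. t ^ Suc n / Suc n"])
       (auto intro!: derivative_eq_intros simp del: power_Suc of_nat_Suc)
  finally show ?thesis by (simp add: n_def add.commute)
qed

theorem nn_integral_hyp_measure_isometry:
  fixes F :: "'n::finite mink \<Rightarrow> ennreal"
  assumes [measurable]: "F \<in> borel_measurable borel" and L: "hyp_isometry L"
  shows "(\<integral>\<^sup>+z. F (L z) \<partial>hyp_measure) = (\<integral>\<^sup>+z. F z \<partial>hyp_measure)"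
proof -
  have [measurable]: "L \<in> borel_measurable borel" by (rule hyp_isometry_measurable[OF L])
  let ?k = "ennreal (1 / (CARD('n) + 1))"
  have dir_in: "mink_dir z \<in> hyp_space" if z: "z \<in> unit_cone" for z :: "'n mink"
  proof -
    have q: "mink_inner z z < 0" "0 < fst z" using z by (auto simp: unit_cone_def)
    then have "mink_inner (mink_dir z) (mink_dir z) = -1"
      by (simp add: mink_dir_def mink_inner_simps field_simps)
    then show ?thesis using q by (simp add: hyp_space_def mink_dir_def)
  qed
  have dir: "L (mink_dir z) = mink_dir (L z)" for z
    by (simp add: mink_dir_def linear_scale[OF hyp_isometry_linear[OF L]] hyp_isometry_inner[OF L])
  have pos: "0 < fst (L z)" if z: "z \<in> unit_cone" for z
  proof -
    have "0 < fst (mink_dir (L z))"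
      using hyp_isometry_hyp_space[OF L dir_in[OF z]] by (simp add: dir hyp_space_def)
    then show ?thesis using z by (simp add: mink_dir_def hyp_isometry_inner[OF L] unit_cone_def zero_less_mult_iff)
  qed
  have cone: "L z \<in> unit_cone \<longleftrightarrow> z \<in> unit_cone" for z
  proof
    assume "z \<in> unit_cone" then show "L z \<in> unit_cone"
      using pos by (simp add: unit_cone_def hyp_isometry_inner[OF L])
  next
    assume Lz: "L z \<in> unit_cone"
    then have q: "mink_inner z z < 0" "-1 \<le> mink_inner z z" by (auto simp: unit_cone_def hyp_isometry_inner[OF L])
    have "fst z \<noteq> 0" using q inner_ge_zero[of "snd z"] by (auto simp: mink_inner_def simp del: inner_ge_zero)
    moreover have False if "fst z < 0"
    proof -
      have "- z \<in> unit_cone" using that q by (simp add: unit_cone_def mink_inner_simps)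
      from pos[OF this] Lz show False
        by (simp add: linear_neg[OF hyp_isometry_linear[OF L]] unit_cone_def)
    qed
    ultimately show "z \<in> unit_cone" using q by (force simp: unit_cone_def)
  qed
  have "?k * (\<integral>\<^sup>+z. F (L z) \<partial>hyp_measure) = (\<integral>\<^sup>+z. F (L (mink_dir z)) * indicator unit_cone z \<partial>lborel)"
    by (rule nn_integral_unit_cone[symmetric]) measurable
  also have "\<dots> = (\<integral>\<^sup>+z. F (mink_dir (L z)) * indicator unit_cone (L z) \<partial>lborel)"
    by (simp add: dir cone indicator_def)
  also have "\<dots> = (\<integral>\<^sup>+z. F (mink_dir z) * indicator unit_cone z \<partial>lborel)"
    by (rule lborel_hyp_isometry[OF _ L]) measurable
  also have "\<dots> = ?k * (\<integral>\<^sup>+z. F z \<partial>hyp_measure)"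
    by (rule nn_integral_unit_cone) measurable
  finally show ?thesis by (simp add: ennreal_mult_cancel_left)
qed

text \<open>
  At a point at distance \<open>d\<close> from the origin of the coordinates, with \<open>t = cosh d\<close>, this is
  \<open>sinh(d)\<^sup>-\<^sup>m\<close>, cut off to \<open>0 < d \<le> R\<close> (see \<open>radial_weight_dist\<close>). For \<open>m = n - 1\<close> it cancels the
  growth of the spheres about that origin.
\<close>

definition radial_weight :: "nat \<Rightarrow> real \<Rightarrow> real \<Rightarrow> ennreal" where
  "radial_weight m R t = ennreal (1 / sqrt (t\<^sup>2 - 1) ^ m) * indicator {1<..cosh R} t"

lemma radial_weight_measurable [measurable]: "radial_weight m R \<in> borel_measurable borel"
  unfolding radial_weight_def by measurable

text \<open>
  By invariance the pole may be moved to \<open>(1, 0)\<close>. There, Euclidean polar coordinates in the chart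
  and the substitution \<open>\<rho> = sinh s\<close> give the claim: \<open>cosh s\<close> from the substitution cancels the
  density of the volume, and \<open>\<rho>\<^sup>n\<^sup>-\<^sup>1\<close> cancels the weight.
\<close>

theorem nn_integral_hyp_polar:
  fixes G :: "'n::finite mink \<Rightarrow> ennreal"
  assumes [measurable]: "G \<in> borel_measurable borel" and L: "hyp_isometry L" and R: "0 < R"
  shows "real CARD('n) * (\<integral>\<^sup>+u. \<integral>\<^sup>+s. G (L (cosh s, sinh s *\<^sub>R u)) * indicator {0<..R} s \<partial>lborel \<partial>sphere_measure)
    = (\<integral>\<^sup>+z. G z * radial_weight (CARD('n) - 1) R (- mink_inner (L hyp_origin) z) \<partial>hyp_measure)"
proof -
  have [measurable]: "L \<in> borel_measurable borel" by (rule hyp_isometry_measurable[OF L])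
  define m where "m = CARD('n) - 1"
  have "(\<integral>\<^sup>+z. G z * radial_weight m R (- mink_inner (L hyp_origin) z) \<partial>hyp_measure)
    = (\<integral>\<^sup>+z. G (L z) * radial_weight m R (- mink_inner (L hyp_origin) (L z)) \<partial>hyp_measure)"
    by (rule nn_integral_hyp_measure_isometry[OF _ L, symmetric]) measurable
  also have "\<dots> = (\<integral>\<^sup>+z. G (L z) * radial_weight m R (fst z) \<partial>hyp_measure)"
    by (simp add: hyp_isometry_inner[OF L] mink_inner_def[of hyp_origin])
  also have "\<dots> = (\<integral>\<^sup>+y. G (L (hyp_chart y)) * radial_weight m R (sqrt (1 + (norm y)\<^sup>2)) * ennreal (1 / sqrt (1 + (norm y)\<^sup>2)) \<partial>lborel)"
    by (subst nn_integral_hyp_measure) (auto simp: hyp_chart_def)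
  also have "\<dots> = real CARD('n) *
    (\<integral>\<^sup>+u. \<integral>\<^sup>+\<rho>. G (L (hyp_chart (\<rho> *\<^sub>R u))) * radial_weight m R (sqrt (1 + (norm (\<rho> *\<^sub>R u))\<^sup>2)) * ennreal (1 / sqrt (1 + (norm (\<rho> *\<^sub>R u))\<^sup>2))
        * ennreal (\<rho> ^ m) * indicator {0<..} \<rho> \<partial>lborel \<partial>sphere_measure)"
    unfolding m_def by (rule nn_integral_polar) measurable
  also have "(\<integral>\<^sup>+u. \<integral>\<^sup>+\<rho>. G (L (hyp_chart (\<rho> *\<^sub>R u))) * radial_weight m R (sqrt (1 + (norm (\<rho> *\<^sub>R u))\<^sup>2)) * ennreal (1 / sqrt (1 + (norm (\<rho> *\<^sub>R u))\<^sup>2))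
        * ennreal (\<rho> ^ m) * indicator {0<..} \<rho> \<partial>lborel \<partial>sphere_measure)
    = (\<integral>\<^sup>+u. \<integral>\<^sup>+s. G (L (cosh s, sinh s *\<^sub>R u)) * indicator {0<..R} s \<partial>lborel \<partial>sphere_measure)"
  proof (rule nn_integral_cong)
    fix u :: "real^'n" assume "u \<in> space sphere_measure"
    then have u: "norm u = 1" by (simp add: space_sphere_measure)
    define f where "f \<rho> = G (L (sqrt (1 + \<rho>\<^sup>2), \<rho> *\<^sub>R u)) * ennreal (1 / sqrt (1 + \<rho>\<^sup>2)) * indicator {0<..} \<rho>" for \<rho>
    have [measurable]: "f \<in> borel_measurable borel" unfolding f_def by measurable
    have "(\<integral>\<^sup>+\<rho>. G (L (hyp_chart (\<rho> *\<^sub>R u))) * radial_weight m R (sqrt (1 + (norm (\<rho> *\<^sub>R u))\<^sup>2)) * ennreal (1 / sqrt (1 + (norm (\<rho> *\<^sub>R u))\<^sup>2))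
        * ennreal (\<rho> ^ m) * indicator {0<..} \<rho> \<partial>lborel) = (\<integral>\<^sup>+\<rho>. f \<rho> * indicator {sinh 0..sinh R} \<rho> \<partial>lborel)"
    proof (rule nn_integral_cong)
      fix \<rho> :: real
      show "G (L (hyp_chart (\<rho> *\<^sub>R u))) * radial_weight m R (sqrt (1 + (norm (\<rho> *\<^sub>R u))\<^sup>2)) * ennreal (1 / sqrt (1 + (norm (\<rho> *\<^sub>R u))\<^sup>2))
        * ennreal (\<rho> ^ m) * indicator {0<..} \<rho> = f \<rho> * indicator {sinh 0..sinh R} \<rho>"
      proof (cases "\<rho> > 0")
        case True
        have "cosh R = sqrt (1 + (sinh R)\<^sup>2)"
          by (metis add.commute cosh_real_nonneg cosh_square_eq real_sqrt_unique)
        then have "sqrt (1 + \<rho>\<^sup>2) \<le> cosh R \<longleftrightarrow> sqrt (1 + \<rho>\<^sup>2) \<le> sqrt (1 + (sinh R)\<^sup>2)"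
          by simp
        also have "\<dots> \<longleftrightarrow> \<rho> \<le> sinh R"
          using True R power_mono_iff[of \<rho> "sinh R" 2] by simp
        finally have 1: "sqrt (1 + \<rho>\<^sup>2) \<le> cosh R \<longleftrightarrow> \<rho> \<le> sinh R" .
        have "1 < sqrt (1 + \<rho>\<^sup>2)" using True by simp
        then have "radial_weight m R (sqrt (1 + \<rho>\<^sup>2)) * ennreal (\<rho> ^ m) = indicator {..sinh R} \<rho>"
          using True by (simp add: radial_weight_def 1 indicator_def add_nonneg_nonneg ennreal_mult[symmetric])
        then have "(G (L (hyp_chart (\<rho> *\<^sub>R u))) * ennreal (1 / sqrt (1 + \<rho>\<^sup>2))) * (radial_weight m R (sqrt (1 + \<rho>\<^sup>2)) * ennreal (\<rho> ^ m))
          = (G (L (hyp_chart (\<rho> *\<^sub>R u))) * ennreal (1 / sqrt (1 + \<rho>\<^sup>2))) * indicator {..sinh R} \<rho>" by simp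
        then show ?thesis
          using True by (simp add: f_def u hyp_chart_def mult_ac indicator_def)
      qed (auto simp: f_def)
    qed
    also have "\<dots> = (\<integral>\<^sup>+s. f (sinh s) * ennreal (cosh s) * indicator {0..R} s \<partial>lborel)"
      by (rule nn_integral_substitution_aux)
        (use R in \<open>auto intro!: derivative_eq_intros continuous_intros\<close>)
    also have "\<dots> = (\<integral>\<^sup>+s. G (L (cosh s, sinh s *\<^sub>R u)) * indicator {0<..R} s \<partial>lborel)"
    proof (rule nn_integral_cong)
      fix s :: real
      have "sqrt (1 + (sinh s)\<^sup>2) = cosh s"
        by (metis add.commute cosh_real_nonneg cosh_square_eq real_sqrt_unique)
      moreover have "ennreal (1 / cosh s) * ennreal (cosh s) = 1" by (simp add: ennreal_mult[symmetric])
      ultimately show "f (sinh s) * ennreal (cosh s) * indicator {0..R} s = G (L (cosh s, sinh s *\<^sub>R u)) * indicator {0<..R} s"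
        by (auto simp: f_def indicator_def mult.assoc)
    qed
    finally show "(\<integral>\<^sup>+\<rho>. G (L (hyp_chart (\<rho> *\<^sub>R u))) * radial_weight m R (sqrt (1 + (norm (\<rho> *\<^sub>R u))\<^sup>2)) * ennreal (1 / sqrt (1 + (norm (\<rho> *\<^sub>R u))\<^sup>2))
        * ennreal (\<rho> ^ m) * indicator {0<..} \<rho> \<partial>lborel) = (\<integral>\<^sup>+s. G (L (cosh s, sinh s *\<^sub>R u)) * indicator {0<..R} s \<partial>lborel)" .
  qed
  finally show ?thesis by (simp add: m_def)
qed

section \<open>Injectivity radius of a closed hyperbolic manifold\<close>

definition base_ball :: "real \<Rightarrow> 'n::finite mink set" where
  "base_ball R = {x \<in> hyp_space. fst x \<le> cosh R}"

lemma base_ball_iff: "0 \<le> R \<Longrightarrow> x \<in> base_ball R \<longleftrightarrow> x \<in> hyp_space \<and> hyp_dist hyp_origin x \<le> R"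
  using hyp_dist_le_iff[OF hyp_origin_in, of x R] by (auto simp: base_ball_def mink_inner_def[of hyp_origin])

lemma compact_base_ball: "compact (base_ball R :: 'n::finite mink set)"
proof -
  have "base_ball R = {x::'n mink. mink_inner x x = -1 \<and> 0 \<le> fst x \<and> fst x \<le> cosh R}"
  proof -
    have "fst x \<noteq> 0" if "mink_inner x x = -1" for x :: "'n mink"
      using that inner_ge_zero[of "snd x"] by (auto simp: mink_inner_def simp del: inner_ge_zero)
    then have "mink_inner x x = -1 \<Longrightarrow> 0 < fst x \<longleftrightarrow> 0 \<le> fst x" for x :: "'n mink"
      by (metis less_le)
    then show ?thesis unfolding base_ball_def hyp_space_def by blast
  qed
  moreover have "closed {x::'n mink. mink_inner x x = -1 \<and> 0 \<le> fst x \<and> fst x \<le> cosh R}"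
    by (intro closed_Collect_conj closed_Collect_eq closed_Collect_le continuous_intros)
  moreover have "bounded (base_ball R :: 'n mink set)"
  proof (rule boundedI)
    fix x :: "'n mink" assume x: "x \<in> base_ball R"
    then have f: "0 < fst x" "fst x \<le> cosh R" "snd x \<bullet> snd x \<le> fst x * fst x"
      by (auto simp: base_ball_def hyp_space_def mink_inner_def)
    then have "norm (snd x) \<le> fst x"
      by - (rule power2_le_imp_le, auto simp: power2_norm_eq_inner power2_eq_square[of "fst x"])
    moreover have "norm x \<le> norm (fst x) + norm (snd x)"
      by (metis norm_Pair_le prod.collapse)
    ultimately show "norm x \<le> 2 * cosh R" using f by simp
  qed
  ultimately show ?thesis by (simp add: compact_eq_bounded_closed)
qed

lemma base_ball_subset: "base_ball R \<subseteq> hyp_space"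
  by (auto simp: base_ball_def)

text \<open>
  In the frame \<open>L\<close> the exponential map is explicit; the next three lemmas read off its distance,
  injectivity and surjectivity from these coordinates.
\<close>

lemma tangent_frame:
  assumes "hyp_isometry L" "v \<in> tangent_space (L hyp_origin)"
  obtains b where "v = L (0, b)" "mink_norm v = norm b"
    "hyp_exp (L hyp_origin) v = L (cosh (norm b), (sinh (norm b) / norm b) *\<^sub>R b)"
proof -
  obtain w where w: "v = L w" using hyp_isometry_surj[OF assms(1)] by (metis surj_def)
  have "mink_inner hyp_origin w = 0"
    using assms by (simp add: tangent_space_def w hyp_isometry_inner)
  then have "fst w = 0" by (simp add: mink_inner_def)
  then have v: "v = L (0, snd w)" using w by (metis prod.collapse)
  have nv: "mink_norm v = norm (snd w)"
    by (simp add: mink_norm_def v hyp_isometry_inner[OF assms(1)] mink_inner_def[of "(0, _)"] norm_eq_sqrt_inner)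
  have "hyp_exp (L hyp_origin) v = L (cosh (norm (snd w)), (sinh (norm (snd w)) / norm (snd w)) *\<^sub>R snd w)"
    unfolding hyp_exp_def nv hyp_isometry_split[OF assms(1), of "cosh _"]
    unfolding v using linear_scale[OF hyp_isometry_linear[OF assms(1)], of "sinh (norm (snd w)) / norm (snd w)" "(0, snd w)"]
    by simp
  then show ?thesis using that v nv by blast
qed

lemma hyp_exp_polar:
  assumes "x \<in> hyp_space" "v \<in> tangent_space x"
  shows "hyp_exp x v \<in> hyp_space" "hyp_dist x (hyp_exp x v) = mink_norm v"
proof -
  obtain L where L: "hyp_isometry L" "L hyp_origin = x" using hyp_frame_exists assms by blast
  obtain b where b: "v = L (0, b)" "mink_norm v = norm b"
    "hyp_exp x v = L (cosh (norm b), (sinh (norm b) / norm b) *\<^sub>R b)"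
    using tangent_frame[of L v] L assms by auto
  have "(cosh (norm b), (sinh (norm b) / norm b) *\<^sub>R b) \<in> hyp_space"
  proof (cases "b = 0")
    case False
    then show ?thesis using polar_point_in_hyp_space[of "b /\<^sub>R norm b" "norm b"] by (simp add: divide_inverse)
  qed simp
  then show "hyp_exp x v \<in> hyp_space" unfolding b(3) by (rule hyp_isometry_hyp_space[OF L(1)])
  show "hyp_dist x (hyp_exp x v) = mink_norm v"
  proof -
    have "hyp_dist x (hyp_exp x v) = hyp_dist (L hyp_origin) (L (cosh (norm b), (sinh (norm b) / norm b) *\<^sub>R b))"
      by (simp only: b(3) L(2))
    also have "\<dots> = hyp_dist hyp_origin (cosh (norm b), (sinh (norm b) / norm b) *\<^sub>R b)"
      by (rule hyp_dist_isometry[OF L(1)])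
    also have "\<dots> = mink_norm v"
      by (simp add: b(2) hyp_dist_def mink_inner_def arcosh_cosh_real)
    finally show ?thesis .
  qed
qed

lemma inj_on_hyp_exp: "x \<in> hyp_space \<Longrightarrow> inj_on (hyp_exp x) (tangent_space x)"
proof (rule inj_onI)
  fix v w assume x: "x \<in> hyp_space" and vw: "v \<in> tangent_space x" "w \<in> tangent_space x" "hyp_exp x v = hyp_exp x w"
  obtain L where L: "hyp_isometry L" "L hyp_origin = x" using hyp_frame_exists x by blast
  obtain b where b: "v = L (0, b)" "mink_norm v = norm b"
    "hyp_exp x v = L (cosh (norm b), (sinh (norm b) / norm b) *\<^sub>R b)"
    using tangent_frame[of L v] L vw by auto
  obtain c where c: "w = L (0, c)" "mink_norm w = norm c"
    "hyp_exp x w = L (cosh (norm c), (sinh (norm c) / norm c) *\<^sub>R c)"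
    using tangent_frame[of L w] L vw by auto
  have eq: "norm b = norm c" using hyp_exp_polar[OF x] vw b c by metis
  have "(sinh (norm b) / norm b) *\<^sub>R b = (sinh (norm c) / norm c) *\<^sub>R c"
    using vw(3) b c hyp_isometry_inj[OF L(1)] by (auto dest: injD)
  then have "b = c" using eq by (cases "b = 0") auto
  then show "v = w" using b c by simp
qed

lemma hyp_exp_surj:
  assumes "x \<in> hyp_space" "y \<in> hyp_space"
  shows "\<exists>v\<in>tangent_space x. hyp_exp x v = y"
proof -
  obtain L where L: "hyp_isometry L" "L hyp_origin = x" using hyp_frame_exists assms by blast
  obtain y' where y': "y' \<in> hyp_space" "y = L y'" using hyp_isometry_preimage L assms by blast
  define t where "t = arsinh (norm (snd y'))"
  have t: "0 \<le> t" "norm (snd y') = sinh t"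
    using arsinh_real_neg_iff[of "norm (snd y')"] by (auto simp: t_def not_less[symmetric] simp del: arsinh_real_neg_iff)
  have "fst y' = cosh t"
    using y'(1) hyp_space_iff_chart[of y'] by (cases y') (auto simp: hyp_chart_def t_def cosh_arsinh_real add.commute)
  then have y'': "y' = (cosh t, snd y')" by (metis prod.collapse)
  define b where "b = (t / sinh t) *\<^sub>R snd y'"
  have nb: "norm b = t" using t by (cases "t = 0") (auto simp: b_def)
  have yb: "snd y' = (sinh (norm b) / norm b) *\<^sub>R b"
    using t nb by (cases "t = 0") (auto simp: b_def)
  have T: "L (0, b) \<in> tangent_space x"
    by (simp add: tangent_space_def hyp_isometry_inner L flip: L(2)) (simp add: mink_inner_def)
  then obtain b' where b': "L (0, b) = L (0, b')" "hyp_exp x (L (0, b)) = L (cosh (norm b'), (sinh (norm b') / norm b') *\<^sub>R b')"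
    using tangent_frame[of L "L (0, b)"] L by metis
  have "b' = b" using b'(1) hyp_isometry_inj[OF L(1)] by (auto dest: injD)
  then have "hyp_exp x (L (0, b)) = y" using b' y' y'' yb nb by metis
  then show ?thesis using T by blast
qed

locale closed_hyperbolic =
  fixes \<Gamma> :: "('n::finite mink \<Rightarrow> 'n mink) set"
  assumes manifold: "closed_hyperbolic_manifold \<Gamma>"
begin

lemma iso: "f \<in> \<Gamma> \<Longrightarrow> hyp_isometry f"
  and id_in: "id \<in> \<Gamma>"
  and comp_in: "f \<in> \<Gamma> \<Longrightarrow> g \<in> \<Gamma> \<Longrightarrow> f \<circ> g \<in> \<Gamma>"
  and inv_in: "f \<in> \<Gamma> \<Longrightarrow> inv f \<in> \<Gamma>"
  and free: "f \<in> \<Gamma> \<Longrightarrow> f \<noteq> id \<Longrightarrow> x \<in> hyp_space \<Longrightarrow> f x \<noteq> x"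
  and properly_discontinuous: "compact K \<Longrightarrow> K \<subseteq> hyp_space \<Longrightarrow> finite {f \<in> \<Gamma>. f ` K \<inter> K \<noteq> {}}"
proof -
  note m = manifold[unfolded closed_hyperbolic_manifold_def]
  show "f \<in> \<Gamma> \<Longrightarrow> hyp_isometry f" using m[THEN conjunct1] by simp
  note m = m[THEN conjunct2]
  show "id \<in> \<Gamma>" using m[THEN conjunct1] .
  note m = m[THEN conjunct2]
  show "f \<in> \<Gamma> \<Longrightarrow> g \<in> \<Gamma> \<Longrightarrow> f \<circ> g \<in> \<Gamma>" using m[THEN conjunct1] by simp
  note m = m[THEN conjunct2]
  show "f \<in> \<Gamma> \<Longrightarrow> inv f \<in> \<Gamma>" using m[THEN conjunct1] by simp
  note m = m[THEN conjunct2]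
  show "f \<in> \<Gamma> \<Longrightarrow> f \<noteq> id \<Longrightarrow> x \<in> hyp_space \<Longrightarrow> f x \<noteq> x" using m[THEN conjunct1] by blast
  note m = m[THEN conjunct2]
  show "compact K \<Longrightarrow> K \<subseteq> hyp_space \<Longrightarrow> finite {f \<in> \<Gamma>. f ` K \<inter> K \<noteq> {}}" using m[THEN conjunct1] by simp
qed

lemma inv_f_f: "f \<in> \<Gamma> \<Longrightarrow> inv f (f x) = x"
  by (simp add: hyp_isometry_inj iso)

lemma f_inv_f: "f \<in> \<Gamma> \<Longrightarrow> f (inv f x) = x"
  by (simp add: hyp_isometry_surj iso surj_f_inv_f)

lemma in_space: "f \<in> \<Gamma> \<Longrightarrow> x \<in> hyp_space \<Longrightarrow> f x \<in> hyp_space"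
  by (rule hyp_isometry_hyp_space[OF iso])

lemma covering_ball:
  obtains R where "R > 0" "\<And>x. x \<in> hyp_space \<Longrightarrow> \<exists>f\<in>\<Gamma>. f x \<in> base_ball R"
proof -
  obtain K where K: "compact K" "K \<subseteq> hyp_space" "(\<Union>f\<in>\<Gamma>. f ` K) = hyp_space"
    using manifold[unfolded closed_hyperbolic_manifold_def, THEN conjunct2, THEN conjunct2, THEN conjunct2,
      THEN conjunct2, THEN conjunct2, THEN conjunct2] by blast
  have "bounded (fst ` K)"
    using K(1) by (intro compact_imp_bounded compact_continuous_image continuous_intros)
  then obtain B where B: "\<And>x. x \<in> K \<Longrightarrow> fst x \<le> B"
    unfolding bounded_iff by (metis abs_le_D1 image_eqI real_norm_def)
  define R where "R = arcosh (max B 2)"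
  have R: "R > 0" "cosh R = max B 2" by (auto simp: R_def)
  show ?thesis
  proof
    show "R > 0" by (rule R)
    fix x :: "'n mink" assume "x \<in> hyp_space"
    then obtain f y where f: "f \<in> \<Gamma>" "y \<in> K" "x = f y" using K(3) by blast
    then have "inv f x \<in> base_ball R"
      using B[of y] K(2) by (auto simp: inv_f_f base_ball_def R)
    then show "\<exists>f\<in>\<Gamma>. f x \<in> base_ball R" using f inv_in by blast
  qed
qed

lemma finite_near: "finite {f \<in> \<Gamma>. f ` base_ball R \<inter> base_ball R \<noteq> {}}"
  by (rule properly_discontinuous[OF compact_base_ball base_ball_subset])

text \<open>
  A lower bound for all translation lengths of nontrivial deck transformations. The constants of the
  theorem are expressed through such a bound, which is easier to use than the injectivity radius.
\<close>

definition displaces_by :: "real \<Rightarrow> bool" where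
  "displaces_by c \<longleftrightarrow> (\<forall>f\<in>\<Gamma>. f \<noteq> id \<longrightarrow> (\<forall>x\<in>hyp_space. c \<le> hyp_dist x (f x)))"

lemma displaces_byD:
  "displaces_by c \<Longrightarrow> f \<in> \<Gamma> \<Longrightarrow> f \<noteq> id \<Longrightarrow> x \<in> hyp_space \<Longrightarrow> c \<le> hyp_dist x (f x)"
  unfolding displaces_by_def by blast

text \<open>
  Conjugation reduces to points of the compact set \<open>base_ball R\<close>. An element that moves such a point
  by less than \<open>1\<close> makes \<open>base_ball (R + 1)\<close> meet its translate. There are finitely many of these, and
  each has a positive minimal displacement on the compact set since it has no fixed point.
\<close>

lemma displacement:
  obtains c where "c > 0" "displaces_by c"
proof -
  obtain R where R: "R > 0" "\<And>x. x \<in> hyp_space \<Longrightarrow> \<exists>f\<in>\<Gamma>. f x \<in> base_ball R"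
    using covering_ball by blast
  define F where "F = {f \<in> \<Gamma>. f ` base_ball (R + 1) \<inter> base_ball (R + 1) \<noteq> {}}"
  have fin: "finite F" unfolding F_def by (rule finite_near)
  have "\<exists>c>0. \<forall>x\<in>base_ball R. c \<le> hyp_dist x (f x)" if f: "f \<in> \<Gamma>" "f \<noteq> id" for f
  proof -
    have ne: "base_ball R \<noteq> ({} :: 'n mink set)" using R(2)[OF hyp_origin_in] by blast
    have "continuous_on (base_ball R) (\<lambda>x. - mink_inner x (f x))"
      using hyp_isometry_continuous[OF iso[OF f(1)]] by (intro continuous_intros)
    then have "\<exists>x0\<in>base_ball R. \<forall>x\<in>base_ball R. - mink_inner x0 (f x0) \<le> - mink_inner x (f x)"
      by (rule continuous_attains_inf[OF compact_base_ball ne])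
    then obtain x0 where x0: "x0 \<in> base_ball R" "\<forall>x\<in>base_ball R. - mink_inner x0 (f x0) \<le> - mink_inner x (f x)"
      by (elim bexE) rule
    have x0s: "x0 \<in> hyp_space" using x0(1) by (simp add: base_ball_def)
    note x0H = x0s in_space[OF f(1) x0s]
    have "hyp_dist x0 (f x0) \<noteq> 0"
      by (rule contrapos_nn[OF free[OF f x0s, symmetric]]) (rule hyp_dist_eq_0[OF x0H])
    then have "0 < hyp_dist x0 (f x0)"
      using hyp_dist_nonneg[OF x0H] by (metis less_le)
    moreover have "hyp_dist x0 (f x0) \<le> hyp_dist x (f x)" if x: "x \<in> base_ball R" for x
    proof -
      have xs: "x \<in> hyp_space" using x by (simp add: base_ball_def)
      note xH = xs in_space[OF f(1) xs]
      show ?thesis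
        using hyp_dist_le_iff[OF x0H hyp_dist_nonneg[OF xH]] bspec[OF x0(2) x] cosh_hyp_dist[OF xH] by simp
    qed
    ultimately show ?thesis by blast
  qed
  then have pos: "\<exists>c>0. \<forall>x\<in>base_ball R. c \<le> hyp_dist x (f x)" if "f \<in> F - {id}" for f
    using that by (auto simp: F_def)
  have "finite (F - {id})" using fin by simp
  then have "\<exists>c>0. c \<le> 1 \<and> (\<forall>f\<in>F - {id}. \<forall>x\<in>base_ball R. c \<le> hyp_dist x (f x))"
    by (rule finite_uniform_lower_bound[where h = "\<lambda>f x. hyp_dist x (f x)"]) (rule pos)
  then obtain d where d: "d > 0" "d \<le> 1" "\<forall>f\<in>F - {id}. \<forall>x\<in>base_ball R. d \<le> hyp_dist x (f x)"
    by (elim exE conjE) rule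
  have near: "d \<le> hyp_dist x (f x)" if f: "f \<in> \<Gamma>" "f \<noteq> id" and x: "x \<in> base_ball R" for f x
  proof (cases "f \<in> F")
    case True then show ?thesis using bspec[OF bspec[OF d(3)] x, of f] f(2) by simp
  next
    case False
    have xs: "x \<in> hyp_space" using x by (simp add: base_ball_def)
    note xH = xs in_space[OF f(1) xs]
    show ?thesis
    proof (rule ccontr)
      assume "\<not> ?thesis"
      then have "hyp_dist x (f x) \<le> 1" using d(2) by simp
      moreover have xR: "hyp_dist hyp_origin x \<le> R" using x R(1) by (simp add: base_ball_iff)
      ultimately have "hyp_dist hyp_origin (f x) \<le> R + 1"
        using hyp_dist_triangle[OF hyp_origin_in xH] by simp
      then have "f x \<in> base_ball (R + 1)" "x \<in> base_ball (R + 1)"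
        using R(1) xH xR by (simp_all add: base_ball_iff)
      then show False using False f by (auto simp: F_def)
    qed
  qed
  show ?thesis
  proof
    show "d > 0" by (rule d)
    show "displaces_by d" unfolding displaces_by_def
    proof (intro ballI impI)
    fix f and x :: "'n mink" assume f: "f \<in> \<Gamma>" "f \<noteq> id" and x: "x \<in> hyp_space"
    obtain g where g: "g \<in> \<Gamma>" "g x \<in> base_ball R" using R(2)[OF x] by blast
    define f' where "f' = g \<circ> f \<circ> inv g"
    have "f' \<in> \<Gamma>" unfolding f'_def by (rule comp_in[OF comp_in[OF g(1) f(1)] inv_in[OF g(1)]])
    moreover have "f' \<noteq> id"
    proof
      assume "f' = id"
      then have "f' (g x) = g x" by simp
      then have "g (f x) = g x" by (simp add: f'_def inv_f_f[OF g(1)])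
      then have "f x = x" by (metis inv_f_f[OF g(1)])
      then show False using free[OF f x] by simp
    qed
    ultimately have "d \<le> hyp_dist (g x) (f' (g x))" by (intro near g)
    then show "d \<le> hyp_dist x (f x)"
      by (simp add: f'_def inv_f_f[OF g(1)] hyp_dist_isometry[OF iso[OF g(1)]])
    qed
  qed
qed

text \<open>
  The hyperboloid is not compact.
\<close>

lemma nontrivial: "\<exists>f\<in>\<Gamma>. f \<noteq> id"
proof (rule ccontr)
  assume "\<not> ?thesis"
  then have triv: "f = id" if "f \<in> \<Gamma>" for f using that by blast
  obtain R where R: "R > 0" "\<And>x. x \<in> hyp_space \<Longrightarrow> \<exists>f\<in>\<Gamma>. f x \<in> base_ball R"
    using covering_ball by blast
  obtain u :: "real^'n" where u: "norm u = 1" using vector_choose_size[of 1] by auto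
  have "(cosh (R + 1), sinh (R + 1) *\<^sub>R u) \<in> hyp_space" by (rule polar_point_in_hyp_space[OF u])
  then have "cosh (R + 1) \<le> cosh R" using R(2) triv by (fastforce simp: base_ball_def)
  then show False using R(1) cosh_real_nonneg_le_iff[of "R + 1" R] by simp
qed

lemma point_class_eq: "f \<in> \<Gamma> \<Longrightarrow> point_class \<Gamma> (f x) = point_class \<Gamma> x"
proof -
  assume f: "f \<in> \<Gamma>"
  have "g (f x) \<in> point_class \<Gamma> x" if "g \<in> \<Gamma>" for g
    unfolding point_class_def using comp_in[OF that f] by (rule rev_image_eqI) simp
  moreover have "g x \<in> point_class \<Gamma> (f x)" if "g \<in> \<Gamma>" for g
    unfolding point_class_def using comp_in[OF that inv_in[OF f]]
    by (rule rev_image_eqI) (simp add: inv_f_f[OF f])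
  ultimately show ?thesis by (auto simp: point_class_def)
qed

text \<open>
  Two vectors shorter than \<open>c / 2\<close> at \<open>x\<close> with equivalent end points give an element that moves one of
  these end points by less than \<open>c\<close>, so it is the identity. The supremum in \<open>inj_radius_at\<close> is that of
  a bounded set: a geodesic from \<open>x\<close> to a distinct translate of \<open>x\<close> ends at the class of its start.
\<close>

lemma inj_radius_ge:
  assumes c: "c > 0" "displaces_by c"
  shows "c / 2 \<le> inj_radius \<Gamma>"
  unfolding inj_radius_def
proof (rule cINF_greatest)
  show "hyp_space \<noteq> ({} :: 'n mink set)" using hyp_origin_in by blast
  fix x :: "'n mink" assume x: "x \<in> hyp_space"
  let ?B = "\<lambda>\<rho>. {v \<in> tangent_space x. mink_norm v < \<rho>}"
  show "c / 2 \<le> inj_radius_at \<Gamma> x"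
    unfolding inj_radius_at_def
  proof (rule cSup_upper)
    have "inj_on (\<lambda>v. point_class \<Gamma> (hyp_exp x v)) (?B (c / 2))"
    proof (rule inj_onI)
      fix v w assume v: "v \<in> ?B (c / 2)" and w: "w \<in> ?B (c / 2)"
        and eq: "point_class \<Gamma> (hyp_exp x v) = point_class \<Gamma> (hyp_exp x w)"
      have H: "hyp_exp x v \<in> hyp_space" "hyp_exp x w \<in> hyp_space"
        using v w x by (auto intro: hyp_exp_polar)
      have "hyp_exp x w \<in> point_class \<Gamma> (hyp_exp x w)"
        unfolding point_class_def using id_in by (rule rev_image_eqI) simp
      then obtain f where f: "f \<in> \<Gamma>" "hyp_exp x w = f (hyp_exp x v)"
        using eq by (auto simp: point_class_def)
      have "hyp_dist (hyp_exp x v) (f (hyp_exp x v)) < c"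
        using hyp_dist_triangle[OF H(1) x H(2)] hyp_exp_polar(2)[OF x, of v] hyp_exp_polar(2)[OF x, of w] v w
        by (simp add: hyp_dist_commute[of _ x] f(2))
      then have "f = id" using displaces_byD[OF c(2) f(1) _ H(1)] by force
      then show "v = w" using f(2) inj_on_hyp_exp[OF x] v w by (auto dest: inj_onD)
    qed
    then show "c / 2 \<in> {\<rho>. 0 < \<rho> \<and> inj_on (\<lambda>v. point_class \<Gamma> (hyp_exp x v)) (?B \<rho>)}"
      using c(1) by simp
    obtain f where f: "f \<in> \<Gamma>" "f \<noteq> id" using nontrivial by blast
    have fx: "f x \<in> hyp_space" by (rule in_space[OF f(1) x])
    obtain v where v: "v \<in> tangent_space x" "hyp_exp x v = f x" using hyp_exp_surj[OF x fx] by blast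
    show "bdd_above {\<rho>. 0 < \<rho> \<and> inj_on (\<lambda>v. point_class \<Gamma> (hyp_exp x v)) (?B \<rho>)}"
    proof (rule bdd_aboveI)
      fix \<rho> assume \<rho>: "\<rho> \<in> {\<rho>. 0 < \<rho> \<and> inj_on (\<lambda>v. point_class \<Gamma> (hyp_exp x v)) (?B \<rho>)}"
      show "\<rho> \<le> mink_norm v"
      proof (rule ccontr)
        assume "\<not> ?thesis"
        then have "v \<in> ?B \<rho>" "0 \<in> ?B \<rho>"
          using v \<rho> by (auto simp: tangent_space_def mink_norm_def mink_inner_def)
        moreover have e0: "hyp_exp x 0 = x" by (simp add: hyp_exp_def mink_norm_def mink_inner_def)
        ultimately have "v = 0"
          using \<rho> v(2) point_class_eq[OF f(1), of x]
            inj_onD[of "\<lambda>v. point_class \<Gamma> (hyp_exp x v)" "?B \<rho>" v 0] by simp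
        then show False using v(2) e0 free[OF f x] by simp
      qed
    qed
  qed
qed

end

section \<open>Volumes of balls\<close>

definition hyp_ball :: "'n::finite mink \<Rightarrow> real \<Rightarrow> 'n mink set" where
  "hyp_ball x a = {y. - mink_inner x y < cosh a}"

lemma hyp_ball_measurable [measurable]: "hyp_ball x a \<in> sets borel"
  unfolding hyp_ball_def by measurable

lemma hyp_ball_iff:
  "x \<in> hyp_space \<Longrightarrow> y \<in> hyp_space \<Longrightarrow> 0 \<le> a \<Longrightarrow> y \<in> hyp_ball x a \<longleftrightarrow> hyp_dist x y < a"
  by (simp add: hyp_ball_def hyp_dist_less_iff)

text \<open>
  In the chart, the ball about \<open>(1, 0)\<close> is the Euclidean ball of radius \<open>sinh a\<close>, and the density of
  the volume lies between \<open>1 / cosh a\<close> and \<open>1\<close> there.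
\<close>

lemma emeasure_hyp_ball:
  fixes x :: "'n::finite mink"
  assumes "x \<in> hyp_space" "0 \<le> a"
  shows "emeasure hyp_measure (hyp_ball x a) \<le> ennreal (unit_ball_vol CARD('n) * sinh a ^ CARD('n))"
    and "ennreal (unit_ball_vol CARD('n) * sinh a ^ CARD('n) / cosh a) \<le> emeasure hyp_measure (hyp_ball x a)"
proof -
  obtain L where L: "hyp_isometry L" "L hyp_origin = x" using hyp_frame_exists assms by blast
  \<comment> \<open>In the frame \<open>L\<close> the ball is cut out by a bound on the time coordinate.\<close>
  have shift: "indicator (hyp_ball x a) (L z) = (indicator {w. fst w < cosh a} z :: ennreal)" for z
  proof -
    have "mink_inner x (L z) = - fst z"
      using hyp_isometry_inner[OF L(1), of hyp_origin z] L(2) by (simp add: mink_inner_def[of hyp_origin])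
    then show ?thesis by (simp add: indicator_def hyp_ball_def)
  qed
  have "emeasure hyp_measure (hyp_ball x a) = (\<integral>\<^sup>+z. indicator (hyp_ball x a) z \<partial>hyp_measure)"
    by (rule nn_integral_indicator[symmetric]) simp
  also have "\<dots> = (\<integral>\<^sup>+z. indicator (hyp_ball x a) (L z) \<partial>hyp_measure)"
    by (rule nn_integral_hyp_measure_isometry[OF _ L(1), symmetric]) measurable
  also have "\<dots> = (\<integral>\<^sup>+z. indicator {w. fst w < cosh a} z \<partial>(hyp_measure :: 'n mink measure))"
    by (simp add: shift)
  also have "\<dots> = (\<integral>\<^sup>+y. indicator {w. fst w < cosh a} (hyp_chart y) * ennreal (1 / sqrt (1 + (norm y)\<^sup>2)) \<partial>(lborel :: (real^'n) measure))"
    by (rule nn_integral_hyp_measure) measurable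
  also have "\<dots> = (\<integral>\<^sup>+y. indicator (ball 0 (sinh a)) y * ennreal (1 / sqrt (1 + (norm y)\<^sup>2)) \<partial>(lborel :: (real^'n) measure))"
  proof -
    have "sqrt (1 + (norm y)\<^sup>2) < cosh a \<longleftrightarrow> norm y < sinh a" for y :: "real^'n"
    proof -
      have "cosh a = sqrt (1 + (sinh a)\<^sup>2)"
        by (metis add.commute cosh_real_nonneg cosh_square_eq real_sqrt_unique)
      then have "sqrt (1 + (norm y)\<^sup>2) < cosh a \<longleftrightarrow> (norm y)\<^sup>2 < (sinh a)\<^sup>2" by simp
      also have "\<dots> \<longleftrightarrow> norm y < sinh a"
        using assms(2) power2_less_imp_less[of "norm y" "sinh a"] power_strict_mono[of "norm y" "sinh a" 2] by auto
      finally show ?thesis .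
    qed
    then show ?thesis by (simp add: hyp_chart_def indicator_def)
  qed
  finally have eq: "emeasure hyp_measure (hyp_ball x a)
    = (\<integral>\<^sup>+y. indicator (ball 0 (sinh a)) y * ennreal (1 / sqrt (1 + (norm y)\<^sup>2)) \<partial>(lborel :: (real^'n) measure))" .
  have vol: "emeasure lborel (ball (0::real^'n) (sinh a)) = ennreal (unit_ball_vol CARD('n) * sinh a ^ CARD('n))"
    using assms(2) by (simp add: emeasure_ball)
  have "emeasure hyp_measure (hyp_ball x a) \<le> (\<integral>\<^sup>+y. indicator (ball 0 (sinh a)) y \<partial>(lborel :: (real^'n) measure))"
    unfolding eq
  proof (rule nn_integral_mono)
    fix y :: "real^'n"
    have "1 / sqrt (1 + (norm y)\<^sup>2) \<le> 1 / 1"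
      by (intro divide_left_mono) (auto intro!: add_pos_nonneg)
    then have "ennreal (1 / sqrt (1 + (norm y)\<^sup>2)) \<le> 1" by (simp only: ennreal_le_1 div_by_1)
    then show "indicator (ball 0 (sinh a)) y * ennreal (1 / sqrt (1 + (norm y)\<^sup>2)) \<le> indicator (ball 0 (sinh a)) y"
      by (auto simp: indicator_def)
  qed
  then show "emeasure hyp_measure (hyp_ball x a) \<le> ennreal (unit_ball_vol CARD('n) * sinh a ^ CARD('n))"
    by (simp add: vol)
  have "(\<integral>\<^sup>+y. ennreal (1 / cosh a) * indicator (ball 0 (sinh a)) y \<partial>(lborel :: (real^'n) measure)) \<le> emeasure hyp_measure (hyp_ball x a)"
    unfolding eq
  proof (rule nn_integral_mono)
    fix y :: "real^'n"
    have "ennreal (1 / cosh a) \<le> ennreal (1 / sqrt (1 + (norm y)\<^sup>2))" if y: "norm y < sinh a"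
    proof (rule ennreal_leI)
      have "(norm y)\<^sup>2 \<le> (sinh a)\<^sup>2" using y by (intro power_mono) auto
      then have "sqrt (1 + (norm y)\<^sup>2) \<le> sqrt ((cosh a)\<^sup>2)" by (simp add: cosh_square_eq)
      then show "1 / cosh a \<le> 1 / sqrt (1 + (norm y)\<^sup>2)"
        by (intro divide_left_mono) (auto intro!: mult_pos_pos add_pos_nonneg)
    qed
    then show "ennreal (1 / cosh a) * indicator (ball 0 (sinh a)) y \<le> indicator (ball 0 (sinh a)) y * ennreal (1 / sqrt (1 + (norm y)\<^sup>2))"
      by (auto simp: indicator_def)
  qed
  then show "ennreal (unit_ball_vol CARD('n) * sinh a ^ CARD('n) / cosh a) \<le> emeasure hyp_measure (hyp_ball x a)"
    using assms(2) by (simp add: nn_integral_cmult_indicator vol ennreal_mult[symmetric])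
qed

lemma sigma_finite_hyp_measure: "sigma_finite_measure (hyp_measure :: 'n::finite mink measure)"
proof
  let ?A = "range (\<lambda>k::nat. hyp_ball hyp_origin (real k)) :: 'n mink set set"
  show "\<exists>A. countable A \<and> A \<subseteq> sets hyp_measure \<and> \<Union> A = space (hyp_measure :: 'n mink measure) \<and>
    (\<forall>a\<in>A. emeasure hyp_measure a \<noteq> \<infinity>)"
  proof (intro exI[of _ ?A] conjI ballI)
    fix a assume "a \<in> ?A"
    then obtain k where a: "a = hyp_ball hyp_origin (real k)" by blast
    have "emeasure hyp_measure a \<le> ennreal (unit_ball_vol CARD('n) * sinh (real k) ^ CARD('n))"
      unfolding a by (rule emeasure_hyp_ball(1)) auto
    then show "emeasure hyp_measure a \<noteq> \<infinity>" by (metis ennreal_less_top infinity_ennreal_def leD)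
  next
    have "\<exists>k::nat. fst y < cosh (real k)" for y :: "'n mink"
    proof -
      define b where "b = max 1 (fst y)"
      obtain k :: nat where k: "arcosh b < real k" using reals_Archimedean2 by blast
      have "fst y \<le> b" "b = cosh (arcosh b)" "0 \<le> arcosh b" by (auto simp: b_def)
      moreover have "cosh (arcosh b) < cosh (real k)"
        using k \<open>0 \<le> arcosh b\<close> by (subst cosh_real_nonneg_less_iff) auto
      ultimately show ?thesis by (metis le_less_trans)
    qed
    then show "\<Union> ?A = space (hyp_measure :: 'n mink measure)"
      by (auto simp: hyp_ball_def mink_inner_def)
  qed auto
qed

interpretation hyp_measure: sigma_finite_measure "hyp_measure :: 'n::finite mink measure"
  by (rule sigma_finite_hyp_measure)

interpretation hyp_pair: pair_sigma_finite "hyp_measure :: 'n::finite mink measure" "hyp_measure :: 'n::finite mink measure" ..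

lemma radial_weight_dist:
  assumes "x \<in> hyp_space" "y \<in> hyp_space" "0 \<le> R"
  shows "radial_weight m R (- mink_inner x y)
    = (if 0 < hyp_dist x y \<and> hyp_dist x y \<le> R then ennreal (1 / sinh (hyp_dist x y) ^ m) else 0)"
proof -
  define d where "d = hyp_dist x y"
  have d: "0 \<le> d" "- mink_inner x y = cosh d"
    using hyp_dist_nonneg[OF assms(1,2)] cosh_hyp_dist[OF assms(1,2)] by (simp_all add: d_def)
  have "1 < cosh d \<longleftrightarrow> 0 < d" using cosh_real_nonneg_less_iff[of 0 d] d(1) by simp
  moreover have "cosh d \<le> cosh R \<longleftrightarrow> d \<le> R" using d assms by (simp add: cosh_real_nonneg_le_iff)
  moreover have "sqrt ((cosh d)\<^sup>2 - 1) = sinh d" using d(1) by (simp add: cosh_square_eq)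
  ultimately show ?thesis by (simp add: radial_weight_def d indicator_def flip: d_def)
qed

text \<open>
  In polar coordinates the weight turns the volume into the product of the measures of directions and
  of times, so a ball of radius \<open>R\<close> has weighted volume proportional to \<open>R\<close>.
\<close>

lemma nn_integral_radial_weight:
  assumes "x \<in> hyp_space" "0 < R"
  shows "(\<integral>\<^sup>+z. radial_weight (CARD('n) - 1) R (- mink_inner x z) \<partial>(hyp_measure :: 'n::finite mink measure))
    = ennreal (CARD('n) * measure (sphere_measure :: (real^'n) measure) (sphere 0 1) * R)"
proof -
  obtain L where L: "hyp_isometry L" "L hyp_origin = x" using hyp_frame_exists assms by blast
  have "(\<integral>\<^sup>+z. radial_weight (CARD('n) - 1) R (- mink_inner x z) \<partial>(hyp_measure :: 'n mink measure))
    = (\<integral>\<^sup>+z. 1 * radial_weight (CARD('n) - 1) R (- mink_inner (L hyp_origin) z) \<partial>(hyp_measure :: 'n mink measure))"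
    by (simp add: L(2))
  also have "\<dots> = real CARD('n) * (\<integral>\<^sup>+u. \<integral>\<^sup>+s. 1 * indicator {0<..R} s \<partial>lborel \<partial>(sphere_measure :: (real^'n) measure))"
    by (rule nn_integral_hyp_polar[OF _ L(1) assms(2), symmetric]) simp
  also have "\<dots> = real CARD('n) * (ennreal R * emeasure (sphere_measure :: (real^'n) measure) (sphere 0 1))"
    using assms(2) by (simp add: space_sphere_measure)
  also have "\<dots> = ennreal (CARD('n) * measure (sphere_measure :: (real^'n) measure) (sphere 0 1) * R)"
    using assms(2) by (simp add: sphere_measure.emeasure_eq_measure ennreal_mult[symmetric] ennreal_of_nat_eq_real_of_nat mult_ac)
  finally show ?thesis .
qed

section \<open>Directions of return\<close>

context closed_hyperbolic
begin

text \<open>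
  The lift to the unit tangent bundle of hyperbolic space of the set \<open>E\<close> of the introduction.
\<close>

definition return_set :: "real \<Rightarrow> real \<Rightarrow> ('n mink \<times> 'n mink) set" where
  "return_set r \<delta> = {(x, v). \<exists>f\<in>\<Gamma>. \<exists>l\<in>{inj_radius \<Gamma>..r}. geodesic x v l \<in> hyp_ball (f x) (2 * \<delta>)}"

lemma open_return_set: "open (return_set r \<delta>)"
proof -
  have "return_set r \<delta> = (\<Union>f\<in>\<Gamma>. \<Union>l\<in>{inj_radius \<Gamma>..r}.
      {p. - mink_inner (f (fst p)) (geodesic (fst p) (snd p) l) < cosh (2 * \<delta>)})"
    by (rule set_eqI) (simp add: return_set_def hyp_ball_def case_prod_unfold)
  moreover have "open {p::'n mink \<times> 'n mink. - mink_inner (f (fst p)) (geodesic (fst p) (snd p) l) < cosh (2 * \<delta>)}"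
    if "f \<in> \<Gamma>" for f l
    unfolding geodesic_def
    by (intro open_Collect_less continuous_intros
        continuous_on_compose2[OF hyp_isometry_continuous[OF iso[OF that], of UNIV]]) auto
  ultimately show ?thesis by (simp add: open_UN)
qed

lemma return_set_sets [measurable]: "return_set r \<delta> \<in> sets (borel \<Otimes>\<^sub>M borel)"
  unfolding borel_prod by (rule borel_open[OF open_return_set])

lemma return_set_invariant:
  assumes f: "f \<in> \<Gamma>" shows "(f x, f v) \<in> return_set r \<delta> \<longleftrightarrow> (x, v) \<in> return_set r \<delta>"
proof -
  have *: "(x, v) \<in> return_set r \<delta>" if f: "f \<in> \<Gamma>" and r: "(f x, f v) \<in> return_set r \<delta>" for f x v
  proof -
    obtain g l where g: "g \<in> \<Gamma>" "l \<in> {inj_radius \<Gamma>..r}" "geodesic (f x) (f v) l \<in> hyp_ball (g (f x)) (2 * \<delta>)"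
      using r by (auto simp: return_set_def)
    let ?h = "inv f \<circ> (g \<circ> f)"
    have h: "?h \<in> \<Gamma>" by (rule comp_in[OF inv_in[OF f] comp_in[OF g(1) f]])
    have "mink_inner (?h x) (geodesic x v l) = mink_inner (f (?h x)) (f (geodesic x v l))"
      by (rule hyp_isometry_inner[OF iso[OF f], symmetric])
    also have "\<dots> = mink_inner (g (f x)) (geodesic (f x) (f v) l)"
      by (simp add: f_inv_f[OF f] geodesic_isometry[OF iso[OF f]])
    finally have "geodesic x v l \<in> hyp_ball (?h x) (2 * \<delta>)" using g(3) by (simp add: hyp_ball_def)
    with h g(2) show ?thesis unfolding return_set_def by blast
  qed
  show ?thesis
    using *[OF f, of x v] *[OF inv_in[OF f], of "f x" "f v"] by (auto simp: inv_f_f[OF f])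
qed

lemma finite_displaced:
  assumes z: "z \<in> hyp_space" and "0 \<le> R"
  shows "finite {f \<in> \<Gamma>. f \<noteq> id \<and> hyp_dist z (f z) \<le> R}"
proof -
  define S where "S = hyp_dist hyp_origin z + R"
  have S: "0 \<le> S" unfolding S_def using hyp_dist_nonneg[OF hyp_origin_in z] assms(2) by linarith
  have "f ` base_ball S \<inter> base_ball S \<noteq> {}" if f: "f \<in> \<Gamma>" "hyp_dist z (f z) \<le> R" for f
  proof -
    note fz = in_space[OF f(1) z]
    have "z \<in> base_ball S" using z S assms(2) by (simp add: base_ball_iff S_def)
    moreover have "f z \<in> base_ball S"
      using fz S f(2) hyp_dist_triangle[OF hyp_origin_in z fz] by (simp add: base_ball_iff) (simp add: S_def)
    ultimately show ?thesis by auto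
  qed
  then show ?thesis by (intro finite_subset[OF _ finite_near]) blast
qed

lemma orbit_balls_disjoint:
  assumes c: "displaces_by c"
    and a: "0 \<le> a" "2 * a \<le> c" and z: "z \<in> hyp_space" and y: "y \<in> hyp_space"
    and f: "f \<in> \<Gamma>" "y \<in> hyp_ball (f z) a" and g: "g \<in> \<Gamma>" "y \<in> hyp_ball (g z) a"
  shows "f = g"
proof (rule ccontr)
  assume ne: "f \<noteq> g"
  note fz = in_space[OF f(1) z] and gz = in_space[OF g(1) z]
  let ?h = "inv g \<circ> f"
  have "?h \<noteq> id"
  proof
    assume h: "?h = id"
    have "f w = g w" for w
    proof -
      have "g (?h w) = g w" by (simp only: h id_apply)
      then show ?thesis by (simp add: f_inv_f[OF g(1)])
    qed
    then show False using ne by blast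
  qed
  then have "c \<le> hyp_dist z (?h z)" by (rule displaces_byD[OF c comp_in[OF inv_in[OF g(1)] f(1)] _ z])
  also have "\<dots> = hyp_dist (g z) (g (?h z))" by (rule hyp_dist_isometry[OF iso[OF g(1)], symmetric])
  also have "\<dots> = hyp_dist (g z) (f z)" by (simp add: f_inv_f[OF g(1)])
  also have "\<dots> \<le> hyp_dist (g z) y + hyp_dist y (f z)" by (rule hyp_dist_triangle[OF gz y fz])
  also have "\<dots> < 2 * a"
    using f(2) g(2) by (simp add: hyp_ball_iff fz gz y a(1) hyp_dist_commute[of y])
  finally show False using a by simp
qed

text \<open>
  The two balls have the same centre \<open>f z\<close>, at distance \<open>T \<ge> c\<close> from \<open>z\<close>. The weight is at most
  \<open>sinh(T - 3 \<delta>)\<^sup>-\<^sup>m\<close> on the small one and at least \<open>sinh(T + c / 4)\<^sup>-\<^sup>m\<close> on the large one. As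
  \<open>T - 3 \<delta> \<ge> 3 c / 4\<close> exceeds the difference of these radii, which is at most \<open>c / 2\<close>, the two bounds
  differ by at most the factor \<open>(2 cosh(c / 2))\<^sup>m\<close>. The cut-off of the weight is increased by \<open>c / 2\<close>
  so that it contains the whole of the large ball.
\<close>

lemma orbit_ball_weight:
  assumes c: "0 < c" "displaces_by c"
    and \<delta>: "0 < \<delta>" "3 * \<delta> \<le> c / 4" and z: "z \<in> hyp_space"
    and f: "f \<in> \<Gamma>" "f \<noteq> id" "hyp_dist z (f z) \<le> R + 3 * \<delta>" and R: "0 < R"
  shows "ennreal (unit_ball_vol CARD('n) * sinh (c / 4) ^ CARD('n) / cosh (c / 4)) *
      (\<integral>\<^sup>+y. indicator (hyp_ball (f z) (3 * \<delta>)) y * radial_weight m R (- mink_inner z y) \<partial>hyp_measure)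
    \<le> ennreal ((2 * cosh (c / 2)) ^ m * (unit_ball_vol CARD('n) * sinh (3 * \<delta>) ^ CARD('n))) *
      (\<integral>\<^sup>+y. indicator (hyp_ball (f z) (c / 4)) y * radial_weight m (R + c / 2) (- mink_inner z y) \<partial>hyp_measure)"
    (is "ennreal ?v * ?I \<le> ennreal (?k * ?w) * ?J")
proof -
  note fz = in_space[OF f(1) z]
  define T where "T = hyp_dist z (f z)"
  have T: "c \<le> T" "T \<le> R + 3 * \<delta>" using displaces_byD[OF c(2) f(1,2) z] f(3) by (simp_all add: T_def)
  let ?a = "1 / sinh (T - 3 * \<delta>) ^ m" and ?b = "1 / sinh (T + c / 4) ^ m"
  have pos: "0 < sinh (T - 3 * \<delta>)" "0 < sinh (T + c / 4)" using T \<delta> c(1) by auto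
  have "?I \<le> (\<integral>\<^sup>+y. ennreal ?a * indicator (hyp_ball (f z) (3 * \<delta>)) y \<partial>hyp_measure)"
  proof (rule nn_integral_hyp_measure_mono)
    fix y :: "'n mink" assume y: "y \<in> hyp_space"
    show "indicator (hyp_ball (f z) (3 * \<delta>)) y * radial_weight m R (- mink_inner z y)
        \<le> ennreal ?a * indicator (hyp_ball (f z) (3 * \<delta>)) y"
    proof (cases "y \<in> hyp_ball (f z) (3 * \<delta>)")
      case True
      then have "hyp_dist (f z) y < 3 * \<delta>" using \<delta> by (simp add: hyp_ball_iff fz y)
      then have d: "T - 3 * \<delta> \<le> hyp_dist z y"
        using hyp_dist_triangle[OF z y fz] by (simp add: T_def hyp_dist_commute[of y])
      have "1 / sinh (hyp_dist z y) ^ m \<le> ?a"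
      proof (rule divide_left_mono)
        show "sinh (T - 3 * \<delta>) ^ m \<le> sinh (hyp_dist z y) ^ m"
          using d pos by (intro power_mono) auto
        show "0 < sinh (hyp_dist z y) ^ m * sinh (T - 3 * \<delta>) ^ m"
          using d pos by (intro mult_pos_pos zero_less_power) auto
      qed simp
      then have "radial_weight m R (- mink_inner z y) \<le> ennreal ?a"
        using R by (simp add: radial_weight_dist z y ennreal_leI)
      then show ?thesis using True by simp
    qed simp
  qed measurable
  also have "\<dots> = ennreal ?a * emeasure hyp_measure (hyp_ball (f z) (3 * \<delta>))"
    by (simp add: nn_integral_cmult_indicator)
  also have "\<dots> \<le> ennreal ?a * ennreal ?w"
    using emeasure_hyp_ball(1)[OF fz, of "3 * \<delta>"] \<delta> by (intro mult_left_mono) auto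
  also have "\<dots> = ennreal (?a * ?w)"
    using pos \<delta> by (intro ennreal_mult[symmetric]) auto
  finally have I: "?I \<le> ennreal (?a * ?w)" .
  have "ennreal ?b * emeasure hyp_measure (hyp_ball (f z) (c / 4))
      = (\<integral>\<^sup>+y. ennreal ?b * indicator (hyp_ball (f z) (c / 4)) y \<partial>hyp_measure)"
    by (simp add: nn_integral_cmult_indicator)
  also have "\<dots> \<le> ?J"
  proof (rule nn_integral_hyp_measure_mono)
    fix y :: "'n mink" assume y: "y \<in> hyp_space"
    show "ennreal ?b * indicator (hyp_ball (f z) (c / 4)) y
      \<le> indicator (hyp_ball (f z) (c / 4)) y * radial_weight m (R + c / 2) (- mink_inner z y)"
    proof (cases "y \<in> hyp_ball (f z) (c / 4)")
      case True
      then have dy: "hyp_dist (f z) y < c / 4" using c(1) by (simp add: hyp_ball_iff fz y)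
      have d1: "T - c / 4 \<le> hyp_dist z y"
        using dy hyp_dist_triangle[OF z y fz] by (simp add: T_def hyp_dist_commute[of y])
      have d2: "hyp_dist z y \<le> T + c / 4"
        using dy hyp_dist_triangle[OF z fz y] by (simp add: T_def)
      have d: "0 < hyp_dist z y" "hyp_dist z y \<le> R + c / 2" using d1 d2 T c(1) \<delta> by linarith+
      have "?b \<le> 1 / sinh (hyp_dist z y) ^ m"
        using d(1) d2 pos by (intro divide_left_mono power_mono mult_pos_pos zero_less_power) auto
      then have "ennreal ?b \<le> radial_weight m (R + c / 2) (- mink_inner z y)"
        using R c(1) d by (simp add: radial_weight_dist z y ennreal_leI)
      then show ?thesis using True by simp
    qed simp
  qed measurable
  finally have J1: "ennreal ?b * emeasure hyp_measure (hyp_ball (f z) (c / 4)) \<le> ?J" .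
  have "ennreal (?b * ?v) = ennreal ?b * ennreal ?v"
    using pos c(1) by (intro ennreal_mult) auto
  also have "\<dots> \<le> ennreal ?b * emeasure hyp_measure (hyp_ball (f z) (c / 4))"
    using emeasure_hyp_ball(2)[OF fz, of "c / 4"] c(1) by (intro mult_left_mono) auto
  also note J1
  finally have J: "ennreal (?b * ?v) \<le> ?J" .
  have ab: "?a \<le> (2 * cosh (c / 2)) ^ m * ?b"
  proof -
    have "sinh (T + c / 4) = sinh ((T - 3 * \<delta>) + (3 * \<delta> + c / 4))" by simp
    also have "\<dots> \<le> 2 * cosh (3 * \<delta> + c / 4) * sinh (T - 3 * \<delta>)"
      using T \<delta> c(1) by (intro sinh_add_le) linarith+
    also have "\<dots> \<le> 2 * cosh (c / 2) * sinh (T - 3 * \<delta>)"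
      using pos \<delta> c(1) by (intro mult_right_mono mult_left_mono) (auto simp: cosh_real_nonneg_le_iff)
    finally have "sinh (T + c / 4) ^ m \<le> (2 * cosh (c / 2) * sinh (T - 3 * \<delta>)) ^ m"
      using pos by (intro power_mono) auto
    then show ?thesis using pos by (simp add: field_simps power_mult_distrib)
  qed
  have nn: "0 \<le> ?v" "0 \<le> ?w" using c(1) \<delta> by auto
  have "ennreal ?v * ?I \<le> ennreal ?v * ennreal (?a * ?w)" using I by (intro mult_left_mono) auto
  also have "\<dots> = ennreal (?a * (?v * ?w))"
    using nn pos by (subst ennreal_mult[symmetric]) (auto simp: mult_ac)
  also have "\<dots> \<le> ennreal (((2 * cosh (c / 2)) ^ m * ?b) * (?v * ?w))"
    by (rule ennreal_leI, rule mult_right_mono[OF ab mult_nonneg_nonneg[OF nn]])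
  also have "((2 * cosh (c / 2)) ^ m * ?b) * (?v * ?w) = (?k * ?w) * (?b * ?v)" by (simp only: mult_ac)
  also have "ennreal ((?k * ?w) * (?b * ?v)) = ennreal (?k * ?w) * ennreal (?b * ?v)"
    using nn pos c(1) \<delta>(1) by (intro ennreal_mult mult_nonneg_nonneg) auto
  also have "\<dots> \<le> ennreal (?k * ?w) * ?J" using J by (intro mult_left_mono) auto
  finally show ?thesis .
qed

text \<open>
  The bound on the fibres of the set of returning vectors: once the factor of the integral on the left
  is divided out, the right-hand side is of order \<open>\<delta>\<^sup>n\<^sup>-\<^sup>1 r\<close>. A returning direction spends time at
  least \<open>\<delta>\<close> in the union \<open>A\<close> of the balls of radius \<open>3 \<delta>\<close> about the translates of \<open>z\<close>, where the
  trivial translate is excluded because at a time \<open>l \<ge> c / 2 > 2 \<delta>\<close> the geodesic has left the ball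
  about \<open>z\<close>. So the measure of these directions is controlled by the weighted volume of \<open>A\<close>, which
  is compared with that of disjoint balls of radius \<open>c / 4\<close>.
\<close>

lemma return_directions:
  assumes c: "0 < c" "displaces_by c"
    and \<delta>: "0 < \<delta>" "3 * \<delta> \<le> c / 4" and r: "10 * inj_radius \<Gamma> \<le> r" and J: "hyp_isometry J"
  shows "ennreal (unit_ball_vol CARD('n) * sinh (c / 4) ^ CARD('n) / cosh (c / 4)) *
     (ennreal \<delta> * (real CARD('n) * (\<integral>\<^sup>+u. indicator (return_set r \<delta>) (J hyp_origin, J (0, u)) \<partial>sphere_measure)))
   \<le> ennreal ((2 * cosh (c / 2)) ^ (CARD('n) - 1) * (unit_ball_vol CARD('n) * sinh (3 * \<delta>) ^ CARD('n)) *
        (CARD('n) * measure (sphere_measure :: (real^'n) measure) (sphere 0 1) * (3 * r)))"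
    (is "ennreal ?v * (_ * (_ * ?X)) \<le> ennreal (?k * ?s)")
proof -
  define m where "m = CARD('n) - 1"
  define z where "z = J hyp_origin"
  have z: "z \<in> hyp_space" unfolding z_def by (rule hyp_isometry_hyp_space[OF J hyp_origin_in])
  have [measurable]: "J \<in> borel_measurable borel" by (rule hyp_isometry_measurable[OF J])
  have ir: "c / 2 \<le> inj_radius \<Gamma>" by (rule inj_radius_ge[OF c])
  have r0: "0 < r" "\<delta> \<le> r" "c / 2 \<le> r" using ir r c(1) \<delta> by linarith+
  define A where "A = (\<Union>f\<in>\<Gamma> - {id}. hyp_ball (f z) (3 * \<delta>))"
  have "open A" unfolding A_def hyp_ball_def by (intro open_UN ballI open_Collect_less continuous_intros)
  then have [measurable]: "A \<in> sets borel" by (rule borel_open)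
  \<comment> \<open>Only these translates lie near a geodesic of length \<open>2 r\<close> that starts at \<open>z\<close>.\<close>
  define G where "G = {f \<in> \<Gamma>. f \<noteq> id \<and> hyp_dist z (f z) \<le> 2 * r + 3 * \<delta>}"
  have finG: "finite G" unfolding G_def using r0 \<delta> by (intro finite_displaced[OF z]) simp
  have E[measurable]: "(\<lambda>u. indicator (return_set r \<delta>) (J hyp_origin, J (0, u)) :: ennreal) \<in> borel_measurable borel"
    by measurable
  have "ennreal \<delta> * ?X = (\<integral>\<^sup>+u. ennreal \<delta> * indicator (return_set r \<delta>) (J hyp_origin, J (0, u)) \<partial>sphere_measure)"
    by (rule nn_integral_cmult[symmetric])
      (simp add: measurable_cong_sets[OF sets_sphere_measure refl] measurable_restrict_space1[OF E])
  also have "\<dots> \<le> (\<integral>\<^sup>+u. \<integral>\<^sup>+s. indicator A (J (cosh s, sinh s *\<^sub>R u)) * indicator {0<..2 * r} s \<partial>lborel \<partial>sphere_measure)"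
  proof (rule nn_integral_mono)
    fix u :: "real^'n" assume "u \<in> space sphere_measure"
    then have u: "norm u = 1" by (simp add: space_sphere_measure)
    note zv = unit_tangent_of_frame[OF J u, folded z_def]
    have geo: "geodesic z (J (0, u)) s = J (cosh s, sinh s *\<^sub>R u)" for s
      unfolding z_def by (rule geodesic_frame[OF J])
    note gs = geodesic_in_hyp_space[OF zv]
    show "ennreal \<delta> * indicator (return_set r \<delta>) (J hyp_origin, J (0, u))
      \<le> (\<integral>\<^sup>+s. indicator A (J (cosh s, sinh s *\<^sub>R u)) * indicator {0<..2 * r} s \<partial>lborel)"
    proof (cases "(z, J (0, u)) \<in> return_set r \<delta>")
      case True
      then obtain f l where f: "f \<in> \<Gamma>" and l: "inj_radius \<Gamma> \<le> l" "l \<le> r"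
        and near: "geodesic z (J (0, u)) l \<in> hyp_ball (f z) (2 * \<delta>)"
        by (auto simp: return_set_def)
      note fz = in_space[OF f z]
      have d: "hyp_dist (f z) (geodesic z (J (0, u)) l) < 2 * \<delta>"
        using near \<delta>(1) by (simp add: hyp_ball_iff fz gs)
      have l0: "0 < l" "2 * \<delta> \<le> l" using l ir c(1) \<delta> by linarith+
      have "f \<noteq> id"
      proof
        assume "f = id"
        then have "hyp_dist (geodesic z (J (0, u)) 0) (geodesic z (J (0, u)) l) < 2 * \<delta>"
          using d by (simp add: geodesic_def)
        then show False using l0 by (simp add: hyp_dist_geodesic[OF zv])
      qed
      have inA: "J (cosh s, sinh s *\<^sub>R u) \<in> A" if s: "l < s" "s < l + \<delta>" for s
      proof -
        have "hyp_dist (f z) (geodesic z (J (0, u)) s)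
           \<le> hyp_dist (f z) (geodesic z (J (0, u)) l) + hyp_dist (geodesic z (J (0, u)) l) (geodesic z (J (0, u)) s)"
          by (rule hyp_dist_triangle[OF fz gs gs])
        also have "\<dots> < 3 * \<delta>" using d s by (simp add: hyp_dist_geodesic[OF zv])
        finally have "geodesic z (J (0, u)) s \<in> hyp_ball (f z) (3 * \<delta>)"
          using \<delta>(1) by (simp add: hyp_ball_iff fz gs)
        then show ?thesis using f \<open>f \<noteq> id\<close> unfolding A_def geo by blast
      qed
      have "ennreal \<delta> = (\<integral>\<^sup>+s. indicator {l<..<l + \<delta>} s \<partial>lborel)" using \<delta>(1) by simp
      also have "\<dots> \<le> (\<integral>\<^sup>+s. indicator A (J (cosh s, sinh s *\<^sub>R u)) * indicator {0<..2 * r} s \<partial>lborel)"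
      proof (rule nn_integral_mono)
        fix s :: real
        show "indicator {l<..<l + \<delta>} s \<le> (indicator A (J (cosh s, sinh s *\<^sub>R u)) * indicator {0<..2 * r} s :: ennreal)"
        proof (cases "s \<in> {l<..<l + \<delta>}")
          case True
          moreover have "s \<in> {0<..2 * r}" using True l l0 r0 by auto
          ultimately show ?thesis using inA[of s] by simp
        qed simp
      qed
      finally show ?thesis using True by (simp add: z_def)
    qed (simp add: z_def)
  qed
  finally have "real CARD('n) * (ennreal \<delta> * ?X) \<le> real CARD('n) * (\<integral>\<^sup>+u. \<integral>\<^sup>+s. indicator A (J (cosh s, sinh s *\<^sub>R u)) * indicator {0<..2 * r} s \<partial>lborel \<partial>sphere_measure)"
    by (intro mult_left_mono) auto
  also have "\<dots> = (\<integral>\<^sup>+y. indicator A y * radial_weight m (2 * r) (- mink_inner z y) \<partial>hyp_measure)"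
    unfolding m_def z_def using r0 by (intro nn_integral_hyp_polar J) auto
  also have "\<dots> \<le> (\<integral>\<^sup>+y. (\<Sum>f\<in>G. indicator (hyp_ball (f z) (3 * \<delta>)) y * radial_weight m (2 * r) (- mink_inner z y)) \<partial>hyp_measure)"
  proof (rule nn_integral_hyp_measure_mono)
    fix y :: "'n mink" assume y: "y \<in> hyp_space"
    show "indicator A y * radial_weight m (2 * r) (- mink_inner z y)
      \<le> (\<Sum>f\<in>G. indicator (hyp_ball (f z) (3 * \<delta>)) y * radial_weight m (2 * r) (- mink_inner z y))"
    proof (cases "y \<in> A \<and> hyp_dist z y \<le> 2 * r")
      case True
      then obtain f where f: "f \<in> \<Gamma>" "f \<noteq> id" "y \<in> hyp_ball (f z) (3 * \<delta>)" unfolding A_def by blast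
      note fz = in_space[OF f(1) z]
      have "hyp_dist (f z) y < 3 * \<delta>" using f(3) \<delta>(1) by (simp add: hyp_ball_iff fz y)
      then have "hyp_dist z (f z) \<le> 2 * r + 3 * \<delta>"
        using hyp_dist_triangle[OF z y fz] True by (simp add: hyp_dist_commute[of y])
      then have "f \<in> G" using f by (simp add: G_def)
      have "indicator A y * radial_weight m (2 * r) (- mink_inner z y)
        = indicator (hyp_ball (f z) (3 * \<delta>)) y * radial_weight m (2 * r) (- mink_inner z y)"
        using True f(3) by simp
      also have "\<dots> \<le> (\<Sum>f\<in>G. indicator (hyp_ball (f z) (3 * \<delta>)) y * radial_weight m (2 * r) (- mink_inner z y))"
        by (rule member_le_sum[OF \<open>f \<in> G\<close> _ finG]) simp
      finally show ?thesis .
    next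
      case False
      then have "indicator A y * radial_weight m (2 * r) (- mink_inner z y) = 0"
        using r0 by (auto simp: radial_weight_dist z y indicator_def)
      then show ?thesis by (simp only: zero_le)
    qed
  qed measurable
  also have "\<dots> = (\<Sum>f\<in>G. \<integral>\<^sup>+y. indicator (hyp_ball (f z) (3 * \<delta>)) y * radial_weight m (2 * r) (- mink_inner z y) \<partial>hyp_measure)"
    by (rule nn_integral_sum) measurable
  finally have "ennreal ?v * (ennreal \<delta> * (real CARD('n) * ?X)) \<le> ennreal ?v *
      (\<Sum>f\<in>G. \<integral>\<^sup>+y. indicator (hyp_ball (f z) (3 * \<delta>)) y * radial_weight m (2 * r) (- mink_inner z y) \<partial>hyp_measure)"
    by (intro mult_left_mono) (auto simp: mult_ac)
  also have "\<dots> = (\<Sum>f\<in>G. ennreal ?v *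
      (\<integral>\<^sup>+y. indicator (hyp_ball (f z) (3 * \<delta>)) y * radial_weight m (2 * r) (- mink_inner z y) \<partial>hyp_measure))"
    by (rule sum_distrib_left)
  also have "\<dots> \<le> (\<Sum>f\<in>G. ennreal ?k *
      (\<integral>\<^sup>+y. indicator (hyp_ball (f z) (c / 4)) y * radial_weight m (2 * r + c / 2) (- mink_inner z y) \<partial>hyp_measure))"
    unfolding m_def using r0 by (intro sum_mono orbit_ball_weight c \<delta> z) (auto simp: G_def)
  also have "\<dots> = ennreal ?k * (\<Sum>f\<in>G.
      \<integral>\<^sup>+y. indicator (hyp_ball (f z) (c / 4)) y * radial_weight m (2 * r + c / 2) (- mink_inner z y) \<partial>hyp_measure)"
    by (rule sum_distrib_left[symmetric])
  also have "(\<Sum>f\<in>G. \<integral>\<^sup>+y. indicator (hyp_ball (f z) (c / 4)) y * radial_weight m (2 * r + c / 2) (- mink_inner z y) \<partial>hyp_measure)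
    = (\<integral>\<^sup>+y. (\<Sum>f\<in>G. indicator (hyp_ball (f z) (c / 4)) y * radial_weight m (2 * r + c / 2) (- mink_inner z y)) \<partial>hyp_measure)"
    by (rule nn_integral_sum[symmetric]) measurable
  also have "ennreal ?k * \<dots> \<le> ennreal ?k * ennreal ?s"
  proof (rule mult_left_mono)
    have "(\<integral>\<^sup>+y. (\<Sum>f\<in>G. indicator (hyp_ball (f z) (c / 4)) y * radial_weight m (2 * r + c / 2) (- mink_inner z y)) \<partial>hyp_measure)
      \<le> (\<integral>\<^sup>+y. radial_weight m (2 * r + c / 2) (- mink_inner z y) \<partial>(hyp_measure :: 'n mink measure))"
    proof (rule nn_integral_hyp_measure_mono)
      fix y :: "'n mink" assume y: "y \<in> hyp_space"
      have "(\<Sum>f\<in>G. indicator (hyp_ball (f z) (c / 4)) y :: ennreal) \<le> 1"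
      proof (rule sum_indicator_disjoint_le[OF finG])
        fix f g assume "f \<in> G" "g \<in> G" "y \<in> hyp_ball (f z) (c / 4)" "y \<in> hyp_ball (g z) (c / 4)"
        then show "f = g"
          using c(1) by (intro orbit_balls_disjoint[OF c(2) _ _ z y, of "c / 4" f g]) (auto simp: G_def)
      qed
      then have "(\<Sum>f\<in>G. indicator (hyp_ball (f z) (c / 4)) y) * radial_weight m (2 * r + c / 2) (- mink_inner z y)
        \<le> 1 * radial_weight m (2 * r + c / 2) (- mink_inner z y)"
        by (intro mult_right_mono) auto
      then show "(\<Sum>f\<in>G. indicator (hyp_ball (f z) (c / 4)) y * radial_weight m (2 * r + c / 2) (- mink_inner z y))
        \<le> radial_weight m (2 * r + c / 2) (- mink_inner z y)"
        by (simp add: sum_distrib_right)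
    qed measurable
    also have "\<dots> = ennreal (CARD('n) * measure (sphere_measure :: (real^'n) measure) (sphere 0 1) * (2 * r + c / 2))"
      unfolding m_def using r0 c(1) by (intro nn_integral_radial_weight z) simp
    also have "\<dots> \<le> ennreal ?s"
      using r0 by (intro ennreal_leI mult_left_mono) auto
    finally show "(\<integral>\<^sup>+y. (\<Sum>f\<in>G. indicator (hyp_ball (f z) (c / 4)) y * radial_weight m (2 * r + c / 2) (- mink_inner z y)) \<partial>hyp_measure) \<le> ennreal ?s" .
  qed simp
  also have "\<dots> = ennreal (?k * ?s)"
    using r0 \<delta>(1) by (intro ennreal_mult[symmetric] mult_nonneg_nonneg) auto
  finally show ?thesis .
qed

section \<open>Exchanging the end points of a segment\<close>

text \<open>
  The domain \<open>z\<close> is covered by the translates \<open>f K\<close> of \<open>K = base_ball R\<close>; only finitely many \<open>f\<close> matter,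
  as \<open>k x z\<close> vanishes when \<open>z\<close> is far from \<open>x\<close>. Applying \<open>f\<^sup>-\<^sup>1\<close> to both variables brings \<open>z\<close> into
  \<open>K\<close> and spreads \<open>x\<close> over the translates of \<open>K\<close>. Each point \<open>x\<close> is hit at most as often as there
  are \<open>f\<close> with \<open>f K\<close> meeting \<open>K\<close>. A compact set that meets every orbit thus serves in place of a
  fundamental domain, at the price of this multiplicity.
\<close>

lemma double_integral_swap_le:
  fixes k :: "'n mink \<Rightarrow> 'n mink \<Rightarrow> ennreal"
  defines "N \<equiv> \<lambda>R. card {f \<in> \<Gamma>. f ` base_ball R \<inter> base_ball R \<noteq> {}}"
  assumes k[measurable]: "case_prod k \<in> borel_measurable (borel \<Otimes>\<^sub>M borel)"
    and invariant: "\<And>f x z. f \<in> \<Gamma> \<Longrightarrow> x \<in> hyp_space \<Longrightarrow> z \<in> hyp_space \<Longrightarrow> k (f x) (f z) = k x z"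
    and support: "\<And>x z. x \<in> hyp_space \<Longrightarrow> z \<in> hyp_space \<Longrightarrow> k x z \<noteq> 0 \<Longrightarrow> hyp_dist x z \<le> r"
    and R: "0 \<le> R" "0 \<le> r" and cover: "\<And>x. x \<in> hyp_space \<Longrightarrow> \<exists>f\<in>\<Gamma>. f x \<in> base_ball R"
  shows "(\<integral>\<^sup>+x. indicator (base_ball R) x * (\<integral>\<^sup>+z. k x z \<partial>hyp_measure) \<partial>hyp_measure)
    \<le> of_nat (N R) * (\<integral>\<^sup>+z. indicator (base_ball R) z * (\<integral>\<^sup>+x. k x z \<partial>hyp_measure) \<partial>hyp_measure)"
proof -
  let ?K = "base_ball R :: 'n mink set"
  define F where "F = {f \<in> \<Gamma>. f ` base_ball (R + r) \<inter> base_ball (R + r) \<noteq> {}}"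
  have Rr: "0 \<le> R + r" using R by linarith
  have finF: "finite F" unfolding F_def by (rule finite_near)
  have FG: "f \<in> \<Gamma>" if "f \<in> F" for f using that by (simp add: F_def)
  have Kb[measurable]: "?K \<in> sets borel" by (intro borel_closed compact_imp_closed compact_base_ball)
  have meas: "f \<in> borel_measurable borel" if "f \<in> \<Gamma>" for f by (rule hyp_isometry_measurable[OF iso[OF that]])
  let ?t = "\<lambda>f x z. indicator ?K x * indicator ?K (inv f z) * k x z"
  have tm: "case_prod (?t f) \<in> borel_measurable (borel \<Otimes>\<^sub>M borel)" if "f \<in> F" for f
  proof -
    have [measurable]: "inv f \<in> borel_measurable borel" by (rule meas[OF inv_in[OF FG[OF that]]])
    show ?thesis by measurable
  qed
  have tm1: "?t f x \<in> borel_measurable borel" if "f \<in> F" for f x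
  proof -
    have [measurable]: "inv f \<in> borel_measurable borel" by (rule meas[OF inv_in[OF FG[OF that]]])
    show ?thesis by measurable
  qed
  have "(\<integral>\<^sup>+x. indicator ?K x * (\<integral>\<^sup>+z. k x z \<partial>hyp_measure) \<partial>hyp_measure)
    = (\<integral>\<^sup>+x. \<integral>\<^sup>+z. indicator ?K x * k x z \<partial>hyp_measure \<partial>hyp_measure)"
    by (simp add: nn_integral_cmult)
  also have "\<dots> \<le> (\<integral>\<^sup>+x. \<integral>\<^sup>+z. (\<Sum>f\<in>F. ?t f x z) \<partial>hyp_measure \<partial>hyp_measure)"
  proof (rule nn_integral_hyp_measure_mono)
    show "(\<lambda>x. \<integral>\<^sup>+z. indicator ?K x * k x z \<partial>hyp_measure) \<in> borel_measurable borel" by measurable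
    show "(\<lambda>x. \<integral>\<^sup>+z. (\<Sum>f\<in>F. ?t f x z) \<partial>hyp_measure) \<in> borel_measurable borel"
      by (rule hyp_measure.borel_measurable_nn_integral)
        (use tm in \<open>simp add: case_prod_beta borel_measurable_sum\<close>)
    fix x :: "'n mink" assume x: "x \<in> hyp_space"
    show "(\<integral>\<^sup>+z. indicator ?K x * k x z \<partial>hyp_measure) \<le> (\<integral>\<^sup>+z. (\<Sum>f\<in>F. ?t f x z) \<partial>hyp_measure)"
    proof (rule nn_integral_hyp_measure_mono)
      show "(\<lambda>z. indicator ?K x * k x z) \<in> borel_measurable borel" by measurable
      show "(\<lambda>z. \<Sum>f\<in>F. ?t f x z) \<in> borel_measurable borel" by (rule borel_measurable_sum) (rule tm1)
      fix z :: "'n mink" assume z: "z \<in> hyp_space"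
      show "indicator ?K x * k x z \<le> (\<Sum>f\<in>F. ?t f x z)"
      proof (cases "x \<in> ?K \<and> k x z \<noteq> 0")
        case True
        then have d: "hyp_dist x z \<le> r" using support x z by blast
        obtain g where g: "g \<in> \<Gamma>" "g z \<in> ?K" using cover[OF z] by blast
        have gz: "inv g (g z) = z" by (rule inv_f_f[OF g(1)])
        have ig: "inv (inv g) = g" by (rule inv_inv_eq) (simp add: bij_def hyp_isometry_inj hyp_isometry_surj iso[OF g(1)])
        have "hyp_dist hyp_origin x \<le> R" using True R(1) by (simp add: base_ball_iff)
        then have "z \<in> base_ball (R + r)"
          using hyp_dist_triangle[OF hyp_origin_in x z] d z by (simp add: base_ball_iff[OF Rr])
        moreover have "g z \<in> base_ball (R + r)"
          using g(2) R by (simp add: base_ball_iff)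
        ultimately have "inv g \<in> F"
          using gz inv_in[OF g(1)] unfolding F_def by (metis (mono_tags, lifting) IntI empty_iff imageI mem_Collect_eq)
        then have "?t (inv g) x z \<le> (\<Sum>f\<in>F. ?t f x z)"
          by (rule member_le_sum[OF _ _ finF]) simp
        then show ?thesis using True g(2) by (simp add: ig)
      next
        case False
        then show ?thesis by (auto simp: indicator_def)
      qed
    qed
  qed
  also have "\<dots> = (\<integral>\<^sup>+x. (\<Sum>f\<in>F. \<integral>\<^sup>+z. ?t f x z \<partial>hyp_measure) \<partial>hyp_measure)"
    by (rule nn_integral_cong, rule nn_integral_sum) (use tm1 in simp)
  also have "\<dots> = (\<Sum>f\<in>F. \<integral>\<^sup>+x. \<integral>\<^sup>+z. ?t f x z \<partial>hyp_measure \<partial>hyp_measure)"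
    by (rule nn_integral_sum) (use tm in \<open>auto intro!: hyp_measure.borel_measurable_nn_integral\<close>)
  also have "\<dots> = (\<Sum>f\<in>F. \<integral>\<^sup>+z. \<integral>\<^sup>+x. indicator ?K (f x) * indicator ?K z * k x z \<partial>hyp_measure \<partial>hyp_measure)"
  proof (rule sum.cong[OF refl])
    fix f assume "f \<in> F"
    then have f: "f \<in> \<Gamma>" by (rule FG)
    have [measurable]: "f \<in> borel_measurable borel" "inv f \<in> borel_measurable borel"
      by (rule meas[OF f], rule meas[OF inv_in[OF f]])
    have "(\<integral>\<^sup>+x. \<integral>\<^sup>+z. ?t f x z \<partial>hyp_measure \<partial>hyp_measure)
      = (\<integral>\<^sup>+x. \<integral>\<^sup>+z. ?t f (f x) z \<partial>hyp_measure \<partial>hyp_measure)"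
      by (rule nn_integral_hyp_measure_isometry[OF _ iso[OF f], symmetric]) measurable
    also have "\<dots> = (\<integral>\<^sup>+x. \<integral>\<^sup>+z. ?t f (f x) (f z) \<partial>hyp_measure \<partial>hyp_measure)"
      by (rule nn_integral_cong, rule nn_integral_hyp_measure_isometry[OF _ iso[OF f], symmetric]) measurable
    also have "\<dots> = (\<integral>\<^sup>+x. \<integral>\<^sup>+z. indicator ?K (f x) * indicator ?K z * k x z \<partial>hyp_measure \<partial>hyp_measure)"
    proof (rule nn_integral_hyp_measure_cong)
      fix x :: "'n mink" assume x: "x \<in> hyp_space"
      show "(\<integral>\<^sup>+z. ?t f (f x) (f z) \<partial>hyp_measure) = (\<integral>\<^sup>+z. indicator ?K (f x) * indicator ?K z * k x z \<partial>hyp_measure)"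
        by (rule nn_integral_hyp_measure_cong) (measurable, simp add: inv_f_f[OF f] invariant[OF f x])
    qed measurable
    also have "\<dots> = (\<integral>\<^sup>+z. \<integral>\<^sup>+x. indicator ?K (f x) * indicator ?K z * k x z \<partial>hyp_measure \<partial>hyp_measure)"
      by (rule hyp_pair.Fubini') measurable
    finally show "(\<integral>\<^sup>+x. \<integral>\<^sup>+z. ?t f x z \<partial>hyp_measure \<partial>hyp_measure) = \<dots>" .
  qed
  also have "\<dots> = (\<integral>\<^sup>+z. (\<Sum>f\<in>F. \<integral>\<^sup>+x. indicator ?K (f x) * indicator ?K z * k x z \<partial>hyp_measure) \<partial>hyp_measure)"
  proof (rule nn_integral_sum[symmetric])
    fix f assume "f \<in> F"
    then have [measurable]: "f \<in> borel_measurable borel" by (intro meas FG)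
    show "(\<lambda>z. \<integral>\<^sup>+x. indicator ?K (f x) * indicator ?K z * k x z \<partial>hyp_measure) \<in> borel_measurable hyp_measure"
      by measurable
  qed
  also have "\<dots> = (\<integral>\<^sup>+z. (\<integral>\<^sup>+x. (\<Sum>f\<in>F. indicator ?K (f x) * indicator ?K z * k x z) \<partial>hyp_measure) \<partial>hyp_measure)"
  proof (rule nn_integral_cong, rule nn_integral_sum[symmetric])
    fix z f assume "f \<in> F"
    then have [measurable]: "f \<in> borel_measurable borel" by (intro meas FG)
    show "(\<lambda>x. indicator ?K (f x) * indicator ?K z * k x z) \<in> borel_measurable hyp_measure"
      by measurable
  qed
  also have "\<dots> \<le> (\<integral>\<^sup>+z. (\<integral>\<^sup>+x. of_nat (N R) * (indicator ?K z * k x z) \<partial>hyp_measure) \<partial>hyp_measure)"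
  proof (rule nn_integral_mono, rule nn_integral_hyp_measure_mono)
    fix z :: "'n mink"
    show "(\<lambda>x. \<Sum>f\<in>F. indicator ?K (f x) * indicator ?K z * k x z) \<in> borel_measurable borel"
    proof (rule borel_measurable_sum)
      fix f assume "f \<in> F"
      then have [measurable]: "f \<in> borel_measurable borel" by (intro meas FG)
      show "(\<lambda>x. indicator ?K (f x) * indicator ?K z * k x z) \<in> borel_measurable borel" by measurable
    qed
    show "(\<lambda>x. of_nat (N R) * (indicator ?K z * k x z)) \<in> borel_measurable borel" by measurable
    fix x :: "'n mink" assume x: "x \<in> hyp_space"
    let ?S = "{f \<in> F. f x \<in> ?K}"
    have "card ?S \<le> N R"
    proof (cases "?S = {}")
      case False
      then obtain g where g: "g \<in> \<Gamma>" "g x \<in> ?K" using FG by blast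
      show ?thesis unfolding N_def
      proof (rule card_inj_on_le[of "\<lambda>f. f \<circ> inv g"])
        show "inj_on (\<lambda>f. f \<circ> inv g) ?S"
        proof (rule inj_onI)
          fix f h assume e: "f \<circ> inv g = h \<circ> inv g"
          have "f w = h w" for w using fun_cong[OF e, of "g w"] by (simp add: inv_f_f[OF g(1)])
          then show "f = h" by blast
        qed
        show "(\<lambda>f. f \<circ> inv g) ` ?S \<subseteq> {f \<in> \<Gamma>. f ` ?K \<inter> ?K \<noteq> {}}"
        proof (rule image_subsetI)
          fix f assume "f \<in> ?S"
          then have f: "f \<in> F" "f x \<in> ?K" by auto
          have "f \<circ> inv g \<in> \<Gamma>" by (rule comp_in[OF FG[OF f(1)] inv_in[OF g(1)]])
          moreover have "f x \<in> (f \<circ> inv g) ` ?K"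
            by (rule image_eqI[OF _ g(2)]) (simp add: inv_f_f[OF g(1)])
          ultimately show "f \<circ> inv g \<in> {f \<in> \<Gamma>. f ` ?K \<inter> ?K \<noteq> {}}"
            using f(2) by blast
        qed
        show "finite {f \<in> \<Gamma>. f ` ?K \<inter> ?K \<noteq> {}}" by (rule finite_near)
      qed
    next
      case True
      then show ?thesis by (metis card.empty le0)
    qed
    moreover have "(\<Sum>f\<in>F. indicator ?K (f x) :: ennreal) = of_nat (card ?S)"
    proof -
      have "(\<Sum>f\<in>F. indicator ?K (f x) :: ennreal) = (\<Sum>f\<in>?S. 1)"
        using finF by (intro sum.mono_neutral_cong_right) (auto simp: indicator_def)
      then show ?thesis by simp
    qed
    ultimately have "(\<Sum>f\<in>F. indicator ?K (f x)) * (indicator ?K z * k x z) \<le> of_nat (N R) * (indicator ?K z * k x z)"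
      by (intro mult_right_mono) (auto intro: of_nat_mono)
    then show "(\<Sum>f\<in>F. indicator ?K (f x) * indicator ?K z * k x z) \<le> of_nat (N R) * (indicator ?K z * k x z)"
      by (simp add: sum_distrib_right mult.assoc)
  qed
  also have "\<dots> = (\<integral>\<^sup>+z. of_nat (N R) * (indicator ?K z * (\<integral>\<^sup>+x. k x z \<partial>hyp_measure)) \<partial>hyp_measure)"
    by (simp add: nn_integral_cmult)
  also have "\<dots> = of_nat (N R) * (\<integral>\<^sup>+z. indicator ?K z * (\<integral>\<^sup>+x. k x z \<partial>hyp_measure) \<partial>hyp_measure)"
    by (rule nn_integral_cmult) measurable
  finally show ?thesis .
qed

end

text \<open>
  The velocity at \<open>z\<close> of the unit speed geodesic from \<open>x\<close> to \<open>z\<close>.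
\<close>

definition arrival :: "'n::finite mink \<Rightarrow> 'n mink \<Rightarrow> 'n mink" where
  "arrival x z = (1 / sqrt ((mink_inner x z)\<^sup>2 - 1)) *\<^sub>R (- mink_inner x z *\<^sub>R z - x)"

lemma arrival_measurable [measurable]:
  fixes f g :: "'a \<Rightarrow> 'n::finite mink"
  assumes [measurable]: "f \<in> borel_measurable M" "g \<in> borel_measurable M"
  shows "(\<lambda>x. arrival (f x) (g x)) \<in> borel_measurable M"
  unfolding arrival_def by measurable

lemma arrival_outgoing:
  assumes J: "hyp_isometry J" and u: "norm u = 1" and s: "0 < s"
  shows "arrival (J hyp_origin) (J (cosh s, sinh s *\<^sub>R u)) = J (sinh s, cosh s *\<^sub>R u)"
proof -
  note lin = hyp_isometry_linear[OF J]
  have "mink_inner (J hyp_origin) (J (cosh s, sinh s *\<^sub>R u)) = - cosh s"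
    unfolding hyp_isometry_inner[OF J] by (simp add: mink_inner_def)
  moreover have "sqrt ((cosh s)\<^sup>2 - 1) = sinh s" using s by (simp add: cosh_square_eq)
  ultimately have "arrival (J hyp_origin) (J (cosh s, sinh s *\<^sub>R u))
      = (1 / sinh s) *\<^sub>R (cosh s *\<^sub>R J (cosh s, sinh s *\<^sub>R u) - J hyp_origin)"
    by (simp add: arrival_def)
  also have "\<dots> = J ((1 / sinh s) *\<^sub>R (cosh s *\<^sub>R (cosh s, sinh s *\<^sub>R u) - hyp_origin))"
    by (simp only: linear_scale[OF lin] linear_diff[OF lin])
  also have "(1 / sinh s) *\<^sub>R (cosh s *\<^sub>R (cosh s, sinh s *\<^sub>R u) - hyp_origin) = (sinh s, cosh s *\<^sub>R u)"
    using s cosh_square_eq[of s] by (simp add: power2_eq_square)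
  finally show ?thesis .
qed

lemma arrival_incoming:
  assumes J: "hyp_isometry J" and u: "norm u = 1" and s: "0 < s"
  shows "arrival (J (cosh s, sinh s *\<^sub>R u)) (J hyp_origin) = J (0, - u)"
proof -
  note lin = hyp_isometry_linear[OF J]
  have "mink_inner (J (cosh s, sinh s *\<^sub>R u)) (J hyp_origin) = - cosh s"
    unfolding hyp_isometry_inner[OF J] by (simp add: mink_inner_def)
  moreover have "sqrt ((cosh s)\<^sup>2 - 1) = sinh s" using s by (simp add: cosh_square_eq)
  ultimately have "arrival (J (cosh s, sinh s *\<^sub>R u)) (J hyp_origin)
      = (1 / sinh s) *\<^sub>R (cosh s *\<^sub>R J hyp_origin - J (cosh s, sinh s *\<^sub>R u))"
    by (simp add: arrival_def)
  also have "\<dots> = J ((1 / sinh s) *\<^sub>R (cosh s *\<^sub>R hyp_origin - (cosh s, sinh s *\<^sub>R u)))"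
    by (simp only: linear_scale[OF lin] linear_diff[OF lin])
  also have "(1 / sinh s) *\<^sub>R (cosh s *\<^sub>R hyp_origin - (cosh s, sinh s *\<^sub>R u)) = (0, - u)"
    using s by simp
  finally show ?thesis .
qed

lemma arrival_isometry:
  assumes "hyp_isometry f" shows "arrival (f x) (f z) = f (arrival x z)"
  by (simp add: arrival_def hyp_isometry_inner[OF assms] linear_diff[OF hyp_isometry_linear[OF assms]]
      linear_scale[OF hyp_isometry_linear[OF assms]] linear_neg[OF hyp_isometry_linear[OF assms]])

lemma dist_M_lessD:
  assumes "dist_M X Y < d" "X \<noteq> {}" "Y \<noteq> {}"
  obtains x y where "x \<in> X" "y \<in> Y" "hyp_dist x y < d"
proof -
  have "{hyp_dist x y | x y. x \<in> X \<and> y \<in> Y} \<noteq> {}" using assms by blast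
  then obtain w where "w \<in> {hyp_dist x y | x y. x \<in> X \<and> y \<in> Y}" "w < d"
    using cInf_lessD[of "{hyp_dist x y | x y. x \<in> X \<and> y \<in> Y}" d] assms(1) unfolding dist_M_def by blast
  then show ?thesis using that by blast
qed

context closed_hyperbolic
begin

lemma return_setI:
  assumes "f \<in> \<Gamma>" "l \<in> {inj_radius \<Gamma>..r}" "geodesic x v l \<in> hyp_ball (f x) (2 * \<delta>)"
  shows "(x, v) \<in> return_set r \<delta>"
  unfolding return_set_def mem_Collect_eq prod.case
  by (rule bexI[OF _ assms(1)], rule bexI[OF _ assms(2)], rule assms(3))

text \<open>
  The density, with respect to the volume in both variables, of the segments from \<open>x\<close> to \<open>z\<close> of
  length at most \<open>r\<close> that arrive at \<open>z\<close> with a returning velocity.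
\<close>

definition return_kernel :: "real \<Rightarrow> real \<Rightarrow> 'n mink \<Rightarrow> 'n mink \<Rightarrow> ennreal" where
  "return_kernel r \<delta> x z = indicator (return_set r \<delta>) (z, arrival x z) *
     radial_weight (CARD('n) - 1) r (- mink_inner x z)"

lemma return_kernel_measurable [measurable]:
  "(\<lambda>(x, z). return_kernel r \<delta> x z) \<in> borel_measurable (borel \<Otimes>\<^sub>M borel)"
  unfolding return_kernel_def by measurable

text \<open>
  Fixing \<open>x\<close>, polar coordinates about \<open>x\<close> turn the end point \<open>z\<close> into a direction and a time, and the
  velocity of arrival into the image of the direction under the flow.
\<close>

lemma nn_integral_kernel_outgoing:
  assumes J: "hyp_isometry J" and r: "0 < r"
  shows "real CARD('n) * (\<integral>\<^sup>+u. \<integral>\<^sup>+s. indicator (return_set r \<delta>) (hyp_flow s (J hyp_origin, J (0, u))) * indicator {0<..r} s \<partial>lborel \<partial>sphere_measure)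
    = (\<integral>\<^sup>+z. return_kernel r \<delta> (J hyp_origin) z \<partial>hyp_measure)"
proof -
  have "(\<integral>\<^sup>+u. \<integral>\<^sup>+s. indicator (return_set r \<delta>) (hyp_flow s (J hyp_origin, J (0, u))) * indicator {0<..r} s \<partial>lborel \<partial>sphere_measure)
    = (\<integral>\<^sup>+u. \<integral>\<^sup>+s. indicator (return_set r \<delta>) (J (cosh s, sinh s *\<^sub>R u), arrival (J hyp_origin) (J (cosh s, sinh s *\<^sub>R u))) * indicator {0<..r} s \<partial>lborel \<partial>sphere_measure)"
  proof (rule nn_integral_cong, rule nn_integral_cong)
    fix u :: "real^'n" and s :: real assume "u \<in> space sphere_measure"
    then have "norm u = 1" by (simp add: space_sphere_measure)
    then show "indicator (return_set r \<delta>) (hyp_flow s (J hyp_origin, J (0, u))) * indicator {0<..r} s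
      = (indicator (return_set r \<delta>) (J (cosh s, sinh s *\<^sub>R u), arrival (J hyp_origin) (J (cosh s, sinh s *\<^sub>R u))) * indicator {0<..r} s :: ennreal)"
      by (cases "0 < s") (simp_all add: hyp_flow_frame[OF J] arrival_outgoing[OF J])
  qed
  then show ?thesis
    unfolding return_kernel_def
    by (simp only:) (rule nn_integral_hyp_polar[OF _ J r], measurable)
qed

text \<open>
  Fixing \<open>z\<close>, polar coordinates about \<open>z\<close> run back along the segment, so the velocity of arrival is
  the opposite of the direction and does not depend on the time. Together with
  \<open>nn_integral_kernel_outgoing\<close> this replaces the flow invariance of the Liouville measure.
\<close>

lemma nn_integral_kernel_incoming:
  assumes J: "hyp_isometry J" and r: "0 < r"
  shows "(\<integral>\<^sup>+x. return_kernel r \<delta> x (J hyp_origin) \<partial>hyp_measure)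
    = ennreal r * (real CARD('n) * (\<integral>\<^sup>+u. indicator (return_set r \<delta>) (J hyp_origin, J (0, - u)) \<partial>sphere_measure))"
proof -
  have [measurable]: "J \<in> borel_measurable borel" by (rule hyp_isometry_measurable[OF J])
  have "(\<integral>\<^sup>+x. return_kernel r \<delta> x (J hyp_origin) \<partial>hyp_measure)
    = (\<integral>\<^sup>+x. indicator (return_set r \<delta>) (J hyp_origin, arrival x (J hyp_origin)) * radial_weight (CARD('n) - 1) r (- mink_inner (J hyp_origin) x) \<partial>hyp_measure)"
    by (simp add: return_kernel_def mink_inner_commute)
  also have "\<dots> = real CARD('n) * (\<integral>\<^sup>+u. \<integral>\<^sup>+s. indicator (return_set r \<delta>) (J hyp_origin, arrival (J (cosh s, sinh s *\<^sub>R u)) (J hyp_origin)) * indicator {0<..r} s \<partial>lborel \<partial>sphere_measure)"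
    by (rule nn_integral_hyp_polar[OF _ J r, symmetric]) measurable
  also have "(\<integral>\<^sup>+u. \<integral>\<^sup>+s. indicator (return_set r \<delta>) (J hyp_origin, arrival (J (cosh s, sinh s *\<^sub>R u)) (J hyp_origin)) * indicator {0<..r} s \<partial>lborel \<partial>sphere_measure)
    = (\<integral>\<^sup>+u. ennreal r * indicator (return_set r \<delta>) (J hyp_origin, J (0, - u)) \<partial>sphere_measure)"
  proof (rule nn_integral_cong)
    fix u :: "real^'n" assume "u \<in> space sphere_measure"
    then have u: "norm u = 1" by (simp add: space_sphere_measure)
    have "(\<integral>\<^sup>+s. indicator (return_set r \<delta>) (J hyp_origin, arrival (J (cosh s, sinh s *\<^sub>R u)) (J hyp_origin)) * indicator {0<..r} s \<partial>lborel)
      = (\<integral>\<^sup>+s. indicator (return_set r \<delta>) (J hyp_origin, J (0, - u)) * indicator {0<..r} s \<partial>lborel)"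
    proof (rule nn_integral_cong)
      fix s :: real
      show "indicator (return_set r \<delta>) (J hyp_origin, arrival (J (cosh s, sinh s *\<^sub>R u)) (J hyp_origin)) * indicator {0<..r} s
        = (indicator (return_set r \<delta>) (J hyp_origin, J (0, - u)) * indicator {0<..r} s :: ennreal)"
        by (cases "0 < s") (simp_all add: arrival_incoming[OF J u])
    qed
    also have "\<dots> = ennreal r * indicator (return_set r \<delta>) (J hyp_origin, J (0, - u))"
      using r by (subst nn_integral_cmult_indicator) (simp_all add: mult.commute)
    finally show "(\<integral>\<^sup>+s. indicator (return_set r \<delta>) (J hyp_origin, arrival (J (cosh s, sinh s *\<^sub>R u)) (J hyp_origin)) * indicator {0<..r} s \<partial>lborel)
      = ennreal r * indicator (return_set r \<delta>) (J hyp_origin, J (0, - u))" .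
  qed
  also have "\<dots> = ennreal r * (\<integral>\<^sup>+u. indicator (return_set r \<delta>) (J hyp_origin, J (0, - u)) \<partial>sphere_measure)"
    by (rule nn_integral_cmult, rule measurable_sphere_measureI) measurable
  finally show ?thesis by (simp only: mult_ac)
qed

lemma return_kernel_isometry:
  assumes f: "f \<in> \<Gamma>" shows "return_kernel r \<delta> (f x) (f z) = return_kernel r \<delta> x z"
  by (simp add: return_kernel_def hyp_isometry_inner[OF iso[OF f]] arrival_isometry[OF iso[OF f]]
      return_set_invariant[OF f] indicator_def)

lemma return_kernel_support:
  assumes "x \<in> hyp_space" "z \<in> hyp_space" "0 \<le> r" "return_kernel r \<delta> x z \<noteq> 0" shows "hyp_dist x z \<le> r"
  using assms by (auto simp: return_kernel_def radial_weight_dist split: if_splits)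

section \<open>Tight vectors\<close>

lemma base_proj_geodesic_flow:
  "base_proj (geodesic_flow s (vector_class \<Gamma> (x, v))) = (\<lambda>f. f (geodesic x v s)) ` \<Gamma>"
  unfolding base_proj_def geodesic_flow_def vector_class_def image_image
  by (rule image_cong[OF refl]) (simp add: hyp_flow_eq geodesic_isometry[OF iso])

text \<open>
  Both orbits are moved by one group element, so that the second point is the given lift.
\<close>

lemma close_lifts:
  assumes "dist_M (base_proj (geodesic_flow s (vector_class \<Gamma> (x, v))))
      (base_proj (geodesic_flow t (vector_class \<Gamma> (x, v)))) < \<delta>"
  obtains f where "f \<in> \<Gamma>" "hyp_dist (f (geodesic x v s)) (geodesic x v t) < \<delta>"
proof -
  have ne: "(\<lambda>f. f y) ` \<Gamma> \<noteq> {}" for y :: "'n mink" using id_in by (metis empty_iff image_is_empty)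
  obtain a b where ab: "a \<in> (\<lambda>f. f (geodesic x v s)) ` \<Gamma>" "b \<in> (\<lambda>f. f (geodesic x v t)) ` \<Gamma>" "hyp_dist a b < \<delta>"
    by (rule dist_M_lessD[OF assms[unfolded base_proj_geodesic_flow] ne ne])
  obtain g where g: "g \<in> \<Gamma>" "a = g (geodesic x v s)" using ab(1) by (rule imageE) simp
  obtain h where h: "h \<in> \<Gamma>" "b = h (geodesic x v t)" using ab(2) by (rule imageE) simp
  have d: "hyp_dist (g (geodesic x v s)) (h (geodesic x v t)) < \<delta>" using ab(3) g(2) h(2) by simp
  have "hyp_dist ((inv h \<circ> g) (geodesic x v s)) (geodesic x v t)
     = hyp_dist (h ((inv h \<circ> g) (geodesic x v s))) (h (geodesic x v t))"
    by (rule hyp_dist_isometry[OF iso[OF h(1)], symmetric])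
  also have "\<dots> < \<delta>" using d by (simp add: f_inv_f[OF h(1)])
  finally show ?thesis by (rule that[OF comp_in[OF inv_in[OF h(1)] g(1)]])
qed

text \<open>
  The two times of closeness may be exchanged by applying the inverse group element; let \<open>s\<close> be the
  earlier one. Then the flow line is in \<open>return_set\<close> during \<open>(s - \<delta>, s)\<close>, with a return at time
  \<open>t - a\<close> of the vector at time \<open>a\<close>. This interval lies in \<open>{0<..r}\<close> as
  \<open>s \<ge> r / 10 \<ge> inj_radius \<Gamma> \<ge> \<delta>\<close>.
\<close>

lemma tight_return_time:
  assumes xv: "(x, v) \<in> unit_tangent" and tight: "tight \<Gamma> r \<epsilon> \<delta> (vector_class \<Gamma> (x, v))"
    and \<delta>: "0 < \<delta>" "\<delta> \<le> inj_radius \<Gamma>" and r: "10 * inj_radius \<Gamma> \<le> r"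
  shows "ennreal \<delta> \<le> (\<integral>\<^sup>+s. indicator (return_set r \<delta>) (hyp_flow s (x, v)) * indicator {0<..r} s \<partial>lborel)"
proof -
  obtain s t f where s: "r / 10 \<le> s" "s \<le> 9 * r / 10" and t: "r / 10 \<le> t" "t \<le> 9 * r / 10"
    and st: "inj_radius \<Gamma> \<le> t - s" and f: "f \<in> \<Gamma>"
    and d: "hyp_dist (f (geodesic x v s)) (geodesic x v t) < \<delta>"
  proof -
    obtain s t where s: "s \<in> {r / 10..9 * r / 10}" and t: "t \<in> {r / 10..9 * r / 10}" and st: "\<bar>s - t\<bar> \<ge> inj_radius \<Gamma>"
      and d: "dist_M (base_proj (geodesic_flow s (vector_class \<Gamma> (x, v)))) (base_proj (geodesic_flow t (vector_class \<Gamma> (x, v)))) < \<delta>"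
      using tight unfolding tight_def by blast
    obtain f where f: "f \<in> \<Gamma>" "hyp_dist (f (geodesic x v s)) (geodesic x v t) < \<delta>"
      using close_lifts[OF d] by blast
    show ?thesis
    proof (cases "s \<le> t")
      case True
      then show ?thesis using that[of s t f] s t st f by simp
    next
      case False
      have "hyp_dist (inv f (geodesic x v t)) (geodesic x v s)
        = hyp_dist (f (inv f (geodesic x v t))) (f (geodesic x v s))"
        by (rule hyp_dist_isometry[OF iso[OF f(1)], symmetric])
      also have "\<dots> < \<delta>" using f(2) by (simp add: f_inv_f[OF f(1)] hyp_dist_commute)
      finally show ?thesis using that[of t s "inv f"] s t st inv_in[OF f(1)] False by simp
    qed
  qed
  note gs = geodesic_in_hyp_space[OF xv]
  have ret: "hyp_flow a (x, v) \<in> return_set r \<delta>" if a: "s - \<delta> < a" "a < s" for a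
  proof -
    note fa = in_space[OF f gs, of a] and fs = in_space[OF f gs, of s]
    have "hyp_dist (f (geodesic x v a)) (geodesic x v t)
      \<le> hyp_dist (f (geodesic x v a)) (f (geodesic x v s)) + hyp_dist (f (geodesic x v s)) (geodesic x v t)"
      by (rule hyp_dist_triangle[OF fa fs gs])
    also have "hyp_dist (f (geodesic x v a)) (f (geodesic x v s)) = \<bar>a - s\<bar>"
      by (simp only: hyp_dist_isometry[OF iso[OF f]] hyp_dist_geodesic[OF xv])
    finally have "hyp_dist (f (geodesic x v a)) (geodesic x v t) < 2 * \<delta>" using a d by simp
    then have near: "geodesic x v t \<in> hyp_ball (f (geodesic x v a)) (2 * \<delta>)"
      using \<delta>(1) by (simp add: hyp_ball_iff fa gs)
    have "t - a \<in> {inj_radius \<Gamma>..r}" using a s t st r \<delta> by auto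
    moreover have "geodesic (geodesic x v a) (sinh a *\<^sub>R x + cosh a *\<^sub>R v) (t - a) \<in> hyp_ball (f (geodesic x v a)) (2 * \<delta>)"
      using near by (simp add: geodesic_flow_add)
    ultimately show ?thesis unfolding hyp_flow_eq by (rule return_setI[OF f])
  qed
  have "ennreal \<delta> = (\<integral>\<^sup>+a. indicator {s - \<delta><..<s} a \<partial>lborel)" using \<delta>(1) by simp
  also have "\<dots> \<le> (\<integral>\<^sup>+s. indicator (return_set r \<delta>) (hyp_flow s (x, v)) * indicator {0<..r} s \<partial>lborel)"
  proof (rule nn_integral_mono)
    fix a :: real
    show "indicator {s - \<delta><..<s} a \<le> (indicator (return_set r \<delta>) (hyp_flow a (x, v)) * indicator {0<..r} a :: ennreal)"
    proof (cases "a \<in> {s - \<delta><..<s}")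
      case True
      moreover have "a \<in> {0<..r}" using True s r \<delta> by auto
      ultimately show ?thesis using ret[of a] by simp
    qed simp
  qed
  finally show ?thesis .
qed

end

section \<open>The Liouville measure of the tight vectors\<close>

lemma vector_frame: "hyp_chart y = lorentz_boost y hyp_origin" "boost y u = lorentz_boost y (0, u)"
  by (simp_all only: lorentz_boost_origin lorentz_boost_tangent)

lemma sets_liouville_cover: "sets (liouville_cover :: ('n::finite mink \<times> 'n mink) measure) = sets (restrict_space borel unit_tangent)"
  by (simp add: liouville_cover_def)

lemma space_liouville_cover: "space (liouville_cover :: ('n::finite mink \<times> 'n mink) measure) = unit_tangent"
  by (simp add: liouville_cover_def space_restrict_space)

lemma liouville_chart_measurable:
  "(\<lambda>(y, u). (hyp_chart y, boost y u)) \<in> (hyp_volume :: (real^'n::finite) measure) \<Otimes>\<^sub>M sphere_measure \<rightarrow>\<^sub>M restrict_space borel unit_tangent"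
proof (rule measurable_restrict_space2)
  show "(\<lambda>(y::real^'n, u). (hyp_chart y, boost y u)) \<in> space (hyp_volume \<Otimes>\<^sub>M sphere_measure) \<rightarrow> unit_tangent"
    by (auto simp: space_pair_measure space_sphere_measure vector_frame
        intro!: unit_tangent_of_frame hyp_isometry_lorentz_boost)
  have [measurable]: "(\<lambda>p. snd p) \<in> (hyp_volume :: (real^'n) measure) \<Otimes>\<^sub>M sphere_measure \<rightarrow>\<^sub>M borel"
    by (rule measurable_compose[OF measurable_snd]) (simp add: measurable_cong_sets[OF sets_sphere_measure refl] measurable_restrict_space1)
  show "(\<lambda>(y::real^'n, u). (hyp_chart y, boost y u)) \<in> borel_measurable (hyp_volume \<Otimes>\<^sub>M sphere_measure)"
    unfolding case_prod_beta boost_def by measurable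
qed

lemma emeasure_liouville_cover:
  assumes X: "X \<in> sets (liouville_cover :: ('n::finite mink \<times> 'n mink) measure)"
  shows "emeasure liouville_cover X
      = (\<integral>\<^sup>+y. \<integral>\<^sup>+u. indicator X (hyp_chart y, boost y u) \<partial>sphere_measure \<partial>hyp_volume)" (is ?eq)
    and "(\<lambda>y. \<integral>\<^sup>+u. indicator X (hyp_chart y, boost y u) \<partial>sphere_measure) \<in> borel_measurable hyp_volume" (is ?outer)
    and "(\<lambda>u. indicator X (hyp_chart y, boost y u) :: ennreal) \<in> borel_measurable sphere_measure" (is ?inner)
proof -
  have Xr: "X \<in> sets (restrict_space borel unit_tangent)" using X by (simp add: sets_liouville_cover)
  have m: "(\<lambda>p. indicator X (hyp_chart (fst p), boost (fst p) (snd p)) :: ennreal)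
    \<in> borel_measurable (hyp_volume \<Otimes>\<^sub>M sphere_measure)"
    using measurable_compose[OF liouville_chart_measurable borel_measurable_indicator[OF Xr]]
    by (simp add: case_prod_beta)
  have "emeasure liouville_cover X = (\<integral>\<^sup>+p. indicator X p \<partial>liouville_cover)"
    using X by simp
  also have "\<dots> = (\<integral>\<^sup>+p. indicator X (hyp_chart (fst p), boost (fst p) (snd p)) \<partial>(hyp_volume \<Otimes>\<^sub>M sphere_measure))"
    unfolding liouville_cover_def
    by (subst nn_integral_distr[OF liouville_chart_measurable])
      (auto intro: borel_measurable_indicator[OF Xr] simp: case_prod_beta)
  also have "\<dots> = (\<integral>\<^sup>+y. \<integral>\<^sup>+u. indicator X (hyp_chart y, boost y u) \<partial>sphere_measure \<partial>hyp_volume)"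
    using sphere_measure.nn_integral_fst[OF m] by simp
  finally show ?eq .
  show ?outer using sphere_measure.borel_measurable_nn_integral_fst[OF m] by simp
  show ?inner using measurable_compose[OF measurable_Pair1'[of y hyp_volume sphere_measure] m] by simp
qed

context closed_hyperbolic
begin

lemma dirichlet_domain_sets: "dirichlet_domain \<Gamma> \<in> sets liouville_cover"
proof -
  let ?C = "\<Inter>f\<in>\<Gamma>. {p::'n mink \<times> 'n mink. fst (fst p) \<le> fst (f (fst p))}"
  have "closed {p::'n mink \<times> 'n mink. fst (fst p) \<le> fst (f (fst p))}" if "f \<in> \<Gamma>" for f
  proof -
    have "continuous_on UNIV (\<lambda>p::'n mink \<times> 'n mink. f (fst p))"
      by (rule continuous_on_compose2[OF hyp_isometry_continuous[OF iso[OF that], of UNIV]])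
        (auto intro: continuous_on_fst)
    then show ?thesis by (intro closed_Collect_le continuous_on_fst continuous_on_id)
  qed
  then have "closed ?C" by (rule closed_INT[OF ballI])
  then have "?C \<in> sets borel" by (rule borel_closed)
  moreover have "dirichlet_domain \<Gamma> = unit_tangent \<inter> ?C"
  proof -
    have "hyp_dist hyp_origin x \<le> hyp_dist hyp_origin (f x) \<longleftrightarrow> fst x \<le> fst (f x)"
      if "x \<in> hyp_space" "f \<in> \<Gamma>" for f x
    proof -
      note fx = in_space[OF that(2,1)]
      show ?thesis
        using hyp_dist_le_iff[OF hyp_origin_in that(1) hyp_dist_nonneg[OF hyp_origin_in fx]]
          cosh_hyp_dist[OF hyp_origin_in fx] by (simp add: mink_inner_def[of hyp_origin])
    qed
    then show ?thesis by (auto simp: dirichlet_domain_def unit_tangent_def)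
  qed
  ultimately show ?thesis
    unfolding sets_liouville_cover sets_restrict_space by blast
qed

lemma dirichlet_domain_bounded:
  assumes R: "0 \<le> R" and cover: "\<And>x. x \<in> hyp_space \<Longrightarrow> \<exists>f\<in>\<Gamma>. f x \<in> base_ball R"
    and p: "(x, v) \<in> dirichlet_domain \<Gamma>"
  shows "x \<in> base_ball R"
proof -
  have x: "x \<in> hyp_space" using p by (auto simp: dirichlet_domain_def unit_tangent_def)
  obtain f where f: "f \<in> \<Gamma>" "f x \<in> base_ball R" using cover[OF x] by (rule bexE)
  have "hyp_dist hyp_origin x \<le> hyp_dist hyp_origin (f x)"
    using p f(1) by (simp add: dirichlet_domain_def)
  also have "\<dots> \<le> R" using f(2) R by (simp add: base_ball_iff)
  finally show ?thesis using x R by (simp add: base_ball_iff)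
qed

lemma vector_class_measurable: "vector_class \<Gamma> \<in> liouville_cover \<rightarrow>\<^sub>M quotient_borel \<Gamma>"
  unfolding quotient_borel_def
proof (rule measurable_measure_of)
  show "vector_class \<Gamma> \<in> space liouville_cover \<rightarrow> unit_tangent_bundle \<Gamma>"
    by (auto simp: space_liouville_cover unit_tangent_bundle_def)
  fix A assume A: "A \<in> {A. A \<subseteq> unit_tangent_bundle \<Gamma> \<and> {p \<in> unit_tangent. vector_class \<Gamma> p \<in> A} \<in> sets borel}"
  have "vector_class \<Gamma> -` A \<inter> space liouville_cover = unit_tangent \<inter> {p \<in> unit_tangent. vector_class \<Gamma> p \<in> A}"
    by (auto simp: space_liouville_cover)
  then show "vector_class \<Gamma> -` A \<inter> space liouville_cover \<in> sets liouville_cover"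
    using A unfolding sets_liouville_cover sets_restrict_space by blast
qed auto

text \<open>
  Reduces the estimate on the quotient to measurable sets of vectors over the Dirichlet domain. The
  degenerate cases are covered by conventions: the measure of a set that is not measurable is \<open>0\<close>, and
  so are \<open>0 / 0\<close> and every quotient by \<open>\<infinity>\<close> in the normalisation.
\<close>

lemma measure_liouville_le:
  assumes b: "0 \<le> b"
    and le: "\<And>X. X \<in> sets liouville_cover \<Longrightarrow> X \<subseteq> dirichlet_domain \<Gamma> \<Longrightarrow>
      (\<And>p. p \<in> X \<Longrightarrow> vector_class \<Gamma> p \<in> T) \<Longrightarrow> emeasure liouville_cover X \<le> ennreal b"
  shows "measure (liouville \<Gamma>) T \<le> b / enn2real (emeasure liouville_cover (dirichlet_domain \<Gamma>))"
proof (cases "T \<in> sets (quotient_borel \<Gamma>)")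
  case False
  then have "measure (liouville \<Gamma>) T = 0" by (intro measure_notin_sets) (simp add: liouville_def)
  then show ?thesis using b by simp
next
  case True
  let ?D = "dirichlet_domain \<Gamma>" and ?U = "uniform_measure liouville_cover (dirichlet_domain \<Gamma>)"
  let ?P = "vector_class \<Gamma> -` T \<inter> space liouville_cover"
  have P: "?P \<in> sets liouville_cover" by (rule measurable_sets[OF vector_class_measurable True])
  have U: "vector_class \<Gamma> \<in> ?U \<rightarrow>\<^sub>M quotient_borel \<Gamma>"
    using vector_class_measurable by (simp add: measurable_cong_sets[OF sets_uniform_measure refl])
  have "emeasure (liouville \<Gamma>) T = emeasure ?U ?P"
    unfolding liouville_def using emeasure_distr[OF U True] by simp
  also have "\<dots> = emeasure liouville_cover (?D \<inter> ?P) / emeasure liouville_cover ?D"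
    by (rule emeasure_uniform_measure[OF dirichlet_domain_sets P])
  finally have eq: "emeasure (liouville \<Gamma>) T = emeasure liouville_cover (?D \<inter> ?P) / emeasure liouville_cover ?D" .
  have 1: "emeasure liouville_cover (?D \<inter> ?P) \<le> ennreal b"
    by (rule le) (use dirichlet_domain_sets P in auto)
  have 2: "emeasure liouville_cover (?D \<inter> ?P) \<le> emeasure liouville_cover ?D"
    by (rule emeasure_mono) (use dirichlet_domain_sets in auto)
  show ?thesis
  proof (cases "emeasure liouville_cover ?D" rule: ennreal_cases)
    case top
    then show ?thesis using b by (simp add: measure_def eq ennreal_divide_top)
  next
    case (real d)
    obtain a where a: "0 \<le> a" "emeasure liouville_cover (?D \<inter> ?P) = ennreal a" "a \<le> b"
      using 1 b by (cases "emeasure liouville_cover (?D \<inter> ?P)" rule: ennreal_cases) (auto simp: top_unique)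
    show ?thesis
    proof (cases "d = 0")
      case True
      then have "emeasure liouville_cover (?D \<inter> ?P) = 0" using 2 real by simp
      then show ?thesis using True real by (simp add: measure_def eq)
    next
      case False
      then have d: "0 < d" using real by simp
      have "measure (liouville \<Gamma>) T = a / d"
        unfolding measure_def eq a(2) real(2) using a(1) d by (simp add: divide_ennreal)
      then show ?thesis using a d real by (simp add: divide_right_mono)
    qed
  qed
qed

text \<open>
  Markov's inequality with the exchange of end points. The set \<open>X\<close> lies over the compact set
  \<open>base_ball R\<close>, and each of its vectors spends time at least \<open>\<delta>\<close> in \<open>return_set\<close>; so
  \<open>n \<delta>\<close> times its measure is at most the integral of \<open>return_kernel\<close> over \<open>x\<close> in \<open>base_ball R\<close> and
  all \<open>z\<close>. After the exchange, the integral over \<open>x\<close> is \<open>r n\<close> times the measure of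
  a fibre of \<open>return_set\<close>, where the last two factors are bounded by \<open>B\<close>.
\<close>

lemma recurrent_vectors_measure:
  fixes r R \<delta> B c :: real
  assumes c: "0 < c" "displaces_by c" and R: "0 \<le> R"
    and cover: "\<And>x. x \<in> hyp_space \<Longrightarrow> \<exists>f\<in>\<Gamma>. f x \<in> base_ball R"
    and \<delta>: "0 < \<delta>" "3 * \<delta> \<le> c / 4" and r: "10 * inj_radius \<Gamma> \<le> r"
    and X: "X \<in> sets liouville_cover" "X \<subseteq> dirichlet_domain \<Gamma>"
    and return: "\<And>x v. (x, v) \<in> X \<Longrightarrow>
      ennreal \<delta> \<le> (\<integral>\<^sup>+s. indicator (return_set r \<delta>) (hyp_flow s (x, v)) * indicator {0<..r} s \<partial>lborel)"
    and B: "0 \<le> B" "\<And>J. hyp_isometry J \<Longrightarrow>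
      real CARD('n) * (\<integral>\<^sup>+u. indicator (return_set r \<delta>) (J hyp_origin, J (0, u)) \<partial>sphere_measure) \<le> ennreal B"
  shows "ennreal (real CARD('n) * \<delta>) * emeasure liouville_cover X
    \<le> ennreal (card {f \<in> \<Gamma>. f ` base_ball R \<inter> base_ball R \<noteq> {}} * (r * B * (unit_ball_vol CARD('n) * sinh (R + 1) ^ CARD('n))))"
proof -
  let ?K = "base_ball R :: 'n mink set"
  let ?N = "card {f \<in> \<Gamma>. f ` base_ball R \<inter> base_ball R \<noteq> {}}"
  let ?V = "unit_ball_vol CARD('n) * sinh (R + 1) ^ CARD('n)"
  have r0: "0 < r" using inj_radius_ge[OF c] c(1) r by linarith
  have Kb[measurable]: "?K \<in> sets borel" by (intro borel_closed compact_imp_closed compact_base_ball)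
  have k: "case_prod (return_kernel r \<delta>) \<in> borel_measurable (borel \<Otimes>\<^sub>M borel)"
    by (rule return_kernel_measurable)
  note km[measurable] = k
  have "ennreal (real CARD('n) * \<delta>) * emeasure liouville_cover X
    = (\<integral>\<^sup>+y. ennreal (real CARD('n) * \<delta>) * (\<integral>\<^sup>+u. indicator X (hyp_chart y, boost y u) \<partial>sphere_measure) \<partial>hyp_volume)"
    unfolding emeasure_liouville_cover(1)[OF X(1)]
    by (rule nn_integral_cmult[symmetric, OF emeasure_liouville_cover(2)[OF X(1)]])
  also have "\<dots> \<le> (\<integral>\<^sup>+y. indicator ?K (hyp_chart y) * (\<integral>\<^sup>+z. return_kernel r \<delta> (hyp_chart y) z \<partial>hyp_measure) \<partial>hyp_volume)"
  proof (rule nn_integral_mono)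
    fix y :: "real^'n"
    note Ly = hyp_isometry_lorentz_boost[of y]
    show "ennreal (real CARD('n) * \<delta>) * (\<integral>\<^sup>+u. indicator X (hyp_chart y, boost y u) \<partial>sphere_measure)
      \<le> indicator ?K (hyp_chart y) * (\<integral>\<^sup>+z. return_kernel r \<delta> (hyp_chart y) z \<partial>hyp_measure)"
    proof (cases "hyp_chart y \<in> ?K")
      case True
      have "ennreal \<delta> * (\<integral>\<^sup>+u. indicator X (hyp_chart y, boost y u) \<partial>sphere_measure)
        = (\<integral>\<^sup>+u. ennreal \<delta> * indicator X (hyp_chart y, boost y u) \<partial>sphere_measure)"
        by (rule nn_integral_cmult[symmetric, OF emeasure_liouville_cover(3)[OF X(1)]])
      also have "\<dots> \<le> (\<integral>\<^sup>+u. \<integral>\<^sup>+s. indicator (return_set r \<delta>) (hyp_flow s (lorentz_boost y hyp_origin, lorentz_boost y (0, u))) * indicator {0<..r} s \<partial>lborel \<partial>sphere_measure)"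
      proof (rule nn_integral_mono)
        fix u :: "real^'n"
        show "ennreal \<delta> * indicator X (hyp_chart y, boost y u)
          \<le> (\<integral>\<^sup>+s. indicator (return_set r \<delta>) (hyp_flow s (lorentz_boost y hyp_origin, lorentz_boost y (0, u))) * indicator {0<..r} s \<partial>lborel)"
        proof (cases "(hyp_chart y, boost y u) \<in> X")
          case True
          then have "indicator X (hyp_chart y, boost y u) = (1::ennreal)" by simp
          then show ?thesis
            using return[OF True] by (simp only: vector_frame mult_1_right)
        next
          case False
          then have "indicator X (hyp_chart y, boost y u) = (0::ennreal)" by simp
          then show ?thesis by (simp only: mult_zero_right zero_le)
        qed
      qed
      finally have "real CARD('n) * (ennreal \<delta> * (\<integral>\<^sup>+u. indicator X (hyp_chart y, boost y u) \<partial>sphere_measure))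
        \<le> real CARD('n) * (\<integral>\<^sup>+u. \<integral>\<^sup>+s. indicator (return_set r \<delta>) (hyp_flow s (lorentz_boost y hyp_origin, lorentz_boost y (0, u))) * indicator {0<..r} s \<partial>lborel \<partial>sphere_measure)"
        by (rule mult_left_mono) simp
      also have "\<dots> = (\<integral>\<^sup>+z. return_kernel r \<delta> (lorentz_boost y hyp_origin) z \<partial>hyp_measure)"
        by (rule nn_integral_kernel_outgoing[OF Ly r0])
      finally show ?thesis
        using True \<delta>(1) by (simp add: vector_frame(1)[symmetric] ennreal_mult mult.assoc)
    next
      case False
      have "indicator X (hyp_chart y, boost y u) = (0::ennreal)" for u
        using dirichlet_domain_bounded[OF R cover, of "hyp_chart y" "boost y u"] X(2) False
        by (auto simp: indicator_def)
      then show ?thesis by simp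
    qed
  qed
  also have "\<dots> = (\<integral>\<^sup>+x. indicator ?K x * (\<integral>\<^sup>+z. return_kernel r \<delta> x z \<partial>hyp_measure) \<partial>hyp_measure)"
    by (rule nn_integral_hyp_measure_chart[symmetric]) measurable
  also have "\<dots> \<le> of_nat ?N * (\<integral>\<^sup>+z. indicator ?K z * (\<integral>\<^sup>+x. return_kernel r \<delta> x z \<partial>hyp_measure) \<partial>hyp_measure)"
  proof (rule double_integral_swap_le[OF k _ _ R _ cover])
    show "return_kernel r \<delta> (f x) (f z) = return_kernel r \<delta> x z" if "f \<in> \<Gamma>" for f x z
      by (rule return_kernel_isometry[OF that])
    show "hyp_dist x z \<le> r" if "x \<in> hyp_space" "z \<in> hyp_space" "return_kernel r \<delta> x z \<noteq> 0" for x z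
      using return_kernel_support[OF that(1,2) _ that(3)] r0 by simp
  qed (use r0 in simp)
  also have "(\<integral>\<^sup>+z. indicator ?K z * (\<integral>\<^sup>+x. return_kernel r \<delta> x z \<partial>hyp_measure) \<partial>hyp_measure)
    \<le> (\<integral>\<^sup>+z. ennreal (r * B) * indicator (hyp_ball hyp_origin (R + 1)) z \<partial>(hyp_measure :: 'n mink measure))"
  proof (rule nn_integral_hyp_measure_mono)
    fix z :: "'n mink" assume z: "z \<in> hyp_space"
    obtain L where L: "hyp_isometry L" "L hyp_origin = z" using hyp_frame_exists[OF z] by blast
    \<comment> \<open>The frame at \<open>z\<close> is reversed since the direction from \<open>z\<close> to \<open>x\<close> is opposite to the velocity of arrival.\<close>
    let ?J = "L \<circ> (\<lambda>w. (fst w, - snd w))"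
    have J: "hyp_isometry ?J" by (rule hyp_isometry_comp[OF L(1) hyp_isometry_reflection])
    have "(\<integral>\<^sup>+x. return_kernel r \<delta> x z \<partial>hyp_measure)
      = ennreal r * (real CARD('n) * (\<integral>\<^sup>+u. indicator (return_set r \<delta>) (?J hyp_origin, ?J (0, u)) \<partial>sphere_measure))"
      using nn_integral_kernel_incoming[OF L(1) r0] by (simp add: L(2))
    also have "\<dots> \<le> ennreal r * ennreal B" by (rule mult_left_mono[OF B(2)[OF J]]) simp
    also have "\<dots> = ennreal (r * B)" using r0 B(1) by (intro ennreal_mult[symmetric]) auto
    finally have le: "(\<integral>\<^sup>+x. return_kernel r \<delta> x z \<partial>hyp_measure) \<le> ennreal (r * B)" .
    show "indicator ?K z * (\<integral>\<^sup>+x. return_kernel r \<delta> x z \<partial>hyp_measure) \<le> ennreal (r * B) * indicator (hyp_ball hyp_origin (R + 1)) z"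
    proof (cases "z \<in> ?K")
      case True
      then have "z \<in> hyp_ball hyp_origin (R + 1)" using R by (simp add: hyp_ball_iff z base_ball_iff)
      then show ?thesis using le True by simp
    qed simp
  qed measurable
  also have "\<dots> = ennreal (r * B) * emeasure hyp_measure (hyp_ball (hyp_origin :: 'n mink) (R + 1))"
    by (rule nn_integral_cmult_indicator) simp
  also have "\<dots> \<le> ennreal (r * B) * ennreal ?V"
    using R by (intro mult_left_mono emeasure_hyp_ball) auto
  finally have "ennreal (real CARD('n) * \<delta>) * emeasure liouville_cover X \<le> of_nat ?N * (ennreal (r * B) * ennreal ?V)"
    by (simp add: mult_left_mono)
  also have "\<dots> = ennreal (?N * (r * B * ?V))"
    using r0 B(1) R by (simp add: ennreal_mult ennreal_of_nat_eq_real_of_nat)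
  finally show ?thesis .
qed

end

theorem theorem1p9:
  fixes \<Gamma> :: "('n::finite mink \<Rightarrow> 'n mink) set"
  assumes "3 \<le> CARD('n)"
    and "closed_hyperbolic_manifold \<Gamma>"
  shows "\<exists>C>0. \<exists>\<delta>\<^sub>0>0. \<forall>r \<delta> \<epsilon>. 10 * inj_radius \<Gamma> \<le> r \<longrightarrow> 0 < \<delta> \<longrightarrow> \<delta> \<le> \<delta>\<^sub>0 \<longrightarrow> 0 < \<epsilon> \<longrightarrow>
    measure (liouville \<Gamma>) (tight_set \<Gamma> r \<epsilon> \<delta>) \<le> C * \<delta> ^ (CARD('n) - 2) * r\<^sup>2"
proof -
  interpret closed_hyperbolic \<Gamma> by standard (rule assms(2))
  define n where "n = CARD('n)"
  have n: "3 \<le> n" using assms(1) by (simp add: n_def)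
  obtain c where c: "c > 0" "displaces_by c" by (rule displacement)
  obtain R where R: "R > 0" "\<And>x. x \<in> hyp_space \<Longrightarrow> \<exists>f\<in>\<Gamma>. f x \<in> base_ball R"
    using covering_ball by blast
  note ir = inj_radius_ge[OF c]
  define \<omega> where "\<omega> = unit_ball_vol (real n)"
  define s0 where "s0 = measure (sphere_measure :: (real^'n) measure) (sphere 0 1)"
  define v0 where "v0 = \<omega> * sinh (c / 4) ^ n / cosh (c / 4)"
  define N where "N = card {f \<in> \<Gamma>. f ` base_ball R \<inter> base_ball R \<noteq> {}}"
  define V where "V = \<omega> * sinh (R + 1) ^ n"
  define C1 where "C1 = (2 * cosh (c / 2)) ^ (n - 1) * (\<omega> * (3 * cosh c) ^ n) * (n * s0 * 3) / v0"
  define C2 where "C2 = N * V * C1 / n"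
  define d where "d = enn2real (emeasure liouville_cover (dirichlet_domain \<Gamma>))"
  have pos: "0 < \<omega>" "0 \<le> s0" "0 < v0" "0 \<le> V" "0 \<le> d"
    using c(1) R(1) by (auto simp: \<omega>_def s0_def v0_def V_def d_def)
  then have C1: "0 \<le> C1" by (simp add: C1_def)
  then have C2: "0 \<le> C2" using pos by (simp add: C2_def)
  \<comment> \<open>The summand \<open>1\<close> keeps the constant positive. The bound \<open>c / 12\<close> makes \<open>3 * \<delta> \<le> c / 4\<close>.\<close>
  have main: "measure (liouville \<Gamma>) (tight_set \<Gamma> r \<epsilon> \<delta>) \<le> (C2 / d + 1) * \<delta> ^ (n - 2) * r\<^sup>2"
    if r: "10 * inj_radius \<Gamma> \<le> r" and \<delta>: "0 < \<delta>" "\<delta> \<le> c / 12" for r \<delta> \<epsilon>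
  proof -
    have r0: "0 < r" using ir c(1) r by linarith
    have \<delta>3: "3 * \<delta> \<le> c / 4" "\<delta> \<le> inj_radius \<Gamma>" using \<delta> ir c(1) by linarith+
    define B where "B = C1 * \<delta> ^ n * r / \<delta>"
    have B0: "0 \<le> B" using C1 \<delta>(1) r0 by (simp add: B_def)
    have B: "real CARD('n) * (\<integral>\<^sup>+u. indicator (return_set r \<delta>) (J hyp_origin, J (0, u)) \<partial>sphere_measure) \<le> ennreal B"
      if J: "hyp_isometry J" for J
    proof -
      let ?Y = "real CARD('n) * (\<integral>\<^sup>+u. indicator (return_set r \<delta>) (J hyp_origin, J (0, u)) \<partial>sphere_measure)"
      let ?b = "(2 * cosh (c / 2)) ^ (n - 1) * (\<omega> * sinh (3 * \<delta>) ^ n) * (n * s0 * (3 * r))"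
      have b0: "0 \<le> ?b" using pos r0 \<delta>(1) by simp
      have "ennreal v0 * (ennreal \<delta> * ?Y) \<le> ennreal ?b"
        using return_directions[OF c \<delta>(1) \<delta>3(1) r J] by (simp only: v0_def \<omega>_def s0_def n_def)
      then have "ennreal \<delta> * ?Y \<le> ennreal (?b / v0)" by (rule ennreal_le_divideI[OF pos(3) b0])
      then have "?Y \<le> ennreal (?b / v0 / \<delta>)"
        using b0 pos(3) by (intro ennreal_le_divideI[OF \<delta>(1)] divide_nonneg_pos)
      also have "?b / v0 / \<delta> \<le> B"
      proof -
        have "sinh (3 * \<delta>) \<le> 3 * \<delta> * cosh (3 * \<delta>)" using \<delta>(1) by (intro sinh_le_mult_cosh) simp
        also have "\<dots> \<le> 3 * \<delta> * cosh c"
          using \<delta> c(1) by (intro mult_left_mono) (auto simp: cosh_real_nonneg_le_iff)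
        finally have "sinh (3 * \<delta>) ^ n \<le> (3 * \<delta> * cosh c) ^ n" using \<delta>(1) by (intro power_mono) auto
        then have "sinh (3 * \<delta>) ^ n \<le> (3 * cosh c) ^ n * \<delta> ^ n" by (simp add: power_mult_distrib mult_ac)
        then have "?b / v0 / \<delta> \<le> (2 * cosh (c / 2)) ^ (n - 1) * (\<omega> * ((3 * cosh c) ^ n * \<delta> ^ n)) * (n * s0 * (3 * r)) / v0 / \<delta>"
          using pos r0 \<delta>(1) by (intro divide_right_mono mult_right_mono mult_left_mono) auto
        also have "\<dots> = B" by (simp add: B_def C1_def)
        finally show ?thesis .
      qed
      finally show ?thesis using ennreal_leI by simp
    qed
    define b where "b = C2 * \<delta> ^ (n - 2) * r\<^sup>2"
    have "measure (liouville \<Gamma>) (tight_set \<Gamma> r \<epsilon> \<delta>) \<le> b / d"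
      unfolding d_def
    proof (rule measure_liouville_le)
      show "0 \<le> b" using C2 \<delta>(1) by (simp add: b_def)
      fix X :: "('n mink \<times> 'n mink) set"
      assume X: "X \<in> sets liouville_cover" "X \<subseteq> dirichlet_domain \<Gamma>"
        and T: "\<And>p. p \<in> X \<Longrightarrow> vector_class \<Gamma> p \<in> tight_set \<Gamma> r \<epsilon> \<delta>"
      have ret: "ennreal \<delta> \<le> (\<integral>\<^sup>+s. indicator (return_set r \<delta>) (hyp_flow s (x, v)) * indicator {0<..r} s \<partial>lborel)"
        if "(x, v) \<in> X" for x v
      proof -
        have "(x, v) \<in> unit_tangent" using that X(2) by (auto simp: dirichlet_domain_def)
        moreover have "tight \<Gamma> r \<epsilon> \<delta> (vector_class \<Gamma> (x, v))" using T[OF that] by (simp add: tight_set_def)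
        ultimately show ?thesis by (rule tight_return_time[OF _ _ \<delta>(1) \<delta>3(2) r])
      qed
      have "ennreal (n * \<delta>) * emeasure liouville_cover X \<le> ennreal (N * (r * B * V))"
        unfolding n_def N_def V_def \<omega>_def
        by (rule recurrent_vectors_measure[OF c less_imp_le[OF R(1)] R(2) \<delta>(1) \<delta>3(1) r X ret B0 B])
      then have "emeasure liouville_cover X \<le> ennreal (N * (r * B * V) / (n * \<delta>))"
        using n \<delta>(1) r0 B0 pos by (intro ennreal_le_divideI) auto
      also have "N * (r * B * V) / (n * \<delta>) = b"
      proof -
        have "n = (n - 2) + 2" using n by simp
        then have "\<delta> ^ n = \<delta> ^ (n - 2) * \<delta>\<^sup>2" by (metis power_add)
        then show ?thesis using \<delta>(1) n
          by (simp add: b_def B_def C2_def power2_eq_square field_simps)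
      qed
      finally show "emeasure liouville_cover X \<le> ennreal b" .
    qed
    also have "b / d \<le> (C2 / d + 1) * \<delta> ^ (n - 2) * r\<^sup>2"
      using \<delta>(1) by (simp add: b_def algebra_simps)
    finally show ?thesis .
  qed
  show ?thesis
  proof (rule exI[of _ "C2 / d + 1"], rule conjI, goal_cases)
    case 1
    show "0 < C2 / d + 1" using C2 pos by (simp add: add_nonneg_pos)
  next
    case 2
    show ?case
      using c(1) main by (intro exI[of _ "c / 12"]) (simp add: n_def)
  qed
qed

end
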